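(* Let $W=G(de,e,n)$ acting on $V=\mathbb{C}^n$, with integers $d,e \geq 1$ and $n\ge 2$, $de \geq 2$. For $0\le r\le n$ let $H_r=\operatorname{Hilb}((S(V^* )\otimes \wedge V^*\otimes \wedge^r V)^W, q,t)$. Then: (i) For $r=0$, $$H_0=\frac{(-tq^{de-1};q^{de})_{n-1}\, (1+tq^{dn-1})}{(q^{de};q^{de})_{n-1}\, (1-q^{dn})}.$$ (ii) For $1\le r\le n-1$ and $d\ge 2$, $$H_r=q^{de\binom{r}{2}+r}\,\frac{(-tq^{-1};q^{-de})_r\, (-tq^{de-1};q^{de})_{n-1-r}}{(q^{de};q^{de})_r\, (q^{de};q^{de})_{n-r}\,(1-q^{dn})}\left(1-q^{den}+tq^{-1}\big(q^{de(n-r)}(1-q^{dn})+q^{dn}-q^{den}\big)\right).$$ (iii) For $1\le r\le n-1$ and $d=1$, $$\begin{aligned} H_r=\;& q^{e\binom{r}{2}}\,\frac{(-tq^{-1};q^{-e})_{r-1}\, (-tq^{e-1};q^{e})_{n-1-r}}{(q^{e};q^{e})_{r}\, (q^{e};q^{e})_{n-r}\, (1-q^n)}\Big( q^r (1+tq^{(n-r)e-1}) (1+tq^{-(r-1)e-1}) (1-q^n)\\ &\quad + q^{(n-r)(e-1)-1} (1+tq^{e-1}) (1-q^n) (q+t) + q^{r-1} (1+tq^{-(r-1)e-1}) (q+t)(q^n-q^{n(e-1)}) \Big). \end{aligned}$$ (iv) For $r=n$, $$H_n=q^{de\binom{n-1}{2}+n-1}\,\frac{(-tq^{-1};q^{-de})_{n-1}}{(q^{de};q^{de})_{n-1}\,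 (1-q^{dn})}\cdot\begin{cases} q^{de(n-1)+1}+t & \text{if } d\ge 2,\\ q^{(n-1)(e-1)}+t & \text{if } d=1.\end{cases}$$
   Context: For positive integers $d,e,n$, $G(de,e,n)$ is the group of monomial $n\times n$ complex matrices (exactly one nonzero entry in each row and column) whose nonzero entries are all $(de)$-th roots of unity and for which the product of the nonzero entries is a $d$-th root of unity. It acts on $V=\mathbb{C}^n$ by matrix multiplication, and on $V^*$ dually. $S(V^* )=\bigoplus_i S^i(V^* )$ is the symmetric algebra graded by polynomial degree, and $\operatorname{Hilb}((S(V^* )\otimes \wedge V^*\otimes \wedge^r V)^W,q,t)=\sum_{i,k}\dim_{\mathbb{C}}(S^i(V^* )\otimes\wedge^kV^*\otimes\wedge^rV)^W\,q^it^k$. Notation: $(z;q)_k=(1-z)(1-zq)\cdots(1-zq^{k-1})$, with $(z;q)_0=1$. *)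

theory Defs
  imports
    "Jordan_Normal_Form.Determinant"
    "Jordan_Normal_Form.DL_Submatrix"
    "Jordan_Normal_Form.Gauss_Jordan_Elimination"
    "HOL-Library.Poly_Mapping"
    "HOL-Library.Function_Algebras"
    "HOL-Computational_Algebra.Formal_Laurent_Series"
begin

section \<open>The groups $G(de,e,n)$\<close>

definition monomial_mat :: "nat \<Rightarrow> complex mat \<Rightarrow> bool" where
  "monomial_mat n A \<longleftrightarrow> A \<in> carrier_mat n n
     \<and> (\<forall>i<n. \<exists>!j. j < n \<and> A $$ (i, j) \<noteq> 0)
     \<and> (\<forall>j<n. \<exists>!i. i < n \<and> A $$ (i, j) \<noteq> 0)"

definition nonzero_positions :: "complex mat \<Rightarrow> (nat \<times> nat) set" where
  "nonzero_positions A = {p. fst p < dim_row A \<and> snd p < dim_col A \<and> A $$ p \<noteq> 0}"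

definition G_group :: "nat \<Rightarrow> nat \<Rightarrow> nat \<Rightarrow> complex mat set" where
  "G_group d e n = {A. monomial_mat n A
     \<and> (\<forall>p\<in>nonzero_positions A. (A $$ p) ^ (d * e) = 1)
     \<and> (\<Prod>p\<in>nonzero_positions A. A $$ p) ^ d = 1}"


section \<open>The representations $S^i(V^*) \otimes \wedge^k V^* \otimes \wedge^r V$\<close>

text \<open>
  Throughout, a linear map of an $n$-dimensional space $U$ with basis $u_0,\dots,u_{n-1}$ is given
  by its matrix $A$, column $i$ holding the coordinates of the image of $u_i$.  For $V$ the basis
  is the standard one, for $V^*$ it is the dual basis $x_0,\dots,x_{n-1}$.  An element $g$ acts on
  $V^*$ by $(g \varphi)(v) = \varphi(g^{-1} v)$, so that $g x_i = \sum_j (g^{-1})_{ij} x_j$.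
\<close>

definition dual_mat :: "complex mat \<Rightarrow> complex mat" where
  "dual_mat g = transpose_mat (the (mat_inverse g))"

text \<open>
  The symmetric algebra $S(U)$ is the polynomial ring in the $u_i$, rendered as
  \<^typ>\<open>(nat \<Rightarrow>\<^sub>0 nat) \<Rightarrow>\<^sub>0 complex\<close>; a monomial $u^a$ is its exponent vector $a$.  The map $A$
  acts by the algebra endomorphism extending it: $u^a \mapsto \prod_i (A u_i)^{a_i}$.
\<close>

definition linear_form :: "complex mat \<Rightarrow> nat \<Rightarrow> ((nat \<Rightarrow>\<^sub>0 nat) \<Rightarrow>\<^sub>0 complex)" where
  "linear_form A i = (\<Sum>j<dim_row A. Poly_Mapping.single (Poly_Mapping.single j 1) (A $$ (j, i)))"

definition sym_action :: "complex mat \<Rightarrow> (nat \<Rightarrow>\<^sub>0 nat) \<Rightarrow> ((nat \<Rightarrow>\<^sub>0 nat) \<Rightarrow>\<^sub>0 complex)" where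
  "sym_action A a = (\<Prod>i<dim_col A. linear_form A i ^ Poly_Mapping.lookup a i)"

definition sym_basis :: "nat \<Rightarrow> nat \<Rightarrow> (nat \<Rightarrow>\<^sub>0 nat) set" where
  "sym_basis n i = {a. Poly_Mapping.keys a \<subseteq> {..<n} \<and> (\<Sum>j<n. Poly_Mapping.lookup a j) = i}"

text \<open>
  The exterior power $\wedge^k U$ has the basis $u_I = u_{i_1} \wedge \dots \wedge u_{i_k}$
  indexed by the $k$-subsets $I = \{i_1 < \dots < i_k\}$ of $\{0,\dots,n-1\}$.  Expanding
  $A u_{i_1} \wedge \dots \wedge A u_{i_k}$, the coefficient of $u_K$ is the minor of $A$ with
  rows $K$ and columns $I$.
\<close>

definition ext_basis :: "nat \<Rightarrow> nat \<Rightarrow> nat set set" where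
  "ext_basis n k = {I. I \<subseteq> {..<n} \<and> card I = k}"

definition ext_coeff :: "complex mat \<Rightarrow> nat set \<Rightarrow> nat set \<Rightarrow> complex" where
  "ext_coeff A K I = det (submatrix A K I)"

text \<open>
  The index \<open>(a, I, J)\<close> stands for the basis vector $x^a \otimes x_I \otimes e_J$ of the tensor
  product.  Elements of the tensor product are their coordinate functions with respect to this
  basis (extended by zero).
\<close>

type_synonym tensor_index = "(nat \<Rightarrow>\<^sub>0 nat) \<times> nat set \<times> nat set"

definition tensor_basis :: "nat \<Rightarrow> nat \<Rightarrow> nat \<Rightarrow> nat \<Rightarrow> tensor_index set" where
  "tensor_basis n i k r = sym_basis n i \<times> ext_basis n k \<times> ext_basis n r"

text \<open>
  The coefficient of $x^b \otimes x_K \otimes e_L$ in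
  $g(x^a \otimes x_I \otimes e_J) = g x^a \otimes g x_I \otimes g e_J$:
\<close>

definition tensor_coeff :: "complex mat \<Rightarrow> tensor_index \<Rightarrow> tensor_index \<Rightarrow> complex" where
  "tensor_coeff g = (\<lambda>(b, K, L) (a, I, J).
     Poly_Mapping.lookup (sym_action (dual_mat g) a) b * ext_coeff (dual_mat g) K I * ext_coeff g L J)"

definition tensor_space ::
    "nat \<Rightarrow> nat \<Rightarrow> nat \<Rightarrow> nat \<Rightarrow> (tensor_index \<Rightarrow> complex) set" where
  "tensor_space n i k r = {f. \<forall>b. b \<notin> tensor_basis n i k r \<longrightarrow> f b = 0}"

definition tensor_action ::
    "nat \<Rightarrow> nat \<Rightarrow> nat \<Rightarrow> nat \<Rightarrow> complex mat \<Rightarrow> (tensor_index \<Rightarrow> complex) \<Rightarrow> (tensor_index \<Rightarrow> complex)"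
  where
  "tensor_action n i k r g f = (\<lambda>b. if b \<in> tensor_basis n i k r
     then \<Sum>c\<in>tensor_basis n i k r. tensor_coeff g b c * f c else 0)"

definition tensor_invariants ::
    "nat \<Rightarrow> nat \<Rightarrow> nat \<Rightarrow> nat \<Rightarrow> complex mat set \<Rightarrow> (tensor_index \<Rightarrow> complex) set" where
  "tensor_invariants n i k r W =
     {f \<in> tensor_space n i k r. \<forall>g\<in>W. tensor_action n i k r g f = f}"

text \<open>
  The sums in \<^const>\<open>tensor_action\<close> are finite and all spaces are finite-dimensional.
\<close>

lemma finite_tensor_basis: "finite (tensor_basis n i k r)"
proof -
  have "sym_basis n i \<subseteq> {a. Poly_Mapping.keys a \<subseteq> {..<n} \<and> (\<forall>j. Poly_Mapping.lookup a j \<le> i)}"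
  proof safe
    fix a j assume a: "a \<in> sym_basis n i"
    show "Poly_Mapping.lookup a j \<le> i"
    proof (cases "j < n")
      case True
      then have "Poly_Mapping.lookup a j \<le> (\<Sum>j<n. Poly_Mapping.lookup a j)"
        by (intro member_le_sum) auto
      with a show ?thesis by (simp add: sym_basis_def)
    next
      case False
      with a have "j \<notin> Poly_Mapping.keys a" by (auto simp: sym_basis_def)
      then show ?thesis by (simp add: in_keys_iff)
    qed
  qed (auto simp: sym_basis_def)
  moreover have "finite {a :: nat \<Rightarrow>\<^sub>0 nat. Poly_Mapping.keys a \<subseteq> {..<n} \<and> (\<forall>j. Poly_Mapping.lookup a j \<le> i)}" (is "finite ?S")
  proof (rule finite_imageD)
    have "Poly_Mapping.lookup ` ?S \<subseteq> {f. \<forall>j. (j \<in> {..<n} \<longrightarrow> f j \<in> {..i}) \<and> (j \<notin> {..<n} \<longrightarrow> f j = 0)}"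
      by (auto simp: in_keys_iff subset_iff)
    then show "finite (Poly_Mapping.lookup ` ?S)"
      by (rule finite_subset) (intro finite_set_of_finite_funs; simp)
    show "inj_on Poly_Mapping.lookup ?S" by (simp add: inj_on_def)
  qed
  ultimately have "finite (sym_basis n i)" by (rule finite_subset)
  moreover have "finite (ext_basis n m)" for m
    by (rule finite_subset[of _ "Pow {..<n}"]) (auto simp: ext_basis_def)
  ultimately show ?thesis by (simp add: tensor_basis_def)
qed


section \<open>Hilbert series\<close>

definition cscale :: "complex \<Rightarrow> ('a \<Rightarrow> complex) \<Rightarrow> ('a \<Rightarrow> complex)" where
  "cscale c f = (\<lambda>x. c * f x)"

interpretation cfun: vector_space "cscale :: complex \<Rightarrow> ('a \<Rightarrow> complex) \<Rightarrow> ('a \<Rightarrow> complex)"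
  by unfold_locales (auto simp: cscale_def plus_fun_def algebra_simps)

text \<open>
  Series live in the field of Laurent series in $q$ over the field of Laurent series in $t$,
  which contains the negative powers of $q$ occurring in product formulas.
\<close>

definition hilbert_series :: "nat \<Rightarrow> complex mat set \<Rightarrow> nat \<Rightarrow> rat fls fls" where
  "hilbert_series n W r =
     fps_to_fls (Abs_fps (\<lambda>i. fps_to_fls (Abs_fps (\<lambda>k.
       of_nat (vector_space.dim cscale (tensor_invariants n i k r W))))))"

definition q_pochhammer :: "'a :: comm_ring_1 \<Rightarrow> 'a \<Rightarrow> nat \<Rightarrow> 'a" where
  "q_pochhammer z q k = (\<Prod>j<k. 1 - z * q ^ j)"

end

theory Submission
  imports Defs "HOL-Combinatorics.Combinatorics"
begin

text \<open>
  A diagonal matrix with entries $z_0,\dots,z_{n-1}$ multiplies the basis vector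
  $x^a \otimes x_I \otimes e_J$ by $\prod_i z_i^{-c_i}$, where $c_i = a_i + [i \in I] - [i \in J]$, and a
  permutation matrix permutes the basis vectors up to sign.  So the group acts on the basis by
  permutations up to nonzero scalars, and the dimension of the space of invariants is the number of
  orbits on which point stabilisers act trivially (\<open>dim_scaled_equivalence\<close>).

  Read a basis vector as a word of $n$ letters $(a_i, [i \in I], [i \in J])$.  Its orbit is the multiset
  of its letters.  Two conditions make the stabiliser act trivially (\<open>stabiliser_trivial_iff\<close>).  The
  diagonal matrices in the group act trivially iff all charges $c_i$ are congruent modulo $de$ to the
  same $sd$, for some $s < e$.  Exchanging two equal letters gives the sign $-1$ exactly when one of
  the two bits is set and the other is not; such a letter, called fermionic, may occur only once,
  whereas the others may be repeated.  Hence the Hilbert series counts multisets of letters, weighted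
  by $q^{\sum a}$ and by one $t$ for each letter whose first bit is set, and it is a sum over the $e$
  sectors given by $s$.

  Put $Q = q^{de}$.  In one sector, the letters with second bit $0$ and those with second bit $1$ are
  chosen independently, $n - r$ of the former and $r$ of the latter.  In either case the available
  letters form one arithmetic progression of bosonic and one of fermionic letters, both with common
  ratio $Q$ in weight.  If the first letters of the progressions have weights $x$ and $y$, the multisets
  of $k$ letters have the generating function
  \[ \prod_{j<k} \frac{x + y Q^j}{1 - Q^{j+1}} \]
  (\<open>gf_fermi_bose\<close>), which is the $q$-binomial theorem.  For $0 < s$ the pairs $(x, y)$ are
  $q^{sd} (1, t/q)$ and $q^{sd} (t, q)$.  For $s = 0$ the first pair is $(1, t q^{de-1})$ instead,
  because exponents cannot be negative.  For $d = 1$ and $s = e - 1$ the second pair is $(t q^{e-1}, 1)$,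
  because the exponent $sd + 1$ wraps around modulo $de$; this is why $d = 1$ is a separate case.
  The sum over the remaining sectors is geometric, and extracting common factors gives the formulas.
\<close>

section \<open>Minors of scaled permutation matrices\<close>

text \<open>
  The matrix sending the basis vector $u_j$ to \<open>z j\<close> times $u_{\sigma j}$.
\<close>

definition scaled_perm :: "nat \<Rightarrow> (nat \<Rightarrow> nat) \<Rightarrow> (nat \<Rightarrow> complex) \<Rightarrow> complex mat" where
  "scaled_perm n \<sigma> z = mat n n (\<lambda>(i, j). if i = \<sigma> j then z j else 0)"

lemma scaled_perm_carrier [simp]: "scaled_perm n \<sigma> z \<in> carrier_mat n n"
  by (simp add: scaled_perm_def)

lemma scaled_perm_dims [simp]: "dim_row (scaled_perm n \<sigma> z) = n" "dim_col (scaled_perm n \<sigma> z) = n"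
  by (simp_all add: scaled_perm_def)

lemma scaled_perm_index:
  "i < n \<Longrightarrow> j < n \<Longrightarrow> scaled_perm n \<sigma> z $$ (i, j) = (if i = \<sigma> j then z j else 0)"
  by (simp add: scaled_perm_def)

lemma scaled_perm_cong:
  "(\<And>j. j < n \<Longrightarrow> z j = z' j) \<Longrightarrow> scaled_perm n \<sigma> z = scaled_perm n \<sigma> z'"
  by (auto simp: scaled_perm_def)

lemma permutes_less: "\<sigma> permutes {..<n} \<Longrightarrow> j < n \<Longrightarrow> \<sigma> j < (n :: nat)"
  using permutes_in_image[of \<sigma> "{..<n}" j] by simp

lemma scaled_perm_mult:
  assumes "\<sigma> permutes {..<n}" "\<tau> permutes {..<n}"
  shows "scaled_perm n \<sigma> z * scaled_perm n \<tau> w = scaled_perm n (\<sigma> \<circ> \<tau>) (\<lambda>j. z (\<tau> j) * w j)"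
proof (rule eq_matI)
  fix i j assume "i < dim_row (scaled_perm n (\<sigma> \<circ> \<tau>) (\<lambda>j. z (\<tau> j) * w j))"
    "j < dim_col (scaled_perm n (\<sigma> \<circ> \<tau>) (\<lambda>j. z (\<tau> j) * w j))"
  hence ij: "i < n" "j < n" by auto
  have "(scaled_perm n \<sigma> z * scaled_perm n \<tau> w) $$ (i, j) =
      (\<Sum>k<n. scaled_perm n \<sigma> z $$ (i, k) * scaled_perm n \<tau> w $$ (k, j))"
    using ij by (simp add: scalar_prod_def atLeast0LessThan)
  also have "\<dots> = (\<Sum>k<n. if k = \<tau> j then (if i = \<sigma> k then z k else 0) * w j else 0)"
    using ij by (intro sum.cong) (auto simp: scaled_perm_index)
  also have "\<dots> = scaled_perm n (\<sigma> \<circ> \<tau>) (\<lambda>j. z (\<tau> j) * w j) $$ (i, j)"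
    using ij permutes_less[OF assms(2) ij(2)] by (simp add: scaled_perm_index)
  finally show "(scaled_perm n \<sigma> z * scaled_perm n \<tau> w) $$ (i, j) =
    scaled_perm n (\<sigma> \<circ> \<tau>) (\<lambda>j. z (\<tau> j) * w j) $$ (i, j)" .
qed auto

lemma scaled_perm_one: "scaled_perm n id (\<lambda>_. 1) = 1\<^sub>m n"
  by (rule eq_matI) (auto simp: scaled_perm_index)

lemma dual_mat_scaled_perm:
  assumes \<sigma>: "\<sigma> permutes {..<n}" and z: "\<And>j. j < n \<Longrightarrow> z j \<noteq> 0"
  shows "dual_mat (scaled_perm n \<sigma> z) = scaled_perm n \<sigma> (\<lambda>j. inverse (z j))"
proof -
  let ?A = "scaled_perm n \<sigma> z"
  define B where "B = scaled_perm n (Hilbert_Choice.inv \<sigma>) (\<lambda>i. inverse (z (Hilbert_Choice.inv \<sigma> i)))"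
  have inv: "Hilbert_Choice.inv \<sigma> permutes {..<n}" using \<sigma> by (rule permutes_inv)
  have AB: "?A * B = 1\<^sub>m n"
    unfolding B_def scaled_perm_mult[OF \<sigma> inv] permutes_inv_o[OF \<sigma>] scaled_perm_one[symmetric]
    by (rule scaled_perm_cong) (use z permutes_less[OF inv] in simp)
  have BA: "B * ?A = 1\<^sub>m n"
    unfolding B_def scaled_perm_mult[OF inv \<sigma>] permutes_inv_o[OF \<sigma>] scaled_perm_one[symmetric]
    by (rule scaled_perm_cong) (use z permutes_inverses(2)[OF \<sigma>] in simp)
  have B: "B \<in> carrier_mat n n" by (simp add: B_def)
  have "?A \<in> Units (ring_mat TYPE(complex) n ())"
    using AB BA B by (auto simp: Units_def ring_mat_simps)
  then obtain C where C: "mat_inverse ?A = Some C"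
    using mat_inverse(1)[of ?A n "()"] by fastforce
  hence C': "C * ?A = 1\<^sub>m n" "C \<in> carrier_mat n n"
    using mat_inverse(2)[of ?A n C] by auto
  have "C = C * (?A * B)" using C' AB by simp
  also have "\<dots> = (C * ?A) * B" by (rule assoc_mult_mat[OF C'(2) scaled_perm_carrier B, symmetric])
  also have "\<dots> = B" using C' B by simp
  finally have "dual_mat ?A = transpose_mat B" by (simp add: dual_mat_def C)
  also have "\<dots> = scaled_perm n \<sigma> (\<lambda>j. inverse (z j))"
  proof (rule eq_matI)
    fix i j assume "i < dim_row (scaled_perm n \<sigma> (\<lambda>j. inverse (z j)))"
      "j < dim_col (scaled_perm n \<sigma> (\<lambda>j. inverse (z j)))"
    hence ij: "i < n" "j < n" by auto
    have "j = Hilbert_Choice.inv \<sigma> i \<longleftrightarrow> i = \<sigma> j" using permutes_inverses[OF \<sigma>] by metis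
    thus "transpose_mat B $$ (i, j) = scaled_perm n \<sigma> (\<lambda>j. inverse (z j)) $$ (i, j)"
      using ij by (auto simp: B_def scaled_perm_index)
  qed (auto simp: B_def)
  finally show ?thesis .
qed

lemma bij_betw_pick:
  assumes "finite K"
  shows "bij_betw (pick K) {..<card K} K"
proof (rule bij_betw_byWitness[where f' = "\<lambda>x. card {a \<in> K. a < x}"])
  show "\<forall>i\<in>{..<card K}. card {a \<in> K. a < pick K i} = i" using card_pick by auto
  show "\<forall>x\<in>K. pick K (card {a \<in> K. a < x}) = x" using pick_card_in_set by auto
  show "pick K ` {..<card K} \<subseteq> K" using pick_in_set by auto
  have "card {a \<in> K. a < x} < card K" if "x \<in> K" for x
    using that assms by (intro psubset_card_mono) auto
  thus "(\<lambda>x. card {a \<in> K. a < x}) ` K \<subseteq> {..<card K}" by auto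
qed

text \<open>
  The definition of \<^const>\<open>submatrix\<close> intersects the index sets with the dimensions; for index
  sets within range this disappears.
\<close>

lemma submatrix_alt:
  assumes "A \<in> carrier_mat n m" "K \<subseteq> {..<n}" "L \<subseteq> {..<m}"
  shows "submatrix A K L = mat (card K) (card L) (\<lambda>(i, j). A $$ (pick K i, pick L j))"
proof -
  have "{i. i < n \<and> i \<in> K} = K" "{i. i < m \<and> i \<in> L} = L" using assms by auto
  thus ?thesis using assms(1) by (auto simp: submatrix_def)
qed

lemma pick_less: "K \<subseteq> {..<n} \<Longrightarrow> i < card K \<Longrightarrow> pick K i < n"
  using pick_in_set[of i K] by auto

lemma card_permutes_image: "\<sigma> permutes S \<Longrightarrow> card (\<sigma> ` I) = card I"
  by (meson card_image permutes_inj inj_on_subset subset_UNIV)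

lemma permutes_image_subset: "\<sigma> permutes S \<Longrightarrow> I \<subseteq> S \<Longrightarrow> \<sigma> ` I \<subseteq> S"
  using permutes_in_image by fastforce

text \<open>
  Of the sum in the Cauchy--Binet formula one term survives, since the columns $I$ of the right factor
  vanish outside the rows $\tau(I)$.  So the submatrices themselves multiply, and the determinant is
  multiplicative.  This makes the scalars of the action a cocycle without any bookkeeping of signs.
\<close>

lemma ext_coeff_mult_scaled_perm:
  assumes A: "A \<in> carrier_mat n n" and \<tau>: "\<tau> permutes {..<n}" and I: "I \<subseteq> {..<n}"
    and L: "L \<subseteq> {..<n}" "card L = card I"
  shows "ext_coeff (A * scaled_perm n \<tau> w) L I =
    ext_coeff A L (\<tau> ` I) * ext_coeff (scaled_perm n \<tau> w) (\<tau> ` I) I"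
proof -
  let ?B = "scaled_perm n \<tau> w" and ?K = "\<tau> ` I"
  have K: "?K \<subseteq> {..<n}" "card ?K = card I"
    using permutes_image_subset[OF \<tau> I] card_permutes_image[OF \<tau>] by auto
  have fin: "finite ?K" using K(1) finite_subset by blast
  have "submatrix (A * ?B) L I = submatrix A L ?K * submatrix ?B ?K I"
    unfolding submatrix_alt[OF mult_carrier_mat[OF A scaled_perm_carrier] L(1) I]
      submatrix_alt[OF A L(1) K(1)] submatrix_alt[OF scaled_perm_carrier K(1) I]
  proof (rule eq_matI, goal_cases)
    case (1 i j)
    hence ij: "i < card L" "j < card I" by auto
    have pi: "pick L i < n" "pick I j < n" using pick_less ij L I by auto
    have pj: "pick I j \<in> I" using pick_in_set ij by auto
    have "(A * ?B) $$ (pick L i, pick I j) = (\<Sum>k<n. A $$ (pick L i, k) * ?B $$ (k, pick I j))"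
      using A pi by (simp add: scalar_prod_def atLeast0LessThan)
    also have "\<dots> = (\<Sum>k\<in>?K. A $$ (pick L i, k) * ?B $$ (k, pick I j))"
    proof (rule sum.mono_neutral_right)
      show "\<forall>k\<in>{..<n} - ?K. A $$ (pick L i, k) * ?B $$ (k, pick I j) = 0"
        using pj pi by (auto simp: scaled_perm_index)
    qed (use K in auto)
    also have "\<dots> = (\<Sum>k<card ?K. A $$ (pick L i, pick ?K k) * ?B $$ (pick ?K k, pick I j))"
      by (rule sum.reindex_bij_betw[OF bij_betw_pick[OF fin], symmetric])
    finally show ?case using ij by (simp add: scalar_prod_def atLeast0LessThan)
  qed auto
  moreover have "submatrix A L ?K \<in> carrier_mat (card I) (card I)"
    using submatrix_alt[OF A L(1) K(1)] L(2) K(2) by auto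
  moreover have "submatrix ?B ?K I \<in> carrier_mat (card I) (card I)"
    using submatrix_alt[OF scaled_perm_carrier K(1) I] K(2) by auto
  ultimately show ?thesis unfolding ext_coeff_def by (simp add: det_mult)
qed

text \<open>
  By cardinality some row in $K$ lies outside $\sigma(I)$, and it is zero in the submatrix.
\<close>

lemma ext_coeff_scaled_perm_zero:
  assumes I: "I \<subseteq> {..<n}" and K: "K \<subseteq> {..<n}" "card K = card I" "K \<noteq> \<sigma> ` I" and \<sigma>: "\<sigma> permutes {..<n}"
  shows "ext_coeff (scaled_perm n \<sigma> z) K I = 0"
proof -
  have "\<not> K \<subseteq> \<sigma> ` I"
    using K card_subset_eq[of "\<sigma> ` I" K] card_permutes_image[OF \<sigma>, of I] I finite_subset by fastforce
  then obtain x where x: "x \<in> K" "x \<notin> \<sigma> ` I" by auto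
  have finK: "finite K" using K(1) finite_subset by blast
  obtain i where i: "i < card K" "pick K i = x"
    using bij_betw_imp_surj_on[OF bij_betw_pick[OF finK]] x(1) by (metis image_iff lessThan_iff)
  let ?M = "submatrix (scaled_perm n \<sigma> z) K I"
  have M: "?M = mat (card K) (card I) (\<lambda>(i, j). scaled_perm n \<sigma> z $$ (pick K i, pick I j))"
    by (rule submatrix_alt[OF scaled_perm_carrier K(1) I])
  have zero: "?M $$ (i, j) = 0" if "j < card I" for j
  proof -
    have "pick I j \<in> I" using pick_in_set that by auto
    hence "pick K i \<noteq> \<sigma> (pick I j)" using x i by auto
    thus ?thesis using that i pick_less[OF I that] pick_less[OF K(1) i(1)]
      by (simp add: M scaled_perm_index)
  qed
  have "det ?M = (\<Sum>p | p permutes {0..<card I}. signof p * (\<Prod>j = 0..<card I. ?M $$ (j, p j)))"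
    using M K(2) by (intro det_def') auto
  also have "\<dots> = 0"
  proof (rule sum.neutral, rule ballI)
    fix p assume p: "p \<in> {p. p permutes {0..<card I}}"
    have "p i < card I" using p i(1) K(2) permutes_in_image[of p "{0..<card I}" i] by simp
    hence "?M $$ (i, p i) = 0" by (rule zero)
    hence "(\<Prod>j = 0..<card I. ?M $$ (j, p j)) = 0"
      using i(1) K(2) by (intro prod_zero bexI[of _ i]) auto
    thus "signof p * (\<Prod>j = 0..<card I. ?M $$ (j, p j)) = 0" by simp
  qed
  finally show ?thesis by (simp add: ext_coeff_def)
qed

lemma ext_coeff_diagonal:
  assumes I: "I \<subseteq> {..<n}"
  shows "ext_coeff (scaled_perm n id z) I I = (\<Prod>i\<in>I. z i)"
proof -
  have fin: "finite I" using I finite_subset by blast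
  let ?M = "submatrix (scaled_perm n id z) I I"
  have M: "?M = mat (card I) (card I) (\<lambda>(i, j). scaled_perm n id z $$ (pick I i, pick I j))"
    by (rule submatrix_alt[OF scaled_perm_carrier I I])
  have inj: "pick I i = pick I j \<longleftrightarrow> i = j" if "i < card I" "j < card I" for i j
    using bij_betw_imp_inj_on[OF bij_betw_pick[OF fin]] that by (auto simp: inj_on_def)
  have entry: "?M $$ (i, j) = (if i = j then z (pick I j) else 0)" if "i < card I" "j < card I" for i j
    using that pick_less[OF I] by (simp add: M scaled_perm_index inj)
  have "det ?M = prod_list (diag_mat ?M)"
    by (rule det_lower_triangular[of "card I"]) (auto simp: entry, simp add: M)
  also have "\<dots> = (\<Prod>i<card I. ?M $$ (i, i))"
    by (simp add: prod_list_diag_prod M atLeast0LessThan)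
  also have "\<dots> = (\<Prod>i<card I. z (pick I i))" by (rule prod.cong) (auto simp: entry)
  also have "\<dots> = (\<Prod>i\<in>I. z i)"
    by (rule prod.reindex_bij_betw[OF bij_betw_pick[OF fin]])
  finally show ?thesis by (simp add: ext_coeff_def)
qed

text \<open>
  The submatrix is the identity matrix, or the identity matrix with two rows exchanged.
\<close>

lemma ext_coeff_transpose:
  assumes I: "I \<subseteq> {..<n}" and ab: "a \<noteq> b" "a \<in> I \<longleftrightarrow> b \<in> I"
  shows "ext_coeff (scaled_perm n (transpose a b) (\<lambda>_. 1)) I I = (if a \<in> I then -1 else 1)"
proof -
  have fin: "finite I" using I finite_subset by blast
  let ?M = "submatrix (scaled_perm n (transpose a b) (\<lambda>_. 1)) I I"
  have M: "?M = mat (card I) (card I) (\<lambda>(i, j). scaled_perm n (transpose a b) (\<lambda>_. 1) $$ (pick I i, pick I j))"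
    by (rule submatrix_alt[OF scaled_perm_carrier I I])
  have inj: "pick I i = pick I j \<longleftrightarrow> i = j" if "i < card I" "j < card I" for i j
    using bij_betw_imp_inj_on[OF bij_betw_pick[OF fin]] that by (auto simp: inj_on_def)
  have entry: "?M $$ (i, j) = (if pick I i = transpose a b (pick I j) then 1 else 0)"
    if "i < card I" "j < card I" for i j
    using that pick_less[OF I] by (simp add: M scaled_perm_index)
  show ?thesis
  proof (cases "a \<in> I")
    case True
    hence "b \<in> I" using ab by simp
    have ex: "\<exists>k. k < card I \<and> pick I k = x" if "x \<in> I" for x
    proof -
      have "x \<in> pick I ` {..<card I}"
        using bij_betw_imp_surj_on[OF bij_betw_pick[OF fin]] that by simp
      thus ?thesis by auto
    qed
    obtain k l where kl: "k < card I" "pick I k = a" "l < card I" "pick I l = b"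
      using ex[OF True] ex[OF \<open>b \<in> I\<close>] by blast
    have "?M = swaprows_mat (card I) k l"
    proof (rule eq_matI)
      fix i j assume "i < dim_row (swaprows_mat (card I) k l :: complex mat)"
        "j < dim_col (swaprows_mat (card I) k l :: complex mat)"
      hence ij: "i < card I" "j < card I" by (auto simp: swaprows_mat_def)
      have "transpose a b (pick I j) = pick I (transpose k l j)"
        using inj[OF ij(2) kl(1)] inj[OF ij(2) kl(3)] kl by (auto simp: transpose_def)
      moreover have "transpose k l j < card I" using ij kl by (simp add: transpose_def)
      ultimately have "pick I i = transpose a b (pick I j) \<longleftrightarrow> i = transpose k l j"
        using inj ij(1) by simp
      also have "\<dots> \<longleftrightarrow> k = i \<and> l = j \<or> k = j \<and> l = i \<or> i = j \<and> i \<noteq> k \<and> i \<noteq> l"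
        by (auto simp: transpose_def)
      finally show "?M $$ (i, j) = swaprows_mat (card I) k l $$ (i, j)"
        using ij by (simp add: entry swaprows_mat_def)
    qed (auto simp: M swaprows_mat_def)
    moreover have "k \<noteq> l" using kl ab by auto
    ultimately show ?thesis using det_swaprows_mat[of k "card I" l] kl True by (simp add: ext_coeff_def)
  next
    case False
    have "?M = 1\<^sub>m (card I)"
    proof (rule eq_matI)
      fix i j assume "i < dim_row (1\<^sub>m (card I) :: complex mat)" "j < dim_col (1\<^sub>m (card I) :: complex mat)"
      hence ij: "i < card I" "j < card I" by auto
      have "pick I j \<in> I" using pick_in_set ij by auto
      hence "transpose a b (pick I j) = pick I j" using False ab by (metis transpose_apply_other)
      thus "?M $$ (i, j) = 1\<^sub>m (card I) $$ (i, j)" using ij by (simp add: entry inj)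
    qed (auto simp: M)
    thus ?thesis using False by (simp add: ext_coeff_def)
  qed
qed

section \<open>The action on basis vectors\<close>

lemma single_var_power:
  "Poly_Mapping.single (Poly_Mapping.single x 1) (c :: complex) ^ m =
     Poly_Mapping.single (Poly_Mapping.single (x :: nat) (m :: nat)) (c ^ m)"
  by (induction m) (simp_all add: mult_single single_add[symmetric])

lemma prod_single:
  fixes c :: "'i \<Rightarrow> complex" and f :: "'i \<Rightarrow> (nat \<Rightarrow>\<^sub>0 nat)"
  shows "(\<Prod>x\<in>A. Poly_Mapping.single (f x) (c x)) = Poly_Mapping.single (\<Sum>x\<in>A. f x) (\<Prod>x\<in>A. c x)"
  by (induction A rule: infinite_finite_induct) (simp_all add: mult_single)

text \<open>
  The exponent vector of $x^a$ after the substitution $x_i \mapsto x_{\sigma i}$.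
\<close>

definition permute_exponents :: "(nat \<Rightarrow> nat) \<Rightarrow> (nat \<Rightarrow>\<^sub>0 nat) \<Rightarrow> (nat \<Rightarrow>\<^sub>0 nat)" where
  "permute_exponents \<sigma> a = Poly_Mapping.map_key (Hilbert_Choice.inv \<sigma>) a"

lemma lookup_permute_exponents:
  "\<sigma> permutes S \<Longrightarrow> Poly_Mapping.lookup (permute_exponents \<sigma> a) x =
     Poly_Mapping.lookup a (Hilbert_Choice.inv \<sigma> x)"
  by (simp add: permute_exponents_def map_key.rep_eq permutes_inj[OF permutes_inv])

lemma sym_action_scaled_perm:
  assumes \<sigma>: "\<sigma> permutes {..<n}" and a: "Poly_Mapping.keys a \<subseteq> {..<n}"
  shows "sym_action (scaled_perm n \<sigma> z) a =
    Poly_Mapping.single (permute_exponents \<sigma> a) (\<Prod>i<n. z i ^ Poly_Mapping.lookup a i)"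
proof -
  have lf: "linear_form (scaled_perm n \<sigma> z) i = Poly_Mapping.single (Poly_Mapping.single (\<sigma> i) 1) (z i)"
    if "i < n" for i
  proof -
    have "linear_form (scaled_perm n \<sigma> z) i =
        (\<Sum>j<n. if j = \<sigma> i then Poly_Mapping.single (Poly_Mapping.single j 1) (z i) else 0)"
      unfolding linear_form_def using that by (intro sum.cong) (auto simp: scaled_perm_index)
    thus ?thesis using permutes_less[OF \<sigma> that] by simp
  qed
  have "sym_action (scaled_perm n \<sigma> z) a =
      (\<Prod>i<n. Poly_Mapping.single (Poly_Mapping.single (\<sigma> i) (Poly_Mapping.lookup a i))
                (z i ^ Poly_Mapping.lookup a i))"
    unfolding sym_action_def by (intro prod.cong) (simp_all add: lf single_var_power del: One_nat_def)
  also have "\<dots> = Poly_Mapping.single (\<Sum>i<n. Poly_Mapping.single (\<sigma> i) (Poly_Mapping.lookup a i))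
      (\<Prod>i<n. z i ^ Poly_Mapping.lookup a i)"
    by (rule prod_single)
  also have "(\<Sum>i<n. Poly_Mapping.single (\<sigma> i) (Poly_Mapping.lookup a i)) = permute_exponents \<sigma> a"
  proof (rule poly_mapping_eqI)
    fix x
    have "Poly_Mapping.lookup (\<Sum>i<n. Poly_Mapping.single (\<sigma> i) (Poly_Mapping.lookup a i)) x =
        (\<Sum>i<n. if i = Hilbert_Choice.inv \<sigma> x then Poly_Mapping.lookup a i else 0)"
      unfolding lookup_sum using permutes_inverses[OF \<sigma>]
      by (intro sum.cong) (auto simp: lookup_single when_def)
    also have "\<dots> = Poly_Mapping.lookup a (Hilbert_Choice.inv \<sigma> x)"
      using a by (auto simp: in_keys_iff)
    finally show "Poly_Mapping.lookup (\<Sum>i<n. Poly_Mapping.single (\<sigma> i) (Poly_Mapping.lookup a i)) x =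
        Poly_Mapping.lookup (permute_exponents \<sigma> a) x"
      by (simp add: lookup_permute_exponents[OF \<sigma>])
  qed
  finally show ?thesis .
qed

fun permute_index :: "(nat \<Rightarrow> nat) \<Rightarrow> tensor_index \<Rightarrow> tensor_index" where
  "permute_index \<sigma> (a, I, J) = (permute_exponents \<sigma> a, \<sigma> ` I, \<sigma> ` J)"

text \<open>
  The scalar by which the group element given by $\sigma$ and $z$ multiplies a basis vector while
  moving it to \<open>permute_index \<sigma>\<close> of it.  The symmetric and the first exterior factor carry the dual
  action, whose matrix has the same permutation and inverted entries.
\<close>

fun action_scalar :: "nat \<Rightarrow> (nat \<Rightarrow> nat) \<Rightarrow> (nat \<Rightarrow> complex) \<Rightarrow> tensor_index \<Rightarrow> complex" where
  "action_scalar n \<sigma> z (a, I, J) =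
     (\<Prod>i<n. inverse (z i) ^ Poly_Mapping.lookup a i)
     * ext_coeff (scaled_perm n \<sigma> (\<lambda>i. inverse (z i))) (\<sigma> ` I) I
     * ext_coeff (scaled_perm n \<sigma> z) (\<sigma> ` J) J"

lemma in_tensor_basis_iff:
  "(a, I, J) \<in> tensor_basis n i k r \<longleftrightarrow> Poly_Mapping.keys a \<subseteq> {..<n} \<and> (\<Sum>j<n. Poly_Mapping.lookup a j) = i
     \<and> I \<subseteq> {..<n} \<and> card I = k \<and> J \<subseteq> {..<n} \<and> card J = r"
  by (auto simp: tensor_basis_def sym_basis_def ext_basis_def)

lemma permute_index_in_basis:
  assumes \<sigma>: "\<sigma> permutes {..<n}" and c: "c \<in> tensor_basis n i k r"
  shows "permute_index \<sigma> c \<in> tensor_basis n i k r"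
proof -
  obtain a I J where [simp]: "c = (a, I, J)" by (cases c)
  have "Poly_Mapping.keys (permute_exponents \<sigma> a) \<subseteq> {..<n}"
  proof
    fix x assume "x \<in> Poly_Mapping.keys (permute_exponents \<sigma> a)"
    hence "Hilbert_Choice.inv \<sigma> x \<in> Poly_Mapping.keys a"
      by (simp add: in_keys_iff lookup_permute_exponents[OF \<sigma>])
    hence "Hilbert_Choice.inv \<sigma> x \<in> {..<n}"
      using c by (auto simp: in_tensor_basis_iff)
    thus "x \<in> {..<n}" using permutes_in_image[OF permutes_inv[OF \<sigma>]] by blast
  qed
  moreover have "(\<Sum>j<n. Poly_Mapping.lookup (permute_exponents \<sigma> a) j) = (\<Sum>j<n. Poly_Mapping.lookup a j)"
    unfolding lookup_permute_exponents[OF \<sigma>]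
    using sum.permute[OF permutes_inv[OF \<sigma>], of "Poly_Mapping.lookup a"] by (simp add: comp_def)
  ultimately show ?thesis
    using c permutes_image_subset[OF \<sigma>] card_permutes_image[OF \<sigma>]
    by (simp add: in_tensor_basis_iff)
qed

lemma tensor_coeff_scaled_perm:
  assumes \<sigma>: "\<sigma> permutes {..<n}" and z: "\<And>j. j < n \<Longrightarrow> z j \<noteq> 0"
    and b: "b \<in> tensor_basis n i k r" and c: "c \<in> tensor_basis n i k r"
  shows "tensor_coeff (scaled_perm n \<sigma> z) b c =
    (if b = permute_index \<sigma> c then action_scalar n \<sigma> z c else 0)"
proof -
  obtain a I J where [simp]: "c = (a, I, J)" by (cases c)
  obtain a' K L where [simp]: "b = (a', K, L)" by (cases b)
  have dual: "dual_mat (scaled_perm n \<sigma> z) = scaled_perm n \<sigma> (\<lambda>j. inverse (z j))"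
    by (rule dual_mat_scaled_perm[OF \<sigma> z])
  have keys: "Poly_Mapping.keys a \<subseteq> {..<n}" using c by (simp add: in_tensor_basis_iff)
  have zero: "ext_coeff (scaled_perm n \<sigma> w) K I = 0" if "K \<noteq> \<sigma> ` I" for w
    using that b c by (intro ext_coeff_scaled_perm_zero[OF _ _ _ _ \<sigma>]) (auto simp: in_tensor_basis_iff)
  have zero': "ext_coeff (scaled_perm n \<sigma> w) L J = 0" if "L \<noteq> \<sigma> ` J" for w
    using that b c by (intro ext_coeff_scaled_perm_zero[OF _ _ _ _ \<sigma>]) (auto simp: in_tensor_basis_iff)
  have "b = permute_index \<sigma> c \<longleftrightarrow> a' = permute_exponents \<sigma> a \<and> K = \<sigma> ` I \<and> L = \<sigma> ` J" by simp
  thus ?thesis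
    using zero zero'
    by (cases "K = \<sigma> ` I"; cases "L = \<sigma> ` J")
       (auto simp del: permute_index.simps simp: tensor_coeff_def dual sym_action_scaled_perm[OF \<sigma> keys] lookup_single when_def)
qed

lemma tensor_action_scaled_perm:
  assumes \<sigma>: "\<sigma> permutes {..<n}" and z: "\<And>j. j < n \<Longrightarrow> z j \<noteq> 0"
    and c: "c \<in> tensor_basis n i k r"
  shows "tensor_action n i k r (scaled_perm n \<sigma> z) f (permute_index \<sigma> c) = action_scalar n \<sigma> z c * f c"
proof -
  have inj: "permute_index \<sigma> c = permute_index \<sigma> c' \<longleftrightarrow> c = c'" for c'
  proof
    assume eq: "permute_index \<sigma> c = permute_index \<sigma> c'"
    obtain a I J where [simp]: "c = (a, I, J)" by (cases c)
    obtain a' K L where [simp]: "c' = (a', K, L)" by (cases c')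
    have "a = a'"
    proof (rule poly_mapping_eqI)
      fix x
      from eq have "Poly_Mapping.lookup (permute_exponents \<sigma> a) (\<sigma> x) =
          Poly_Mapping.lookup (permute_exponents \<sigma> a') (\<sigma> x)" by simp
      thus "Poly_Mapping.lookup a x = Poly_Mapping.lookup a' x"
        by (simp add: lookup_permute_exponents[OF \<sigma>] permutes_inverses[OF \<sigma>])
    qed
    thus "c = c'" using eq inj_image_eq_iff[OF permutes_inj[OF \<sigma>]] by simp
  qed simp
  have "(\<Sum>c'\<in>tensor_basis n i k r. tensor_coeff (scaled_perm n \<sigma> z) (permute_index \<sigma> c) c' * f c') =
      (\<Sum>c'\<in>tensor_basis n i k r. if c' = c then action_scalar n \<sigma> z c * f c else 0)"
    using permute_index_in_basis[OF \<sigma> c]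
    by (intro sum.cong refl) (auto simp: tensor_coeff_scaled_perm[OF \<sigma> z] inj)
  thus ?thesis
    using permute_index_in_basis[OF \<sigma> c] c finite_tensor_basis[of n i k r]
    by (simp add: tensor_action_def)
qed

lemma permute_index_comp:
  assumes \<sigma>: "\<sigma> permutes S" and \<tau>: "\<tau> permutes S"
  shows "permute_index (\<sigma> \<circ> \<tau>) c = permute_index \<sigma> (permute_index \<tau> c)"
proof -
  obtain a I J where [simp]: "c = (a, I, J)" by (cases c)
  have "permute_exponents (\<sigma> \<circ> \<tau>) a = permute_exponents \<sigma> (permute_exponents \<tau> a)"
    by (rule poly_mapping_eqI)
       (simp add: lookup_permute_exponents[OF \<sigma>] lookup_permute_exponents[OF \<tau>]
          lookup_permute_exponents[OF permutes_compose[OF \<tau> \<sigma>]]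
          o_inv_distrib[OF permutes_bij[OF \<sigma>] permutes_bij[OF \<tau>]])
  thus ?thesis by (simp add: image_comp)
qed

lemma permute_index_id: "permute_index id c = c"
proof -
  have "permute_exponents id a = a" for a
    by (rule poly_mapping_eqI) (simp add: lookup_permute_exponents[OF permutes_id])
  thus ?thesis by (cases c) simp
qed

lemma action_scalar_comp:
  assumes \<sigma>: "\<sigma> permutes {..<n}" and \<tau>: "\<tau> permutes {..<n}" and c: "c \<in> tensor_basis n i k r"
  shows "action_scalar n (\<sigma> \<circ> \<tau>) (\<lambda>j. z (\<tau> j) * w j) c =
    action_scalar n \<sigma> z (permute_index \<tau> c) * action_scalar n \<tau> w c"
proof -
  obtain a I J where [simp]: "c = (a, I, J)" by (cases c)
  have I: "I \<subseteq> {..<n}" and J: "J \<subseteq> {..<n}" using c by (auto simp: in_tensor_basis_iff)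
  have ext: "ext_coeff (scaled_perm n (\<sigma> \<circ> \<tau>) (\<lambda>j. z' (\<tau> j) * w' j)) ((\<sigma> \<circ> \<tau>) ` K) K =
      ext_coeff (scaled_perm n \<sigma> z') (\<sigma> ` \<tau> ` K) (\<tau> ` K) * ext_coeff (scaled_perm n \<tau> w') (\<tau> ` K) K"
    if K: "K \<subseteq> {..<n}" for K and z' w' :: "nat \<Rightarrow> complex"
    unfolding scaled_perm_mult[OF \<sigma> \<tau>, symmetric]
    by (subst ext_coeff_mult_scaled_perm[OF scaled_perm_carrier \<tau> K])
       (use K permutes_image_subset[OF permutes_compose[OF \<tau> \<sigma>] K]
          card_permutes_image[OF permutes_compose[OF \<tau> \<sigma>]] in \<open>auto simp: image_comp\<close>)
  have "(\<Prod>i<n. inverse (z i) ^ Poly_Mapping.lookup (permute_exponents \<tau> a) i) =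
      (\<Prod>i<n. inverse (z (\<tau> i)) ^ Poly_Mapping.lookup a i)"
    unfolding lookup_permute_exponents[OF \<tau>]
    by (subst prod.permute[OF \<tau>]) (simp add: comp_def permutes_inverses[OF \<tau>])
  moreover have "(\<Prod>i<n. inverse (z (\<tau> i) * w i) ^ Poly_Mapping.lookup a i) =
      (\<Prod>i<n. inverse (z (\<tau> i)) ^ Poly_Mapping.lookup a i) * (\<Prod>i<n. inverse (w i) ^ Poly_Mapping.lookup a i)"
    by (simp add: power_mult_distrib prod.distrib)
  ultimately show ?thesis
    using ext[OF I, of "\<lambda>i. inverse (z i)" "\<lambda>i. inverse (w i)"] ext[OF J, of z w]
    by (simp add: image_comp mult_ac)
qed

lemma action_scalar_diagonal:
  assumes c: "(a, I, J) \<in> tensor_basis n i k r"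
  shows "action_scalar n id z (a, I, J) =
    (\<Prod>i<n. inverse (z i) ^ Poly_Mapping.lookup a i) * (\<Prod>i\<in>I. inverse (z i)) * (\<Prod>i\<in>J. z i)"
  using c by (simp add: ext_coeff_diagonal in_tensor_basis_iff)


section \<open>Invariants of a monomial representation\<close>

text \<open>
  The relation \<open>E b c z\<close> says that some group element maps the basis vector $b$ to $z$ times $c$, and
  $\kappa$ is a complete invariant of orbits.  An invariant function is determined on an orbit by one
  value.  If some stabiliser scalar differs from $1$, this value must be $0$; otherwise any value
  extends consistently along the orbit.  So the orbits with trivial stabiliser scalars index a basis.
\<close>

lemma dim_scaled_equivalence:
  fixes E :: "'i \<Rightarrow> 'i \<Rightarrow> complex \<Rightarrow> bool" and \<kappa> :: "'i \<Rightarrow> 'k"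
  assumes fin: "finite B"
    and refl: "\<And>c. c \<in> B \<Longrightarrow> E c c 1"
    and sym: "\<And>b c z. b \<in> B \<Longrightarrow> c \<in> B \<Longrightarrow> E b c z \<Longrightarrow> z \<noteq> 0 \<and> E c b (inverse z)"
    and trans: "\<And>a b c y z. a \<in> B \<Longrightarrow> b \<in> B \<Longrightarrow> c \<in> B \<Longrightarrow> E a b y \<Longrightarrow> E b c z \<Longrightarrow> E a c (z * y)"
    and \<kappa>: "\<And>b c. b \<in> B \<Longrightarrow> c \<in> B \<Longrightarrow> (\<exists>z. E b c z) \<longleftrightarrow> \<kappa> b = \<kappa> c"
  shows "vector_space.dim cscale {f. (\<forall>b. b \<notin> B \<longrightarrow> f b = 0) \<and>
      (\<forall>b\<in>B. \<forall>c\<in>B. \<forall>z. E b c z \<longrightarrow> f c = z * f b)} =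
    card (\<kappa> ` {b \<in> B. \<forall>z. E b b z \<longrightarrow> z = 1})"
proof -
  define S where "S = {f. (\<forall>b. b \<notin> B \<longrightarrow> f b = 0) \<and> (\<forall>b\<in>B. \<forall>c\<in>B. \<forall>z. E b c z \<longrightarrow> f c = z * f b)}"
  define good where "good = {b \<in> B. \<forall>z. E b b z \<longrightarrow> z = 1}"
  define M where "M = \<kappa> ` good"
  define rep where "rep m = (SOME b. b \<in> good \<and> \<kappa> b = m)" for m
  \<comment> \<open>the invariant function supported on the orbit $m$ with value $1$ at its representative\<close>
  define F where "F m c = (if c \<in> B \<and> \<kappa> c = m then (SOME z. E (rep m) c z) else 0)" for m c
  have rep: "rep m \<in> good" "rep m \<in> B" "\<kappa> (rep m) = m" if "m \<in> M" for m
  proof -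
    have "\<exists>b. b \<in> good \<and> \<kappa> b = m" using that by (auto simp: M_def)
    hence "rep m \<in> good \<and> \<kappa> (rep m) = m" unfolding rep_def by (rule someI_ex)
    thus "rep m \<in> good" "rep m \<in> B" "\<kappa> (rep m) = m" by (auto simp: good_def)
  qed
  have unique: "y = z" if "b \<in> good" "c \<in> B" "E b c y" "E b c z" for b c y z
  proof -
    have b: "b \<in> B" "\<And>z. E b b z \<Longrightarrow> z = 1" using that(1) by (auto simp: good_def)
    have "y \<noteq> 0" "E c b (inverse y)" using sym[OF b(1) that(2,3)] by auto
    hence "E b b (inverse y * z)" using trans[OF b(1) that(2) b(1) that(4)] by simp
    hence "inverse y * z = 1" by (rule b(2))
    thus ?thesis using \<open>y \<noteq> 0\<close> by (simp add: field_simps)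
  qed
  have F_eq: "F m c = z" if "m \<in> M" "c \<in> B" "E (rep m) c z" for m c z
  proof -
    have "\<kappa> c = m" using \<kappa>[OF rep(2)[OF that(1)] that(2)] that(3) rep(3)[OF that(1)] by auto
    moreover have "E (rep m) c (SOME z. E (rep m) c z)" using that(3) by (rule someI)
    ultimately show ?thesis
      using unique[OF rep(1)[OF that(1)] that(2) _ that(3)] that(2) by (simp add: F_def)
  qed
  have F_in: "F m \<in> S" if m: "m \<in> M" for m
    unfolding S_def
  proof (intro CollectI conjI allI impI ballI)
    fix b c z assume b: "b \<in> B" and c: "c \<in> B" and E: "E b c z"
    have eq: "\<kappa> b = \<kappa> c" using \<kappa>[OF b c] E by blast
    show "F m c = z * F m b"
    proof (cases "\<kappa> b = m")
      case True
      then obtain y where y: "E (rep m) b y" using \<kappa>[OF rep(2)[OF m] b] rep(3)[OF m] by auto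
      hence "E (rep m) c (z * y)" using trans[OF rep(2)[OF m] b c] E by blast
      thus ?thesis using F_eq[OF m] b c y by simp
    qed (use eq in \<open>simp add: F_def\<close>)
  qed (simp add: F_def)
  have F_rep: "F m (rep m') = (if m' = m then 1 else 0)" if "m \<in> M" "m' \<in> M" for m m'
    using F_eq[OF that(1) rep(2)[OF that(1)] refl[OF rep(2)[OF that(1)]]] rep(3)[OF that(2)]
    by (auto simp: F_def)
  have finM: "finite M" using fin by (simp add: M_def good_def)
  have inj: "inj_on F M"
  proof (rule inj_onI)
    fix m m' assume "m \<in> M" "m' \<in> M" "F m = F m'"
    thus "m = m'" using F_rep[of m m] F_rep[of m' m] by (simp split: if_splits)
  qed
  have apply_sum: "(\<Sum>m\<in>X. cscale (u m) (F m)) c = (\<Sum>m\<in>X. u m * F m c)" for X u c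
    by (induction X rule: infinite_finite_induct) (auto simp: cscale_def)
  have expand: "f = (\<Sum>m\<in>M. cscale (f (rep m)) (F m))" if f: "f \<in> S" for f
  proof
    fix c
    consider "c \<notin> B" | "c \<in> B" "c \<notin> good" | "c \<in> good" "c \<in> B" by (auto simp: good_def)
    thus "f c = (\<Sum>m\<in>M. cscale (f (rep m)) (F m)) c"
    proof cases
      case 1
      thus ?thesis using f unfolding apply_sum by (simp add: S_def F_def)
    next
      case 2
      then obtain z where z: "E c c z" "z \<noteq> 1" by (auto simp: good_def)
      have vanish: "g c = 0" if "g \<in> S" for g
      proof -
        have "g c = z * g c" using that 2(1) z(1) unfolding S_def by blast
        thus ?thesis using z(2) by simp
      qed
      have "F m c = 0" if "m \<in> M" for m using vanish[OF F_in[OF that]] .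
      thus ?thesis using vanish[OF f] unfolding apply_sum by simp
    next
      case 3
      hence m: "\<kappa> c \<in> M" by (simp add: M_def)
      then obtain z where z: "E (rep (\<kappa> c)) c z" using \<kappa>[OF rep(2)[OF m] 3(2)] rep(3)[OF m] by auto
      have "(\<Sum>m\<in>M. f (rep m) * F m c) = (\<Sum>m\<in>M. if m = \<kappa> c then f (rep (\<kappa> c)) * F (\<kappa> c) c else 0)"
        by (rule sum.cong) (auto simp: F_def)
      also have "\<dots> = f (rep (\<kappa> c)) * z" using m finM F_eq[OF m 3(2) z] by simp
      also have "\<dots> = f c" using f z rep(2)[OF m] 3(2) by (simp add: S_def)
      finally show ?thesis unfolding apply_sum by simp
    qed
  qed
  have "cfun.dim S = card (F ` M)"
  proof (rule cfun.dim_unique[OF _ _ _ HOL.refl])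
    show "F ` M \<subseteq> S" using F_in by auto
    show "S \<subseteq> cfun.span (F ` M)"
    proof
      fix f assume "f \<in> S"
      hence "f = (\<Sum>m\<in>M. cscale (f (rep m)) (F m))" by (rule expand)
      also have "\<dots> \<in> cfun.span (F ` M)"
        by (intro cfun.span_sum cfun.span_scale cfun.span_base imageI)
      finally show "f \<in> cfun.span (F ` M)" .
    qed
    show "cfun.independent (F ` M)"
      unfolding cfun.dependent_finite[OF finite_imageI[OF finM]]
    proof safe
      fix u m
      assume zero: "(\<Sum>v\<in>F ` M. cscale (u v) v) = 0" and m: "m \<in> M" and um: "u (F m) \<noteq> 0"
      have "(\<Sum>m\<in>M. cscale (u (F m)) (F m)) (rep m) = 0"
        using zero by (simp add: sum.reindex[OF inj])
      hence "(\<Sum>m'\<in>M. u (F m') * F m' (rep m)) = 0" unfolding apply_sum .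
      moreover have "(\<Sum>m'\<in>M. u (F m') * F m' (rep m)) = (\<Sum>m'\<in>M. if m' = m then u (F m) else 0)"
        using m by (intro sum.cong) (auto simp: F_rep)
      ultimately show False using um m finM by simp
    qed
  qed
  thus ?thesis unfolding card_image[OF inj] unfolding S_def M_def good_def .
qed

section \<open>The group $G(de,e,n)$ by permutations and scalars\<close>

definition admissible :: "nat \<Rightarrow> nat \<Rightarrow> nat \<Rightarrow> (nat \<Rightarrow> nat) \<Rightarrow> (nat \<Rightarrow> complex) \<Rightarrow> bool" where
  "admissible d e n \<sigma> z \<longleftrightarrow> \<sigma> permutes {..<n} \<and> (\<forall>j<n. z j ^ (d * e) = 1) \<and> (\<Prod>j<n. z j) ^ d = 1"

lemma nonzero_positions_scaled_perm:
  assumes "\<sigma> permutes {..<n}" "\<And>j. j < n \<Longrightarrow> z j \<noteq> 0"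
  shows "nonzero_positions (scaled_perm n \<sigma> z) = (\<lambda>j. (\<sigma> j, j)) ` {..<n}"
  using permutes_less[OF assms(1)] assms(2)
  by (auto simp: nonzero_positions_def scaled_perm_index split: if_splits)

lemma scaled_perm_in_G_group:
  assumes adm: "admissible d e n \<sigma> z" and de: "d * e \<noteq> 0"
  shows "scaled_perm n \<sigma> z \<in> G_group d e n"
proof -
  have \<sigma>: "\<sigma> permutes {..<n}" using adm by (simp add: admissible_def)
  have z: "z j \<noteq> 0" if "j < n" for j
    using adm that de by (auto simp: admissible_def power_0_left)
  have pos: "nonzero_positions (scaled_perm n \<sigma> z) = (\<lambda>j. (\<sigma> j, j)) ` {..<n}"
    by (rule nonzero_positions_scaled_perm[OF \<sigma> z])
  have "monomial_mat n (scaled_perm n \<sigma> z)"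
    unfolding monomial_mat_def
  proof (intro conjI allI impI scaled_perm_carrier)
    fix i assume i: "i < n"
    have "Hilbert_Choice.inv \<sigma> i < n" using permutes_less[OF permutes_inv[OF \<sigma>] i] .
    thus "\<exists>!j. j < n \<and> scaled_perm n \<sigma> z $$ (i, j) \<noteq> 0"
      using i z permutes_inverses[OF \<sigma>]
      by (intro ex1I[of _ "Hilbert_Choice.inv \<sigma> i"]) (auto simp: scaled_perm_index split: if_splits)
  next
    fix j assume j: "j < n"
    thus "\<exists>!i. i < n \<and> scaled_perm n \<sigma> z $$ (i, j) \<noteq> 0"
      using z permutes_less[OF \<sigma> j]
      by (intro ex1I[of _ "\<sigma> j"]) (auto simp: scaled_perm_index split: if_splits)
  qed
  moreover have "inj_on (\<lambda>j. (\<sigma> j, j)) {..<n}" by (auto simp: inj_on_def)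
  hence "(\<Prod>p\<in>nonzero_positions (scaled_perm n \<sigma> z). scaled_perm n \<sigma> z $$ p) = (\<Prod>j<n. z j)"
    using permutes_less[OF \<sigma>]
    by (simp add: pos prod.reindex scaled_perm_index)
  moreover have "(scaled_perm n \<sigma> z $$ p) ^ (d * e) = 1"
    if p: "p \<in> nonzero_positions (scaled_perm n \<sigma> z)" for p
  proof -
    obtain j where "j < n" "p = (\<sigma> j, j)"
      using p unfolding pos by auto
    thus ?thesis using adm permutes_less[OF \<sigma>] by (simp add: scaled_perm_index admissible_def)
  qed
  ultimately show ?thesis using adm by (simp add: G_group_def admissible_def)
qed

text \<open>
  A monomial matrix is determined by the position and the value of the nonzero entry in each column.
\<close>

lemma G_group_scaled_perm:
  assumes A: "A \<in> G_group d e n"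
  obtains \<sigma> z where "admissible d e n \<sigma> z" "A = scaled_perm n \<sigma> z"
proof -
  have mono: "monomial_mat n A" using A by (simp add: G_group_def)
  hence car: "A \<in> carrier_mat n n" by (simp add: monomial_mat_def)
  define \<sigma> where "\<sigma> j = (if j < n then THE i. i < n \<and> A $$ (i, j) \<noteq> 0 else j)" for j
  define z where "z j = A $$ (\<sigma> j, j)" for j
  have \<sigma>: "\<sigma> j < n" "A $$ (\<sigma> j, j) \<noteq> 0" if "j < n" for j
  proof -
    have "\<exists>!i. i < n \<and> A $$ (i, j) \<noteq> 0" using mono that by (simp add: monomial_mat_def)
    hence "\<sigma> j < n \<and> A $$ (\<sigma> j, j) \<noteq> 0" using that theI'[of "\<lambda>i. i < n \<and> A $$ (i, j) \<noteq> 0"] by (simp add: \<sigma>_def)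
    thus "\<sigma> j < n" "A $$ (\<sigma> j, j) \<noteq> 0" by auto
  qed
  have \<sigma>_unique: "i = \<sigma> j" if "i < n" "j < n" "A $$ (i, j) \<noteq> 0" for i j
    using mono that \<sigma>[OF that(2)] by (auto simp: monomial_mat_def)
  have perm: "\<sigma> permutes {..<n}"
  proof (rule bij_imp_permutes)
    have "inj_on \<sigma> {..<n}"
    proof (rule inj_onI)
      fix j j' assume "j \<in> {..<n}" "j' \<in> {..<n}" "\<sigma> j = \<sigma> j'"
      thus "j = j'" using mono \<sigma>[of j] \<sigma>[of j'] by (auto simp: monomial_mat_def)
    qed
    moreover have "\<sigma> ` {..<n} \<subseteq> {..<n}" using \<sigma> by auto
    ultimately show "bij_betw \<sigma> {..<n} {..<n}"
      by (simp add: bij_betw_def endo_inj_surj)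
  qed (simp add: \<sigma>_def)
  have eq: "A = scaled_perm n \<sigma> z"
  proof (rule eq_matI)
    fix i j assume "i < dim_row (scaled_perm n \<sigma> z)" "j < dim_col (scaled_perm n \<sigma> z)"
    thus "A $$ (i, j) = scaled_perm n \<sigma> z $$ (i, j)"
      using \<sigma>_unique[of i j] by (auto simp: scaled_perm_index z_def)
  qed (use car in auto)
  have pos: "nonzero_positions A = (\<lambda>j. (\<sigma> j, j)) ` {..<n}"
    unfolding eq by (rule nonzero_positions_scaled_perm[OF perm]) (use \<sigma> in \<open>simp add: z_def\<close>)
  have "inj_on (\<lambda>j. (\<sigma> j, j)) {..<n}" by (auto simp: inj_on_def)
  hence "(\<Prod>p\<in>nonzero_positions A. A $$ p) = (\<Prod>j<n. z j)"
    unfolding pos by (simp add: prod.reindex z_def)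
  moreover have "\<forall>j<n. z j ^ (d * e) = 1" using A pos by (auto simp: G_group_def z_def)
  ultimately have "admissible d e n \<sigma> z" using A perm by (simp add: G_group_def admissible_def)
  thus ?thesis using eq by (rule that)
qed

lemma admissible_nonzero: "admissible d e n \<sigma> z \<Longrightarrow> d * e \<noteq> 0 \<Longrightarrow> j < n \<Longrightarrow> z j \<noteq> 0"
  by (auto simp: admissible_def power_0_left)

lemma admissible_id: "admissible d e n id (\<lambda>_. 1)"
  by (simp add: admissible_def permutes_id)

lemma admissible_comp:
  assumes "admissible d e n \<sigma> z" "admissible d e n \<tau> w"
  shows "admissible d e n (\<sigma> \<circ> \<tau>) (\<lambda>j. z (\<tau> j) * w j)"
proof -
  have \<tau>: "\<tau> permutes {..<n}" using assms by (simp add: admissible_def)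
  have "(\<Prod>j<n. z (\<tau> j)) = (\<Prod>j<n. z j)"
    using prod.permute[OF \<tau>, of z] by (simp add: comp_def)
  thus ?thesis using assms permutes_less[OF \<tau>]
    by (auto simp: admissible_def power_mult_distrib prod.distrib permutes_compose)
qed

lemma admissible_inv:
  assumes "admissible d e n \<sigma> z"
  shows "admissible d e n (Hilbert_Choice.inv \<sigma>) (\<lambda>i. inverse (z (Hilbert_Choice.inv \<sigma> i)))"
proof -
  have \<sigma>: "\<sigma> permutes {..<n}" using assms by (simp add: admissible_def)
  have \<sigma>': "Hilbert_Choice.inv \<sigma> permutes {..<n}" using \<sigma> by (rule permutes_inv)
  have "(\<Prod>j<n. inverse (z (Hilbert_Choice.inv \<sigma> j))) = inverse (\<Prod>j<n. z j)"
    using prod.permute[OF \<sigma>', of z] prod_inversef[of "\<lambda>j. z (Hilbert_Choice.inv \<sigma> j)" "{..<n}"]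
    by (simp add: comp_def)
  thus ?thesis using assms \<sigma>' permutes_less[OF \<sigma>']
    by (auto simp: admissible_def power_inverse)
qed

lemma action_scalar_cong:
  assumes c: "c \<in> tensor_basis n i k r" and "\<And>j. j < n \<Longrightarrow> z j = w j"
  shows "action_scalar n \<sigma> z c = action_scalar n \<sigma> w c"
proof -
  obtain a I J where [simp]: "c = (a, I, J)" by (cases c)
  have "scaled_perm n \<sigma> (\<lambda>i. inverse (z i)) = scaled_perm n \<sigma> (\<lambda>i. inverse (w i))"
    "scaled_perm n \<sigma> z = scaled_perm n \<sigma> w"
    by (rule scaled_perm_cong; use assms in simp)+
  moreover have "(\<Prod>i<n. inverse (z i) ^ Poly_Mapping.lookup a i) = (\<Prod>i<n. inverse (w i) ^ Poly_Mapping.lookup a i)"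
    using assms by (intro prod.cong) auto
  ultimately show ?thesis by simp
qed

lemma action_scalar_id:
  assumes c: "c \<in> tensor_basis n i k r" shows "action_scalar n id (\<lambda>_. 1) c = 1"
  using c by (cases c) (simp add: ext_coeff_diagonal in_tensor_basis_iff)

text \<open>
  The relation to which \<open>dim_scaled_equivalence\<close> is applied: a group element takes the basis vector
  $c$ to $y$ times $b$.  The group laws, in the form of composition and inversion of the data
  $(\sigma, z)$, make it reflexive, symmetric and transitive in the required sense.
\<close>

definition moves :: "nat \<Rightarrow> nat \<Rightarrow> nat \<Rightarrow> tensor_index \<Rightarrow> tensor_index \<Rightarrow> complex \<Rightarrow> bool" where
  "moves d e n c b y \<longleftrightarrow> (\<exists>\<sigma> z. admissible d e n \<sigma> z \<and> b = permute_index \<sigma> c \<and> y = action_scalar n \<sigma> z c)"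

lemma moves_refl: "c \<in> tensor_basis n i k r \<Longrightarrow> moves d e n c c 1"
  unfolding moves_def
  by (intro exI[of _ id] exI[of _ "\<lambda>_. 1"]) (simp add: admissible_id permute_index_id action_scalar_id)

lemma moves_trans:
  assumes "a \<in> tensor_basis n i k r" "moves d e n a b y" "moves d e n b c z"
  shows "moves d e n a c (z * y)"
proof -
  obtain \<sigma> u \<tau> w where *: "admissible d e n \<sigma> u" "b = permute_index \<sigma> a" "y = action_scalar n \<sigma> u a"
    "admissible d e n \<tau> w" "c = permute_index \<tau> b" "z = action_scalar n \<tau> w b"
    using assms(2,3) unfolding moves_def by blast
  have \<sigma>: "\<sigma> permutes {..<n}" and \<tau>: "\<tau> permutes {..<n}" using * by (auto simp: admissible_def)
  have "admissible d e n (\<tau> \<circ> \<sigma>) (\<lambda>j. w (\<sigma> j) * u j)" by (rule admissible_comp[OF *(4,1)])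
  moreover have "c = permute_index (\<tau> \<circ> \<sigma>) a" using permute_index_comp[OF \<tau> \<sigma>] * by simp
  moreover have "z * y = action_scalar n (\<tau> \<circ> \<sigma>) (\<lambda>j. w (\<sigma> j) * u j) a"
    using action_scalar_comp[OF \<tau> \<sigma> assms(1)] * by simp
  ultimately show ?thesis unfolding moves_def by blast
qed

lemma moves_sym:
  assumes c: "c \<in> tensor_basis n i k r" and de: "d * e \<noteq> 0" and move: "moves d e n c b y"
  shows "y \<noteq> 0 \<and> moves d e n b c (inverse y)"
proof -
  obtain \<sigma> z where *: "admissible d e n \<sigma> z" "b = permute_index \<sigma> c" "y = action_scalar n \<sigma> z c"
    using move unfolding moves_def by blast
  have \<sigma>: "\<sigma> permutes {..<n}" using * by (auto simp: admissible_def)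
  let ?\<tau> = "Hilbert_Choice.inv \<sigma>" and ?w = "\<lambda>i. inverse (z (Hilbert_Choice.inv \<sigma> i))"
  have \<tau>: "?\<tau> permutes {..<n}" using \<sigma> by (rule permutes_inv)
  have "action_scalar n (?\<tau> \<circ> \<sigma>) (\<lambda>j. ?w (\<sigma> j) * z j) c = action_scalar n ?\<tau> ?w b * y"
    using action_scalar_comp[OF \<tau> \<sigma> c] * by simp
  moreover have "action_scalar n (?\<tau> \<circ> \<sigma>) (\<lambda>j. ?w (\<sigma> j) * z j) c = action_scalar n id (\<lambda>_. 1) c"
    unfolding permutes_inv_o[OF \<sigma>]
    by (rule action_scalar_cong[OF c])
       (use admissible_nonzero[OF *(1) de] permutes_inverses[OF \<sigma>] in simp)
  ultimately have prod: "action_scalar n ?\<tau> ?w b * y = 1" using action_scalar_id[OF c] by simp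
  hence "y \<noteq> 0" by auto
  moreover have "inverse y = action_scalar n ?\<tau> ?w b"
    using prod \<open>y \<noteq> 0\<close> by (simp add: field_simps)
  moreover have "c = permute_index ?\<tau> b"
    using permute_index_comp[OF \<tau> \<sigma>, of c] * by (simp add: permutes_inv_o[OF \<sigma>] permute_index_id)
  ultimately show ?thesis using admissible_inv[OF *(1)] unfolding moves_def by blast
qed

text \<open>
  Comparing coefficients at the image of each basis vector turns invariance into a condition relating
  two values of the coordinate function at a time.
\<close>

lemma tensor_invariants_eq:
  assumes de: "d * e \<noteq> 0"
  shows "tensor_invariants n i k r (G_group d e n) =
    {f. (\<forall>b. b \<notin> tensor_basis n i k r \<longrightarrow> f b = 0) \<and>
      (\<forall>b\<in>tensor_basis n i k r. \<forall>c\<in>tensor_basis n i k r. \<forall>z. moves d e n b c z \<longrightarrow> f c = z * f b)}"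
    (is "?L = ?R")
proof (intro equalityI subsetI)
  fix f assume f: "f \<in> ?L"
  show "f \<in> ?R"
  proof (intro CollectI conjI allI impI ballI)
    fix b assume b: "b \<notin> tensor_basis n i k r"
    have "\<forall>b. b \<notin> tensor_basis n i k r \<longrightarrow> f b = 0"
      using f unfolding tensor_invariants_def tensor_space_def by blast
    thus "f b = 0" using b by blast
  next
    fix b c y assume b: "b \<in> tensor_basis n i k r" and "moves d e n b c y"
    then obtain \<sigma> z where *: "admissible d e n \<sigma> z" "c = permute_index \<sigma> b" "y = action_scalar n \<sigma> z b"
      unfolding moves_def by blast
    have "tensor_action n i k r (scaled_perm n \<sigma> z) f c = f c"
      using f scaled_perm_in_G_group[OF *(1) de] by (simp add: tensor_invariants_def)
    moreover have "tensor_action n i k r (scaled_perm n \<sigma> z) f c = y * f b"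
      unfolding *(2,3) using * admissible_nonzero[OF *(1) de]
      by (intro tensor_action_scaled_perm[OF _ _ b]) (auto simp: admissible_def)
    ultimately show "f c = y * f b" by simp
  qed
next
  fix f assume f: "f \<in> ?R"
  have "tensor_action n i k r A f = f" if A: "A \<in> G_group d e n" for A
  proof
    fix c
    show "tensor_action n i k r A f c = f c"
    proof (cases "c \<in> tensor_basis n i k r")
      case True
      obtain \<sigma> z where *: "admissible d e n \<sigma> z" "A = scaled_perm n \<sigma> z"
        using G_group_scaled_perm[OF A] .
      have \<sigma>: "\<sigma> permutes {..<n}" using * by (auto simp: admissible_def)
      define b where "b = permute_index (Hilbert_Choice.inv \<sigma>) c"
      have b: "b \<in> tensor_basis n i k r"
        unfolding b_def by (rule permute_index_in_basis[OF permutes_inv[OF \<sigma>] True])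
      have c: "c = permute_index \<sigma> b"
        using permute_index_comp[OF \<sigma> permutes_inv[OF \<sigma>], of c]
        by (simp add: b_def permutes_inv_o[OF \<sigma>] permute_index_id)
      have "moves d e n b c (action_scalar n \<sigma> z b)" using *(1) c unfolding moves_def by blast
      hence "f c = action_scalar n \<sigma> z b * f b" using f b True by blast
      moreover have "tensor_action n i k r A f (permute_index \<sigma> b) = action_scalar n \<sigma> z b * f b"
        unfolding *(2) using admissible_nonzero[OF *(1) de]
        by (intro tensor_action_scaled_perm[OF \<sigma> _ b]) auto
      ultimately show ?thesis using c by simp
    next
      case False
      moreover have "\<forall>b. b \<notin> tensor_basis n i k r \<longrightarrow> f b = 0" using f by blast
      ultimately have "f c = 0" by blast
      thus ?thesis using False by (simp add: tensor_action_def)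
    qed
  qed
  thus "f \<in> ?L" using f by (simp add: tensor_invariants_def tensor_space_def)
qed


section \<open>Words of letters\<close>

text \<open>
  The letter at position $x$ of the basis vector $x^a \otimes x_I \otimes e_J$ records the exponent of
  $x$ and whether $x$ belongs to $I$ and to $J$.
\<close>

type_synonym letter = "nat \<times> bool \<times> bool"

fun label :: "tensor_index \<Rightarrow> nat \<Rightarrow> letter" where
  "label (a, I, J) x = (Poly_Mapping.lookup a x, x \<in> I, x \<in> J)"

definition content :: "nat \<Rightarrow> tensor_index \<Rightarrow> letter multiset" where
  "content n c = image_mset (label c) (mset_set {..<n})"

text \<open>
  A diagonal matrix acts on a basis vector through its entries, each raised to minus the charge of the
  letter at its position.
\<close>

fun charge :: "letter \<Rightarrow> int" where
  "charge (a, \<epsilon>, \<delta>) = int a + of_bool \<epsilon> - of_bool \<delta>"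

text \<open>
  Exchanging two equal letters contributes a sign from $\wedge V^*$ if the first bit is set and a sign
  from $\wedge V$ if the second one is.  These cancel if both are set.
\<close>

fun fermionic :: "letter \<Rightarrow> bool" where
  "fermionic (a, \<epsilon>, \<delta>) \<longleftrightarrow> \<epsilon> \<noteq> \<delta>"

lemma label_permute_index:
  assumes "\<sigma> permutes S"
  shows "label (permute_index \<sigma> c) x = label c (Hilbert_Choice.inv \<sigma> x)"
proof -
  obtain a I J where [simp]: "c = (a, I, J)" by (cases c)
  have "x \<in> \<sigma> ` K \<longleftrightarrow> Hilbert_Choice.inv \<sigma> x \<in> K" for K
    using permutes_inverses[OF assms] by (metis image_iff)
  thus ?thesis by (simp add: lookup_permute_exponents[OF assms])
qed

lemma tensor_index_eqI:
  assumes b: "b \<in> tensor_basis n i k r" and c: "c \<in> tensor_basis n i k r"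
    and lab: "\<And>x. x < n \<Longrightarrow> label b x = label c x"
  shows "b = c"
proof -
  obtain a I J a' I' J' where [simp]: "b = (a, I, J)" "c = (a', I', J')" by (cases b, cases c) auto
  have "a = a'"
  proof (rule poly_mapping_eqI)
    fix x
    show "Poly_Mapping.lookup a x = Poly_Mapping.lookup a' x"
    proof (cases "x < n")
      case False
      hence "x \<notin> Poly_Mapping.keys a" "x \<notin> Poly_Mapping.keys a'"
        using b c by (auto simp: in_tensor_basis_iff)
      thus ?thesis by (simp add: in_keys_iff)
    qed (use lab[of x] in auto)
  qed
  moreover have "I = I'" "J = J'"
    using lab b c by (auto simp: in_tensor_basis_iff)
  ultimately show ?thesis by simp
qed

text \<open>
  Two words with the same multiset of letters differ by a permutation of positions, which is realised
  by a permutation matrix; all of these belong to the group.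
\<close>

lemma moves_iff_content:
  assumes b: "b \<in> tensor_basis n i k r" and c: "c \<in> tensor_basis n i k r"
  shows "(\<exists>z. moves d e n b c z) \<longleftrightarrow> content n b = content n c"
proof
  assume "\<exists>z. moves d e n b c z"
  then obtain \<sigma> where \<sigma>: "\<sigma> permutes {..<n}" "c = permute_index \<sigma> b"
    by (auto simp: moves_def admissible_def)
  have "label c = label b \<circ> Hilbert_Choice.inv \<sigma>"
    unfolding \<sigma>(2) by (rule ext) (simp add: label_permute_index[OF \<sigma>(1)])
  hence "content n c = image_mset (label b) (image_mset (Hilbert_Choice.inv \<sigma>) (mset_set {..<n}))"
    by (simp add: content_def multiset.map_comp)
  also have "image_mset (Hilbert_Choice.inv \<sigma>) (mset_set {..<n}) = mset_set {..<n}"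
    by (rule permutes_image_mset[OF permutes_inv[OF \<sigma>(1)]])
  finally show "content n b = content n c" by (simp add: content_def)
next
  assume eq: "content n b = content n c"
  obtain p where p: "p permutes {..<n}" "\<forall>x\<in>{..<n}. label b x = label c (p x)"
    using image_mset_eq_implies_permutes[of "{..<n}" "label b" "label c"] eq
    by (auto simp: content_def)
  have "c = permute_index p b"
  proof (rule tensor_index_eqI[OF c permute_index_in_basis[OF p(1) b]])
    fix x assume "x < n"
    hence "Hilbert_Choice.inv p x < n" using permutes_less[OF permutes_inv[OF p(1)]] by simp
    thus "label c x = label (permute_index p b) x"
      using p by (simp add: label_permute_index[OF p(1)] permutes_inverses[OF p(1)])
  qed
  moreover have "admissible d e n p (\<lambda>_. 1)" using p(1) by (simp add: admissible_def)
  ultimately show "\<exists>z. moves d e n b c z" unfolding moves_def by blast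
qed

section \<open>Characters of the torus\<close>

lemma root_of_unity_powi:
  assumes "N \<ge> 1"
  defines "\<omega> \<equiv> cis (2 * pi / real N)"
  shows "\<omega> powi m = 1 \<longleftrightarrow> int N dvd m"
proof -
  have "\<omega> powi m = cis (of_int m * (2 * pi / real N))"
    unfolding \<omega>_def by (rule cis_power_int)
  also have "of_int m * (2 * pi / real N) = 2 * pi * (of_int m / real N)" by simp
  finally have eq: "\<omega> powi m = cis (2 * pi * (of_int m / real N))" .
  have "cis (2 * pi * (of_int m / real N)) = 1 \<longleftrightarrow> of_int m / real N \<in> \<int>"
  proof
    assume "cis (2 * pi * (of_int m / real N)) = 1"
    hence "cos (2 * pi * (of_int m / real N)) = 1" by (simp add: complex_eq_iff)
    then obtain k :: int where "2 * pi * (of_int m / real N) = of_int k * 2 * pi"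
      by (auto simp: cos_one_2pi_int)
    hence "2 * pi * (of_int m / real N) = 2 * pi * of_int k" by (simp only: mult_ac)
    hence "of_int m / real N = of_int k" by (simp del: times_divide_eq_right)
    thus "of_int m / real N \<in> \<int>" by simp
  next
    assume "of_int m / real N \<in> \<int>"
    thus "cis (2 * pi * (of_int m / real N)) = 1" by (rule cis_multiple_2pi)
  qed
  also have "\<dots> \<longleftrightarrow> int N dvd m"
  proof
    assume "of_int m / real N \<in> \<int>"
    then obtain k where "of_int m / real N = of_int k" by (auto elim: Ints_cases)
    hence "(of_int m :: real) = of_int (k * int N)" using assms(1) by (simp add: field_simps)
    hence "m = k * int N" by (simp only: of_int_eq_iff)
    thus "int N dvd m" by simp
  next
    assume "int N dvd m"
    thus "of_int m / real N \<in> \<int>" using assms(1) by (auto elim!: dvdE)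
  qed
  finally show ?thesis unfolding eq .
qed

text \<open>
  On the diagonal matrices with $(de)$-th roots of unity as entries and a $d$-th root of unity as
  determinant, a Laurent monomial in the entries is trivial iff, up to $(de)$-th powers, it is a power
  of the $d$-th power of the determinant.  Testing on $\mathrm{diag}(\omega,1,\dots,\omega^{-1},\dots,1)$, for a primitive
  root $\omega$, shows that all exponents are congruent; testing on
  $\mathrm{diag}(\omega^e,1,\dots,1)$ shows that $d$ divides them.
\<close>

lemma torus_character_trivial_iff:
  fixes v :: "nat \<Rightarrow> int"
  assumes de: "d \<ge> 1" "e \<ge> 1" and n: "n \<ge> 1"
  shows "(\<forall>z. (\<forall>j<n. z j ^ (d * e) = 1) \<and> (\<Prod>j<n. z j) ^ d = 1 \<longrightarrow> (\<Prod>x<n. z x powi (- v x)) = (1 :: complex))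
    \<longleftrightarrow> (\<exists>s<e. \<forall>x<n. int (d * e) dvd v x - int (s * d))"
proof
  define N where "N = d * e"
  have N: "N \<ge> 1" using de by (simp add: N_def)
  define \<omega> where "\<omega> = cis (2 * pi / real N)"
  have \<omega>_powi: "\<omega> powi m = 1 \<longleftrightarrow> int N dvd m" for m
    unfolding \<omega>_def by (rule root_of_unity_powi[OF N])
  have \<omega>0: "\<omega> \<noteq> 0" by (simp add: \<omega>_def)
  have \<omega>N: "\<omega> ^ N = 1" using \<omega>_powi[of "int N"] by simp
  assume trivial: "\<forall>z. (\<forall>j<n. z j ^ (d * e) = 1) \<and> (\<Prod>j<n. z j) ^ d = 1 \<longrightarrow>
    (\<Prod>x<n. z x powi (- v x)) = (1 :: complex)"
  have diff: "int N dvd v x - v 0" if x: "x < n" for x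
  proof (cases "x = 0")
    case False
    define z where "z j = (if j = 0 then \<omega> else if j = x then inverse \<omega> else 1)" for j
    have split: "(\<Prod>j<n. f j) = f 0 * f x" if "\<And>j. j \<noteq> 0 \<Longrightarrow> j \<noteq> x \<Longrightarrow> f j = 1" for f :: "nat \<Rightarrow> complex"
    proof -
      have "(\<Prod>j<n. f j) = (\<Prod>j\<in>{0, x}. f j)"
        using n x that by (intro prod.mono_neutral_right) auto
      thus ?thesis using False by simp
    qed
    have "(\<Prod>j<n. z j) = 1" using split[of z] \<omega>0 False by (simp add: z_def)
    moreover have "\<forall>j<n. z j ^ (d * e) = 1" using \<omega>N by (simp add: z_def N_def power_inverse)
    ultimately have "(\<Prod>j<n. z j powi (- v j)) = 1" using trivial by simp
    moreover have "(\<Prod>j<n. z j powi (- v j)) = \<omega> powi (- v 0) * \<omega> powi (v x)"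
      using split[of "\<lambda>j. z j powi (- v j)"] False by (simp add: z_def power_int_inverse power_int_minus)
    ultimately have "\<omega> powi (v x - v 0) = 1"
      using \<omega>0 by (simp add: power_int_diff power_int_minus field_simps)
    thus ?thesis by (simp add: \<omega>_powi)
  qed simp
  have "int N dvd int e * v 0"
  proof -
    define z where "z j = (if j = 0 then \<omega> ^ e else 1)" for j :: nat
    have split: "(\<Prod>j<n. f j) = f 0" if "\<And>j. j \<noteq> 0 \<Longrightarrow> f j = 1" for f :: "nat \<Rightarrow> complex"
    proof -
      have "(\<Prod>j<n. f j) = (\<Prod>j\<in>{0}. f j)"
        using n that by (intro prod.mono_neutral_right) auto
      thus ?thesis by simp
    qed
    have pow: "(\<omega> ^ e) ^ d = 1" using \<omega>N by (simp add: N_def mult.commute power_mult[symmetric])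
    have "(\<Prod>j<n. z j) ^ d = 1" using split[of z] pow by (simp add: z_def)
    moreover have "\<forall>j<n. z j ^ (d * e) = 1" using pow by (simp add: z_def power_mult)
    ultimately have "(\<Prod>j<n. z j powi (- v j)) = 1" using trivial by simp
    moreover have "(\<Prod>j<n. z j powi (- v j)) = (\<omega> ^ e) powi (- v 0)"
      using split[of "\<lambda>j. z j powi (- v j)"] by (simp add: z_def)
    ultimately have "\<omega> powi (int e * (- v 0)) = 1"
      unfolding power_int_mult by simp
    thus ?thesis by (simp add: \<omega>_powi)
  qed
  hence "int d dvd v 0" using de by (simp add: N_def mult.commute)
  then obtain u where u: "v 0 = int d * u" by (elim dvdE)
  define s where "s = nat (u mod int e)"
  have s: "int s = u mod int e" using de by (simp add: s_def)
  have "int s < int e" unfolding s using de by simp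
  hence "s < e" by simp
  moreover have "int (d * e) dvd v x - int (s * d)" if "x < n" for x
  proof -
    have "int e dvd u - int s" unfolding s by (simp add: mod_eq_dvd_iff[symmetric])
    hence "int d * int e dvd int d * (u - int s)" by (rule mult_dvd_mono[OF dvd_refl])
    hence "int N dvd v 0 - int (s * d)" by (simp add: u N_def algebra_simps)
    thus ?thesis using diff[OF that] dvd_add[of "int N" "v x - v 0" "v 0 - int (s * d)"] by (simp add: N_def)
  qed
  ultimately show "\<exists>s<e. \<forall>x<n. int (d * e) dvd v x - int (s * d)" by blast
next
  assume "\<exists>s<e. \<forall>x<n. int (d * e) dvd v x - int (s * d)"
  then obtain s where s: "\<And>x. x < n \<Longrightarrow> int (d * e) dvd v x - int (s * d)" by blast
  show "\<forall>z. (\<forall>j<n. z j ^ (d * e) = 1) \<and> (\<Prod>j<n. z j) ^ d = 1 \<longrightarrow> (\<Prod>x<n. z x powi (- v x)) = (1 :: complex)"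
  proof (intro allI impI)
    fix z :: "nat \<Rightarrow> complex"
    assume z: "(\<forall>j<n. z j ^ (d * e) = 1) \<and> (\<Prod>j<n. z j) ^ d = 1"
    have "z x powi (- v x) = inverse (z x ^ (s * d))" if x: "x < n" for x
    proof -
      have zN: "z x ^ (d * e) = 1" using z x by blast
      hence z0: "z x \<noteq> 0" using de by (auto simp: power_0_left)
      obtain m where m: "v x - int (s * d) = int (d * e) * m" using s[OF x] by (elim dvdE)
      have "z x powi (v x) = z x powi (int (s * d) + int (d * e) * m)" using m by (simp add: algebra_simps)
      also have "\<dots> = z x powi (int (s * d)) * (z x powi int (d * e)) powi m"
        using z0 by (simp add: power_int_add power_int_mult)
      also have "\<dots> = z x ^ (s * d)" using zN by (simp only: power_int_of_nat) simp
      finally show ?thesis by (simp add: power_int_minus)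
    qed
    hence "(\<Prod>x<n. z x powi (- v x)) = (\<Prod>x<n. inverse (z x ^ (s * d)))" by (intro prod.cong) auto
    also have "\<dots> = inverse (((\<Prod>x<n. z x) ^ d) ^ s)"
      by (simp add: prod_inversef[symmetric] comp_def prod_power_distrib power_mult[symmetric] mult.commute)
    finally show "(\<Prod>x<n. z x powi (- v x)) = 1" using z by simp
  qed
qed

lemma action_scalar_diagonal_charge:
  assumes c: "c \<in> tensor_basis n i k r" and z: "\<And>j. j < n \<Longrightarrow> z j \<noteq> 0"
  shows "action_scalar n id z c = (\<Prod>x<n. z x powi (- charge (label c x)))"
proof -
  obtain a I J where [simp]: "c = (a, I, J)" by (cases c)
  have IJ: "I \<subseteq> {..<n}" "J \<subseteq> {..<n}" using c by (auto simp: in_tensor_basis_iff)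
  have restrict: "(\<Prod>x\<in>K. f x) = (\<Prod>x<n. if x \<in> K then f x else 1)"
    if "K \<subseteq> {..<n}" for K and f :: "nat \<Rightarrow> complex"
    using prod.inter_restrict[of "{..<n}" f K] that by (simp add: Int_absorb1)
  have "action_scalar n id z c = (\<Prod>x<n. inverse (z x) ^ Poly_Mapping.lookup a x
      * (if x \<in> I then inverse (z x) else 1) * (if x \<in> J then z x else 1))"
    using action_scalar_diagonal[of a I J n i k r z] c
    by (simp add: restrict[OF IJ(1)] restrict[OF IJ(2)] prod.distrib)
  also have "\<dots> = (\<Prod>x<n. z x powi (- charge (label c x)))"
  proof (rule prod.cong)
    fix x assume "x \<in> {..<n}"
    hence "z x \<noteq> 0" using z by simp
    thus "inverse (z x) ^ Poly_Mapping.lookup a x * (if x \<in> I then inverse (z x) else 1)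
        * (if x \<in> J then z x else 1) = z x powi (- charge (label c x))"
      by (simp add: power_int_minus power_int_add power_int_diff power_inverse field_simps)
  qed simp
  finally show ?thesis .
qed

section \<open>Orbits with trivial stabiliser action\<close>

lemma action_scalar_transpose:
  assumes c: "c \<in> tensor_basis n i k r" and x: "x < n" "y < n" "x \<noteq> y" "label c x = label c y"
  shows "permute_index (transpose x y) c = c"
    and "action_scalar n (transpose x y) (\<lambda>_. 1) c = (if fermionic (label c x) then -1 else 1)"
proof -
  have perm: "transpose x y permutes {..<n}" using x by (intro permutes_swap_id) auto
  have inv: "Hilbert_Choice.inv (transpose x y) = transpose x y"
    by (rule inv_unique_comp) simp_all
  show fixed: "permute_index (transpose x y) c = c"
  proof (rule tensor_index_eqI[OF permute_index_in_basis[OF perm c] c])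
    fix w
    have "label (permute_index (transpose x y) c) w = label c (transpose x y w)"
      by (simp only: label_permute_index[OF perm] inv)
    also have "\<dots> = label c w" using x(4) by (auto simp only: transpose_def split: if_splits)
    finally show "label (permute_index (transpose x y) c) w = label c w" .
  qed
  obtain a I J where [simp]: "c = (a, I, J)" by (cases c)
  have IJ: "I \<subseteq> {..<n}" "J \<subseteq> {..<n}" using c by (auto simp: in_tensor_basis_iff)
  have "x \<in> I \<longleftrightarrow> y \<in> I" "x \<in> J \<longleftrightarrow> y \<in> J" using x(4) by auto
  thus "action_scalar n (transpose x y) (\<lambda>_. 1) c = (if fermionic (label c x) then -1 else 1)"
    using fixed ext_coeff_transpose[OF IJ(1) x(3)] ext_coeff_transpose[OF IJ(2) x(3)] by auto
qed

text \<open>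
  A permutation that preserves letters is a product of transpositions exchanging equal letters, and
  those letters are not fermionic, so every factor acts trivially.  The induction removes one such
  transposition at a time: composing with the exchange of $x$ and $\sigma x$ fixes $x$ and unfixes
  nothing.
\<close>

lemma action_scalar_stabiliser_perm:
  assumes c: "c \<in> tensor_basis n i k r" and \<sigma>: "\<sigma> permutes {..<n}"
    and lab: "\<And>x. x < n \<Longrightarrow> label c (\<sigma> x) = label c x"
    and dist: "\<And>x y. x < n \<Longrightarrow> y < n \<Longrightarrow> label c x = label c y \<Longrightarrow> fermionic (label c x) \<Longrightarrow> x = y"
  shows "permute_index \<sigma> c = c \<and> action_scalar n \<sigma> (\<lambda>_. 1) c = 1"
  using \<sigma> lab
proof (induction "card {x. x < n \<and> \<sigma> x \<noteq> x}" arbitrary: \<sigma> rule: less_induct)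
  case less
  note \<sigma> = less.prems(1)
  show ?case
  proof (cases "\<exists>x<n. \<sigma> x \<noteq> x")
    case False
    hence "\<sigma> x = x" for x using permutes_not_in[OF \<sigma>, of x] by (cases "x < n") auto
    hence "\<sigma> = id" by (intro ext) simp
    thus ?thesis using permute_index_id[of c] action_scalar_id[OF c] by simp
  next
    case True
    then obtain x where x: "x < n" "\<sigma> x \<noteq> x" by blast
    define y where "y = \<sigma> x"
    have y: "y < n" "x \<noteq> y" using permutes_less[OF \<sigma> x(1)] x by (auto simp: y_def)
    have lxy: "label c x = label c y" using less.prems(2)[OF x(1)] by (simp add: y_def)
    define \<tau> where "\<tau> = transpose x y \<circ> \<sigma>"
    have tp: "transpose x y permutes {..<n}" using x y by (intro permutes_swap_id) auto
    have \<tau>: "\<tau> permutes {..<n}" unfolding \<tau>_def by (rule permutes_compose[OF \<sigma> tp])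
    have "{x. x < n \<and> \<tau> x \<noteq> x} \<subset> {x. x < n \<and> \<sigma> x \<noteq> x}"
    proof
      show "{x. x < n \<and> \<tau> x \<noteq> x} \<subseteq> {x. x < n \<and> \<sigma> x \<noteq> x}"
      proof safe
        fix w assume w: "w < n" "\<tau> w \<noteq> w" "\<sigma> w = w"
        hence "w \<noteq> x" using x by auto
        moreover have "w \<noteq> y" using w(3) x injD[OF permutes_inj[OF \<sigma>], of y x] by (auto simp: y_def)
        ultimately show False using w by (simp add: \<tau>_def transpose_def)
      qed
      have "\<tau> x = x" by (simp add: \<tau>_def y_def)
      hence "x \<in> {x. x < n \<and> \<sigma> x \<noteq> x}" "x \<notin> {x. x < n \<and> \<tau> x \<noteq> x}" using x by simp_all
      thus "{x. x < n \<and> \<tau> x \<noteq> x} \<noteq> {x. x < n \<and> \<sigma> x \<noteq> x}" by (intro notI) simp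
    qed
    hence "card {x. x < n \<and> \<tau> x \<noteq> x} < card {x. x < n \<and> \<sigma> x \<noteq> x}"
      by (intro psubset_card_mono) auto
    moreover have "label c (\<tau> w) = label c w" if "w < n" for w
    proof -
      have "label c (transpose x y u) = label c u" for u
        using lxy unfolding transpose_def by metis
      thus ?thesis using less.prems(2)[OF that] unfolding \<tau>_def comp_apply by metis
    qed
    ultimately have "permute_index \<tau> c = c \<and> action_scalar n \<tau> (\<lambda>_. 1) c = 1"
      by (intro less.hyps[OF _ \<tau>])
    hence IH: "permute_index \<tau> c = c" "action_scalar n \<tau> (\<lambda>_. 1) c = 1" by blast+
    have \<sigma>_eq: "\<sigma> = transpose x y \<circ> \<tau>" by (intro ext) (simp add: \<tau>_def)
    have "\<not> fermionic (label c x)" using dist[OF x(1) y(1) lxy] y(2) by auto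
    hence "permute_index (transpose x y) c = c" "action_scalar n (transpose x y) (\<lambda>_. 1) c = 1"
      using action_scalar_transpose[OF c x(1) y lxy] by (simp_all only: if_False)
    moreover have "permute_index \<sigma> c = permute_index (transpose x y) (permute_index \<tau> c)"
      unfolding \<sigma>_eq by (rule permute_index_comp[OF tp \<tau>])
    moreover have "action_scalar n \<sigma> (\<lambda>_. 1) c =
        action_scalar n (transpose x y) (\<lambda>_. 1) (permute_index \<tau> c) * action_scalar n \<tau> (\<lambda>_. 1) c"
      unfolding \<sigma>_eq using action_scalar_comp[OF tp \<tau> c, of "\<lambda>_. 1" "\<lambda>_. 1"] by simp
    ultimately show ?thesis using IH by simp
  qed
qed

text \<open>
  A stabilising element is a letter-preserving permutation matrix times a diagonal matrix of the group,
  so both factors can be tested separately.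
\<close>

lemma stabiliser_trivial_iff:
  assumes de: "d \<ge> 1" "e \<ge> 1" and n: "n \<ge> 1" and c: "c \<in> tensor_basis n i k r"
  shows "(\<forall>y. moves d e n c c y \<longrightarrow> y = 1) \<longleftrightarrow>
    (\<exists>s<e. \<forall>x<n. int (d * e) dvd charge (label c x) - int (s * d)) \<and>
    (\<forall>x<n. \<forall>y<n. label c x = label c y \<and> fermionic (label c x) \<longrightarrow> x = y)"
    (is "?L \<longleftrightarrow> ?T \<and> ?D")
proof -
  have de0: "d * e \<noteq> 0" using de by simp
  have diag: "action_scalar n id z c = (\<Prod>x<n. z x powi (- charge (label c x)))"
    if "\<forall>j<n. z j ^ (d * e) = 1" for z
  proof (rule action_scalar_diagonal_charge[OF c])
    fix j assume "j < n"
    hence "z j ^ (d * e) = 1" using that by blast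
    thus "z j \<noteq> 0" using de0 by (auto simp: power_0_left)
  qed
  have T: "?T \<longleftrightarrow> (\<forall>z. admissible d e n id z \<longrightarrow> action_scalar n id z c = 1)"
    unfolding torus_character_trivial_iff[OF de n, symmetric] admissible_def
    using diag by (auto simp: permutes_id)
  show ?thesis
  proof
    assume L: ?L
    have "?T"
      unfolding T
    proof (intro allI impI)
      fix z assume "admissible d e n id z"
      hence "moves d e n c c (action_scalar n id z c)"
        unfolding moves_def by (intro exI[of _ id] exI[of _ z]) (simp add: permute_index_id)
      thus "action_scalar n id z c = 1" using L by blast
    qed
    moreover have "?D"
    proof (intro allI impI, rule ccontr)
      fix x y assume xy: "x < n" "y < n" "label c x = label c y \<and> fermionic (label c x)" "x \<noteq> y"
      hence "permute_index (transpose x y) c = c" "action_scalar n (transpose x y) (\<lambda>_. 1) c = -1"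
        using action_scalar_transpose[OF c xy(1,2,4)] by auto
      moreover have "admissible d e n (transpose x y) (\<lambda>_. 1)"
        using xy permutes_swap_id[of x "{..<n}" y] by (simp add: admissible_def)
      ultimately have "moves d e n c c (-1)"
        unfolding moves_def by (intro exI[of _ "transpose x y"] exI[of _ "\<lambda>_. 1"]) simp
      hence "(-1 :: complex) = 1" using L by blast
      thus False by simp
    qed
    ultimately show "?T \<and> ?D" by blast
  next
    assume TD: "?T \<and> ?D"
    show ?L
    proof (intro allI impI)
      fix y assume "moves d e n c c y"
      then obtain \<sigma> z where *: "admissible d e n \<sigma> z" "c = permute_index \<sigma> c" "y = action_scalar n \<sigma> z c"
        unfolding moves_def by blast
      have \<sigma>: "\<sigma> permutes {..<n}" using * by (simp add: admissible_def)
      have lab: "label c (\<sigma> x) = label c x" for x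
        using label_permute_index[OF \<sigma>, of c "\<sigma> x"] *(2) permutes_inverses[OF \<sigma>] by simp
      have "permute_index \<sigma> c = c \<and> action_scalar n \<sigma> (\<lambda>_. 1) c = 1"
        by (rule action_scalar_stabiliser_perm[OF c \<sigma> lab]) (use TD in blast)
      moreover have "admissible d e n id z" using *(1) by (simp add: admissible_def permutes_id)
      hence "action_scalar n id z c = 1" using TD T by blast
      ultimately show "y = 1"
        using action_scalar_comp[OF \<sigma> permutes_id c, of "\<lambda>_. 1" z] *(3)
        by (simp add: permute_index_id)
    qed
  qed
qed


section \<open>Bigraded generating functions\<close>

text \<open>
  The coefficient of $q^i t^k$ is the number of elements of weight $(i, k)$, in the same encoding as
  two nested Laurent series that is used by \<^const>\<open>hilbert_series\<close>.
\<close>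

definition gf :: "'a set \<Rightarrow> ('a \<Rightarrow> nat \<times> nat) \<Rightarrow> rat fls fls" where
  "gf A w = fps_to_fls (Abs_fps (\<lambda>i. fps_to_fls (Abs_fps (\<lambda>k.
     of_nat (card {x \<in> A. w x = (i, k)})))))"

definition bifps_to_fls :: "(nat \<Rightarrow> nat \<Rightarrow> rat) \<Rightarrow> rat fls fls" where
  "bifps_to_fls c = fps_to_fls (Abs_fps (\<lambda>i. fps_to_fls (Abs_fps (c i))))"

lemma gf_altdef: "gf A w = bifps_to_fls (\<lambda>i k. of_nat (card {x \<in> A. w x = (i, k)}))"
  by (simp add: gf_def bifps_to_fls_def)

lemma Abs_fps_add: "Abs_fps (\<lambda>i. f i + g i) = Abs_fps f + Abs_fps g"
  by (simp add: fps_eq_iff)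

lemma bifps_to_fls_add: "bifps_to_fls c + bifps_to_fls c' = bifps_to_fls (\<lambda>i k. c i k + c' i k)"
  unfolding bifps_to_fls_def by (simp add: Abs_fps_add)

lemma fps_to_fls_sum_distrib: "fps_to_fls (\<Sum>x\<in>A. f x) = (\<Sum>x\<in>A. fps_to_fls (f x))"
  by (induction A rule: infinite_finite_induct) simp_all

lemma bifps_to_fls_mult:
  "bifps_to_fls c * bifps_to_fls c' =
     bifps_to_fls (\<lambda>i k. \<Sum>i'\<le>i. \<Sum>k'\<le>k. c i' k' * c' (i - i') (k - k'))"
proof -
  have inner: "fps_to_fls (Abs_fps (c i)) * fps_to_fls (Abs_fps (c' j)) =
      fps_to_fls (Abs_fps (\<lambda>k. \<Sum>k'\<le>k. c i k' * c' j (k - k')))" for i j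
    by (subst fls_times_fps_to_fls[symmetric], rule arg_cong[where f = fps_to_fls])
       (simp add: fps_eq_iff fps_mult_nth atLeast0AtMost)
  have "Abs_fps (\<lambda>i. fps_to_fls (Abs_fps (c i))) * Abs_fps (\<lambda>i. fps_to_fls (Abs_fps (c' i))) =
      Abs_fps (\<lambda>i. fps_to_fls (Abs_fps (\<lambda>k. \<Sum>i'\<le>i. \<Sum>k'\<le>k. c i' k' * c' (i - i') (k - k'))))"
    (is "?L = ?R")
  proof (rule fps_ext)
    fix i
    have "?L $ i = (\<Sum>i'\<le>i. fps_to_fls (Abs_fps (\<lambda>k. \<Sum>k'\<le>k. c i' k' * c' (i - i') (k - k'))))"
      by (simp add: fps_mult_nth atLeast0AtMost inner)
    also have "\<dots> = ?R $ i"
      by (subst fps_to_fls_sum_distrib[symmetric]) (simp add: fps_eq_iff fps_sum_nth)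
    finally show "?L $ i = ?R $ i" .
  qed
  thus ?thesis
    unfolding bifps_to_fls_def by (subst fls_times_fps_to_fls[symmetric]) simp
qed

abbreviation qq :: "rat fls fls" where "qq \<equiv> fls_X"
abbreviation tt :: "rat fls fls" where "tt \<equiv> fls_const fls_X"

lemma monomial_eq_bifps: "qq ^ a * tt ^ b = bifps_to_fls (\<lambda>i k. of_bool (i = a \<and> k = b))"
proof -
  have t: "tt ^ b = fps_to_fls (fps_const (fps_to_fls (fps_X ^ b)))"
    by (simp add: fps_to_fls_power fps_X_to_fls fls_const_power)
  have q: "qq ^ a = fps_to_fls (fps_X ^ a)"
    by (simp add: fps_to_fls_power fps_X_to_fls)
  have "fps_X ^ a * fps_const (fps_to_fls (fps_X ^ b)) =
      Abs_fps (\<lambda>i. fps_to_fls (Abs_fps (\<lambda>k. of_bool (i = a \<and> k = b) :: rat)))"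
  proof (rule fps_ext)
    fix i
    show "(fps_X ^ a * fps_const (fps_to_fls (fps_X ^ b))) $ i =
      Abs_fps (\<lambda>i. fps_to_fls (Abs_fps (\<lambda>k. of_bool (i = a \<and> k = b) :: rat))) $ i"
      by (cases "i = a") (auto simp: fps_eq_iff fps_X_power_nth intro!: arg_cong[where f = fps_to_fls])
  qed
  thus ?thesis unfolding bifps_to_fls_def q t by (subst fls_times_fps_to_fls[symmetric]) simp
qed

text \<open>
  Without finite fibres the cardinalities in \<^const>\<open>gf\<close> would silently be $0$, and sums and
  products of generating functions would lose their meaning.
\<close>

definition finite_fibres :: "'a set \<Rightarrow> ('a \<Rightarrow> 'b) \<Rightarrow> bool" where
  "finite_fibres A w \<longleftrightarrow> (\<forall>p. finite {x \<in> A. w x = p})"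

lemma finite_fibresD: "finite_fibres A w \<Longrightarrow> finite {x \<in> A. w x = p}"
  by (simp only: finite_fibres_def)

lemma finite_fibres_subset: "finite_fibres B w \<Longrightarrow> A \<subseteq> B \<Longrightarrow> finite_fibres A w"
  unfolding finite_fibres_def
proof
  fix p assume "\<forall>p. finite {x \<in> B. w x = p}" "A \<subseteq> B"
  thus "finite {x \<in> A. w x = p}"
    by (intro finite_subset[of "{x \<in> A. w x = p}" "{x \<in> B. w x = p}"]) blast+
qed

lemma gf_image: "inj_on f A \<Longrightarrow> gf (f ` A) w = gf A (w \<circ> f)"
proof -
  assume inj: "inj_on f A"
  have "card {x \<in> f ` A. w x = p} = card {x \<in> A. (w \<circ> f) x = p}" for p
  proof -
    have "{x \<in> f ` A. w x = p} = f ` {x \<in> A. (w \<circ> f) x = p}" by auto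
    thus ?thesis using inj by (simp add: card_image inj_on_def)
  qed
  thus ?thesis by (simp add: gf_def)
qed

lemma gf_cong: "A = B \<Longrightarrow> (\<And>x. x \<in> B \<Longrightarrow> w x = v x) \<Longrightarrow> gf A w = gf B v"
proof -
  assume "A = B" "\<And>x. x \<in> B \<Longrightarrow> w x = v x"
  hence "{x \<in> A. w x = p} = {x \<in> B. v x = p}" for p by auto
  thus ?thesis by (simp add: gf_def)
qed

lemma gf_Un:
  assumes "A \<inter> B = {}" "finite_fibres A w" "finite_fibres B w"
  shows "gf (A \<union> B) w = gf A w + gf B w"
proof -
  have "card {x \<in> A \<union> B. w x = p} = card {x \<in> A. w x = p} + card {x \<in> B. w x = p}" for p
  proof -
    have "{x \<in> A \<union> B. w x = p} = {x \<in> A. w x = p} \<union> {x \<in> B. w x = p}" by auto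
    moreover have "{x \<in> A. w x = p} \<inter> {x \<in> B. w x = p} = {}" using assms(1) by auto
    ultimately show ?thesis using assms(2,3) by (simp add: finite_fibresD card_Un_disjoint)
  qed
  thus ?thesis by (simp add: gf_altdef bifps_to_fls_add)
qed

lemma gf_empty: "gf {} w = 0"
proof -
  have "fps_to_fls (Abs_fps (\<lambda>k. 0 :: rat)) = 0"
    by (simp add: fps_eq_iff)
  moreover have "fps_to_fls (Abs_fps (\<lambda>k. 0 :: rat fls)) = 0"
    by (simp add: fps_eq_iff)
  ultimately show ?thesis by (simp add: gf_def)
qed

lemma gf_UN:
  assumes "finite S" "\<And>s s'. s \<in> S \<Longrightarrow> s' \<in> S \<Longrightarrow> s \<noteq> s' \<Longrightarrow> A s \<inter> A s' = {}"
    and "\<And>s. s \<in> S \<Longrightarrow> finite_fibres (A s) w"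
  shows "gf (\<Union>s\<in>S. A s) w = (\<Sum>s\<in>S. gf (A s) w)"
  using assms
proof (induction S rule: finite_induct)
  case (insert s S)
  have "finite_fibres (\<Union>s\<in>S. A s) w"
  proof -
    have "{x \<in> (\<Union>s\<in>S. A s). w x = p} = (\<Union>s\<in>S. {x \<in> A s. w x = p})" for p by auto
    thus ?thesis using insert by (simp add: finite_fibres_def)
  qed
  moreover have "A s \<inter> (\<Union>s\<in>S. A s) = {}"
    using insert.prems(1)[of s] insert.hyps(2) by fastforce
  ultimately have "gf (A s \<union> (\<Union>s\<in>S. A s)) w = gf (A s) w + gf (\<Union>s\<in>S. A s) w"
    using insert.prems by (intro gf_Un) auto
  thus ?case using insert by simp
qed (simp add: gf_empty)

lemma gf_times:
  assumes "finite_fibres A w" "finite_fibres B v"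
  shows "gf (A \<times> B) (\<lambda>(x, y). (fst (w x) + fst (v y), snd (w x) + snd (v y))) = gf A w * gf B v"
proof -
  have "card {z \<in> A \<times> B. (\<lambda>(x, y). (fst (w x) + fst (v y), snd (w x) + snd (v y))) z = (i, k)} =
      (\<Sum>i'\<le>i. \<Sum>k'\<le>k. card {x \<in> A. w x = (i', k')} * card {y \<in> B. v y = (i - i', k - k')})"
    (is "card ?Z = _") for i k
  proof -
    let ?F = "\<lambda>(i', k'). {x \<in> A. w x = (i', k')} \<times> {y \<in> B. v y = (i - i', k - k')}"
    have "?Z = (\<Union>p\<in>{..i} \<times> {..k}. ?F p)"
    proof (intro equalityI subsetI)
      fix z assume "z \<in> ?Z"
      then obtain x y where "z = (x, y)" "x \<in> A" "y \<in> B" "fst (w x) + fst (v y) = i"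
        "snd (w x) + snd (v y) = k" by auto
      thus "z \<in> (\<Union>p\<in>{..i} \<times> {..k}. ?F p)"
        by (intro UN_I[of "w x"]) (auto simp: mem_Times_iff case_prod_beta prod_eq_iff)
    qed auto
    also have "card \<dots> = (\<Sum>p\<in>{..i} \<times> {..k}. card (?F p))"
      using assms by (intro card_UN_disjoint) (auto simp: finite_fibres_def)
    also have "\<dots> = (\<Sum>i'\<le>i. \<Sum>k'\<le>k. card (?F (i', k')))"
      by (simp add: sum.cartesian_product case_prod_beta)
    finally show ?thesis by (simp add: card_cartesian_product)
  qed
  thus ?thesis unfolding gf_altdef bifps_to_fls_mult by simp
qed

lemma gf_shift:
  assumes "finite_fibres A w"
  shows "gf A (\<lambda>x. (a + fst (w x), b + snd (w x))) = qq ^ a * tt ^ b * gf A w"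
proof -
  have "gf {()} (\<lambda>_. (a, b)) = qq ^ a * tt ^ b"
  proof -
    have "card {x \<in> {()}. (a, b) = (i, k)} = of_bool (i = a \<and> k = b)" for i k
      by (cases "i = a \<and> k = b") auto
    thus ?thesis unfolding gf_altdef monomial_eq_bifps
      by (intro arg_cong[where f = bifps_to_fls] ext) (simp add: of_bool_def)
  qed
  moreover have "gf ({()} \<times> A) (\<lambda>(x, y). (fst (a, b) + fst (w y), snd (a, b) + snd (w y))) =
      gf {()} (\<lambda>_. (a, b)) * gf A w"
    using gf_times[of "{()}" "\<lambda>_. (a, b)" A w] assms by (simp add: finite_fibres_def)
  moreover have "gf (Pair () ` A) (\<lambda>(x, y). (fst (a, b) + fst (w y), snd (a, b) + snd (w y))) =
      gf A (\<lambda>x. (a + fst (w x), b + snd (w x)))"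
    by (subst gf_image) (auto simp: inj_on_def comp_def)
  moreover have "Pair () ` A = {()} \<times> A" by auto
  ultimately show ?thesis by simp
qed

section \<open>The $q$-binomial theorem\<close>

text \<open>
  Multisets of $k$ letters from two ladders indexed by rungs $j$: bosonic letters \<open>(j, False)\<close> may be
  repeated, fermionic letters \<open>(j, True)\<close> may not.
\<close>

definition fermi_bose :: "nat \<Rightarrow> (nat \<times> bool) multiset set" where
  "fermi_bose k = {M. size M = k \<and> (\<forall>j. count M (j, True) \<le> 1)}"

text \<open>
  The lowest bosonic letter has weight $x$, the lowest fermionic letter weight $y$, and every rung adds
  $N$ to the first degree.
\<close>

fun ladder_weight :: "nat \<Rightarrow> nat \<times> nat \<Rightarrow> nat \<times> nat \<Rightarrow> nat \<times> bool \<Rightarrow> nat \<times> nat" where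
  "ladder_weight N x y (j, p) = (N * j + fst (if p then y else x), snd (if p then y else x))"

definition mset_wt :: "('a \<Rightarrow> nat \<times> nat) \<Rightarrow> 'a multiset \<Rightarrow> nat \<times> nat" where
  "mset_wt w M = (\<Sum>z\<in>#M. fst (w z), \<Sum>z\<in>#M. snd (w z))"

lemma finite_msets_bounded_sum:
  fixes f :: "'a \<Rightarrow> nat"
  assumes "\<And>m. finite {z. f z \<le> m}"
  shows "finite {M. size M = k \<and> (\<Sum>z\<in>#M. f z) = m}"
proof (rule finite_subset)
  show "{M. size M = k \<and> (\<Sum>z\<in>#M. f z) = m} \<subseteq> mset ` {zs. set zs \<subseteq> {z. f z \<le> m} \<and> length zs = k}"
  proof
    fix M assume M: "M \<in> {M. size M = k \<and> (\<Sum>z\<in>#M. f z) = m}"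
    obtain zs where zs: "mset zs = M" using ex_mset by blast
    have bound: "f z \<le> m" if "z \<in># M" for z
    proof -
      obtain M' where "M = add_mset z M'" using multi_member_split[OF \<open>z \<in># M\<close>] by blast
      thus ?thesis using M by auto
    qed
    have "set zs \<subseteq> {z. f z \<le> m}"
      using bound unfolding zs[symmetric] by auto
    moreover have "length zs = k"
      using M unfolding zs[symmetric] by auto
    ultimately show "M \<in> mset ` {zs. set zs \<subseteq> {z. f z \<le> m} \<and> length zs = k}" using zs by auto
  qed
  show "finite (mset ` {zs. set zs \<subseteq> {z. f z \<le> m} \<and> length zs = k})"
    using assms finite_lists_length_eq by blast
qed

lemma finite_fibres_fermi_bose:
  assumes "N \<ge> 1"
  shows "finite_fibres (fermi_bose k) (mset_wt (ladder_weight N x y))"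
proof -
  have fin: "finite {z. fst (ladder_weight N x y z) \<le> m}" for m
  proof (rule finite_subset)
    show "{z. fst (ladder_weight N x y z) \<le> m} \<subseteq> {..m} \<times> UNIV"
    proof
      fix z assume "z \<in> {z. fst (ladder_weight N x y z) \<le> m}"
      moreover obtain j p where z: "z = (j, p)" by force
      ultimately have "N * j \<le> m" by simp
      have "1 * j \<le> N * j" using assms by (intro mult_right_mono) auto
      hence "j \<le> m" using \<open>N * j \<le> m\<close> by linarith
      thus "z \<in> {..m} \<times> UNIV" using z by simp
    qed
  qed auto
  have "finite {M \<in> fermi_bose k. mset_wt (ladder_weight N x y) M = p}" for p
    by (rule finite_subset[OF _ finite_msets_bounded_sum[OF fin, of k "fst p"]])
       (auto simp: fermi_bose_def mset_wt_def)
  thus ?thesis by (simp add: finite_fibres_def)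
qed

text \<open>
  Moving all letters up by one rung.  A multiset of $k$ letters gains the factor $q^{Nk}$.
\<close>

definition raise :: "(nat \<times> bool) multiset \<Rightarrow> (nat \<times> bool) multiset" where
  "raise M = image_mset (map_prod Suc id) M"

lemma count_raise: "count (raise M) (Suc j, p) = count M (j, p)"
  by (induction M) (auto simp: raise_def)

lemma inj_raise: "inj raise"
  unfolding raise_def by (rule multiset.inj_map) (auto simp: inj_def)

lemma zero_notin_raise: "(0, p) \<notin># raise M"
  by (auto simp: raise_def)

lemma raise_cases:
  assumes "(0, False) \<notin># M" "(0, True) \<notin># M"
  obtains M' where "M = raise M'"
proof
  show "M = raise (image_mset (map_prod (\<lambda>j. j - 1) id) M)"
  proof -
    have "image_mset (map_prod Suc id \<circ> map_prod (\<lambda>j. j - 1) id) M = image_mset id M"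
    proof (rule image_mset_cong)
      fix z assume "z \<in># M"
      moreover obtain j p where "z = (j, p)" by force
      ultimately have "j \<noteq> 0" using assms by (metis (full_types))
      thus "(map_prod Suc id \<circ> map_prod (\<lambda>j. j - 1) id) z = id z" using \<open>z = (j, p)\<close> by simp
    qed
    thus ?thesis by (simp add: raise_def multiset.map_comp)
  qed
qed

lemma raise_fermi_bose_iff: "raise M \<in> fermi_bose k \<longleftrightarrow> M \<in> fermi_bose k"
proof -
  have "(\<forall>j. count (raise M) (j, True) \<le> 1) \<longleftrightarrow> (\<forall>j. count M (j, True) \<le> 1)"
    (is "?L \<longleftrightarrow> ?R")
  proof
    assume ?L thus ?R using count_raise by metis
  next
    assume R: ?R
    show ?L
    proof
      fix j show "count (raise M) (j, True) \<le> 1"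
      proof (cases j)
        case 0 thus ?thesis using zero_notin_raise[of True M] by (simp add: not_in_iff)
      next
        case (Suc j') thus ?thesis using R by (simp add: count_raise)
      qed
    qed
  qed
  moreover have "size (raise M) = size M" by (simp add: raise_def)
  ultimately show ?thesis by (simp add: fermi_bose_def)
qed

lemma mset_wt_raise:
  "mset_wt (ladder_weight N x y) (raise M) =
     (N * size M + fst (mset_wt (ladder_weight N x y) M), 0 + snd (mset_wt (ladder_weight N x y) M))"
  by (induction M) (auto simp: raise_def mset_wt_def)

text \<open>
  A multiset either contains the lowest bosonic letter, which can be removed, or not.  In the latter
  case, after the possible removal of the lowest fermionic letter, it is raised from another one.
\<close>

lemma fermi_bose_Suc:
  "fermi_bose (Suc k) = add_mset (0, False) ` fermi_bose k
     \<union> (add_mset (0, True) \<circ> raise) ` fermi_bose k \<union> raise ` fermi_bose (Suc k)"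
proof (intro equalityI subsetI)
  fix M assume M: "M \<in> fermi_bose (Suc k)"
  show "M \<in> add_mset (0, False) ` fermi_bose k
     \<union> (add_mset (0, True) \<circ> raise) ` fermi_bose k \<union> raise ` fermi_bose (Suc k)"
  proof (cases "(0, False) \<in># M")
    case True
    then obtain M' where "M = add_mset (0, False) M'" by (blast dest: multi_member_split)
    thus ?thesis using M by (auto simp: fermi_bose_def)
  next
    case no_even: False
    show ?thesis
    proof (cases "(0, True) \<in># M")
      case True
      then obtain M' where M': "M = add_mset (0, True) M'" by (blast dest: multi_member_split)
      have *: "count (add_mset (0, True) M') (j, True) \<le> 1" for j
        using M M' by (auto simp: fermi_bose_def)
      have "count M' (j, True) \<le> 1" for j
        using *[of j] by (cases j) auto
      moreover have "(0, True) \<notin># M'" using *[of 0] by (simp add: not_in_iff)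
      moreover have "(0, False) \<notin># M'" using no_even M' by auto
      ultimately obtain M'' where "M' = raise M''" using raise_cases by blast
      moreover have "M' \<in> fermi_bose k" using M M' \<open>\<And>j. count M' (j, True) \<le> 1\<close>
        by (auto simp: fermi_bose_def)
      ultimately show ?thesis using M' by (auto simp: raise_fermi_bose_iff)
    next
      case False
      then obtain M' where "M = raise M'" using no_even raise_cases by blast
      thus ?thesis using M by (auto simp: raise_fermi_bose_iff)
    qed
  qed
next
  fix M assume "M \<in> add_mset (0, False) ` fermi_bose k
     \<union> (add_mset (0, True) \<circ> raise) ` fermi_bose k \<union> raise ` fermi_bose (Suc k)"
  then consider M' where "M = add_mset (0, False) M'" "M' \<in> fermi_bose k"
    | M' where "M = add_mset (0, True) (raise M')" "M' \<in> fermi_bose k"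
    | M' where "M = raise M'" "M' \<in> fermi_bose (Suc k)" by auto
  thus "M \<in> fermi_bose (Suc k)"
  proof cases
    case 1
    thus ?thesis by (auto simp: fermi_bose_def)
  next
    case 2
    hence "raise M' \<in> fermi_bose k" by (simp add: raise_fermi_bose_iff)
    thus ?thesis using 2 zero_notin_raise[of True M'] by (auto simp: fermi_bose_def not_in_iff)
  next
    case 3
    thus ?thesis by (simp add: raise_fermi_bose_iff)
  qed
qed

lemma mset_wt_add_mset: "mset_wt w (add_mset z M) =
    (fst (w z) + fst (mset_wt w M), snd (w z) + snd (mset_wt w M))"
  by (simp add: mset_wt_def)

lemma one_minus_fls_X_power_nonzero: "m \<ge> 1 \<Longrightarrow> 1 - (fls_X :: rat fls fls) ^ m \<noteq> 0"
proof
  assume "m \<ge> 1" "1 - (fls_X :: rat fls fls) ^ m = 0"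
  hence "fls_subdegree ((fls_X :: rat fls fls) ^ m) = fls_subdegree (1 :: rat fls fls)" by simp
  thus False using \<open>m \<ge> 1\<close> by (simp add: fls_subdegree_pow)
qed

text \<open>
  The three kinds of multisets in \<open>fermi_bose_Suc\<close> contribute $x g_k$, $y q^{Nk} g_k$ and
  $q^{N(k+1)} g_{k+1}$ to the generating function $g_{k+1}$.
\<close>

lemma gf_fermi_bose_rec:
  fixes N :: nat and x y :: "nat \<times> nat"
  assumes "N \<ge> 1"
  defines "w \<equiv> mset_wt (ladder_weight N x y)"
  shows "(1 - qq ^ (N * Suc k)) * gf (fermi_bose (Suc k)) w =
    (qq ^ fst x * tt ^ snd x + qq ^ fst y * tt ^ snd y * qq ^ (N * k)) * gf (fermi_bose k) w"
proof -
  define A B C where "A = add_mset (0, False) ` fermi_bose k"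
    and "B = (add_mset (0, True) \<circ> raise) ` fermi_bose k" and "C = raise ` fermi_bose (Suc k)"
  have split: "fermi_bose (Suc k) = A \<union> B \<union> C" unfolding A_def B_def C_def by (rule fermi_bose_Suc)
  have fin: "finite_fibres (fermi_bose l) w" for l
    unfolding w_def by (rule finite_fibres_fermi_bose[OF assms(1)])
  have fin': "finite_fibres D w" if "D \<subseteq> fermi_bose (Suc k)" for D
    using finite_fibres_subset[OF fin that] .
  have has: "(0, False) \<in># M" if "M \<in> A" for M using that by (auto simp: A_def)
  have hasnt: "(0, False) \<notin># M" "(0, True) \<in># M" if "M \<in> B" for M
    using that zero_notin_raise by (auto simp: B_def)
  have hasnt': "(0, p) \<notin># M" if "M \<in> C" for M p
    using that zero_notin_raise by (auto simp: C_def)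
  have "A \<inter> B = {}" "(A \<union> B) \<inter> C = {}"
    using has hasnt hasnt' by blast+
  moreover have "finite_fibres A w" "finite_fibres B w" "finite_fibres C w" "finite_fibres (A \<union> B) w"
    by (rule fin', unfold split, blast)+
  ultimately have "gf (fermi_bose (Suc k)) w = gf A w + gf B w + gf C w"
    unfolding split by (simp only: gf_Un)
  moreover have "gf A w = qq ^ fst x * tt ^ snd x * gf (fermi_bose k) w"
  proof -
    have "inj_on (add_mset (0, False)) (fermi_bose k)" by (simp add: inj_on_def)
    hence "gf A w = gf (fermi_bose k) (w \<circ> add_mset (0, False))"
      unfolding A_def by (rule gf_image)
    also have "\<dots> = gf (fermi_bose k) (\<lambda>M. (fst x + fst (w M), snd x + snd (w M)))"
      by (rule gf_cong) (simp_all add: w_def mset_wt_add_mset)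
    also have "\<dots> = qq ^ fst x * tt ^ snd x * gf (fermi_bose k) w" by (rule gf_shift[OF fin])
    finally show ?thesis .
  qed
  moreover have "gf B w = qq ^ (fst y + N * k) * tt ^ snd y * gf (fermi_bose k) w"
  proof -
    have "inj_on (add_mset (0, True) \<circ> raise) (fermi_bose k)"
      using injD[OF inj_raise] by (auto simp: inj_on_def)
    hence "gf B w = gf (fermi_bose k) (w \<circ> (add_mset (0, True) \<circ> raise))"
      unfolding B_def by (rule gf_image)
    also have "\<dots> = gf (fermi_bose k) (\<lambda>M. (fst y + N * k + fst (w M), snd y + snd (w M)))"
      by (rule gf_cong) (simp_all add: w_def mset_wt_add_mset mset_wt_raise fermi_bose_def)
    also have "\<dots> = qq ^ (fst y + N * k) * tt ^ snd y * gf (fermi_bose k) w"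
      by (rule gf_shift[OF fin])
    finally show ?thesis .
  qed
  moreover have "gf C w = qq ^ (N * Suc k) * tt ^ 0 * gf (fermi_bose (Suc k)) w"
  proof -
    have "gf C w = gf (fermi_bose (Suc k)) (w \<circ> raise)"
      unfolding C_def by (rule gf_image[OF inj_on_subset[OF inj_raise subset_UNIV]])
    also have "\<dots> = gf (fermi_bose (Suc k)) (\<lambda>M. (N * Suc k + fst (w M), 0 + snd (w M)))"
      by (rule gf_cong) (simp_all add: w_def mset_wt_raise fermi_bose_def)
    also have "\<dots> = qq ^ (N * Suc k) * tt ^ 0 * gf (fermi_bose (Suc k)) w"
      by (rule gf_shift[OF fin])
    finally show ?thesis .
  qed
  ultimately show ?thesis by (simp add: algebra_simps power_add)
qed

text \<open>
  Counting by the number of fermionic letters instead turns this identity into the usual expansion of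
  the finite product in the $q$-binomial theorem.
\<close>

lemma gf_fermi_bose:
  assumes "N \<ge> 1"
  shows "gf (fermi_bose k) (mset_wt (ladder_weight N x y)) =
    (\<Prod>j<k. qq ^ fst x * tt ^ snd x + qq ^ fst y * tt ^ snd y * qq ^ (N * j)) / (\<Prod>j<k. 1 - qq ^ (N * Suc j))"
proof (induction k)
  case 0
  have "fermi_bose 0 = {{#}}" by (auto simp: fermi_bose_def)
  moreover have "card {x \<in> {{#}}. mset_wt w x = (i, k)} = of_bool (i = 0 \<and> k = 0)"
    for w :: "nat \<times> bool \<Rightarrow> _" and i k
  proof -
    have "{x \<in> {{#}}. mset_wt w x = (i, k)} = (if i = 0 \<and> k = 0 then {{#}} else {})"
      by (auto simp: mset_wt_def)
    thus ?thesis by simp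
  qed
  ultimately have "gf (fermi_bose 0) (mset_wt (ladder_weight N x y)) = qq ^ 0 * tt ^ 0"
    unfolding gf_altdef monomial_eq_bifps by (intro arg_cong[where f = bifps_to_fls] ext) simp
  thus ?case by simp
next
  case (Suc k)
  have nonzero: "1 - qq ^ (N * Suc k) \<noteq> 0"
    using assms by (intro one_minus_fls_X_power_nonzero) simp
  have solve: "(1 - b) * G = c * g \<Longrightarrow> 1 - b \<noteq> 0 \<Longrightarrow> g = P / D \<Longrightarrow> G = P * c / (D * (1 - b))"
    for b G c g P D :: "rat fls fls"
  proof -
    assume "(1 - b) * G = c * g" "1 - b \<noteq> 0" "g = P / D"
    hence "G = c * (P / D) / (1 - b)" by (metis nonzero_mult_div_cancel_left)
    thus ?thesis by (simp add: mult.commute)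
  qed
  show ?case
    unfolding prod.lessThan_Suc
    by (rule solve[OF gf_fermi_bose_rec[OF assms] nonzero Suc.IH])
qed


section \<open>Invariants as multisets of letters\<close>

fun letter_weight :: "letter \<Rightarrow> nat \<times> nat" where
  "letter_weight (a, \<epsilon>, \<delta>) = (a, of_bool \<epsilon>)"

text \<open>
  The words of $n$ letters, up to order, of which $r$ have the second bit set, whose charges are all
  congruent to $m$ modulo $N$, and in which no fermionic letter is repeated.
\<close>

definition sector :: "nat \<Rightarrow> nat \<Rightarrow> nat \<Rightarrow> nat \<Rightarrow> letter multiset set" where
  "sector N m n r = {M. size M = n \<and> size (filter_mset (snd \<circ> snd) M) = r
     \<and> (\<forall>l\<in>#M. int N dvd charge l - int m) \<and> (\<forall>l. fermionic l \<longrightarrow> count M l \<le> 1)}"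

lemma sum_mset_over_content: "(\<Sum>l\<in>#content n c. f l) = (\<Sum>x<n. f (label c x))"
  by (simp add: content_def multiset.map_comp sum_unfold_sum_mset comp_def)

lemma size_filter_content: "size (filter_mset P (content n c)) = card {x \<in> {..<n}. P (label c x)}"
  by (simp add: content_def filter_mset_image_mset comp_def)

lemma set_mset_content: "set_mset (content n c) = label c ` {..<n}"
  by (simp add: content_def)

lemma count_content: "count (content n c) l = card {x \<in> {..<n}. label c x = l}"
  by (simp add: content_def count_image_mset_eq_card_vimage)

lemma mset_wt_content:
  assumes "c \<in> tensor_basis n i k r"
  shows "mset_wt letter_weight (content n c) = (i, k)"
    and "size (filter_mset (snd \<circ> snd) (content n c)) = r"
proof -
  obtain a I J where [simp]: "c = (a, I, J)" by (cases c)
  have IJ: "{..<n} \<inter> I = I" "{x. x < n \<and> x \<in> J} = J" using assms by (auto simp: in_tensor_basis_iff)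
  show "mset_wt letter_weight (content n c) = (i, k)"
    using assms by (simp add: mset_wt_def sum_mset_over_content in_tensor_basis_iff of_bool_def sum.If_cases IJ)
  show "size (filter_mset (snd \<circ> snd) (content n c)) = r"
    using assms by (simp add: size_filter_content in_tensor_basis_iff IJ)
qed

lemma count_content_le_1_iff:
  "(\<forall>l. fermionic l \<longrightarrow> count (content n c) l \<le> 1) \<longleftrightarrow>
   (\<forall>x<n. \<forall>y<n. label c x = label c y \<and> fermionic (label c x) \<longrightarrow> x = y)"
proof -
  have "count (content n c) l \<le> 1 \<longleftrightarrow> (\<forall>x<n. \<forall>y<n. label c x = l \<and> label c y = l \<longrightarrow> x = y)" for l
    unfolding count_content by (subst One_nat_def, subst card_le_Suc0_iff_eq) auto
  thus ?thesis by (simp only:) metis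
qed

text \<open>
  Any enumeration of the multiset is the word of a basis vector, whose degrees can be read off the
  multiset.
\<close>

lemma ex_content:
  assumes M: "size M = n" "mset_wt letter_weight M = (i, k)" "size (filter_mset (snd \<circ> snd) M) = r"
  obtains c where "c \<in> tensor_basis n i k r" "content n c = M"
proof -
  obtain ls where ls: "mset ls = M" using ex_mset by blast
  have len: "length ls = n" using M(1) ls by auto
  define a where "a = (\<Sum>x<n. Poly_Mapping.single x (fst (ls ! x)))"
  define c where "c = (a, {x. x < n \<and> fst (snd (ls ! x))}, {x. x < n \<and> snd (snd (ls ! x))})"
  have lookup: "Poly_Mapping.lookup a x = (if x < n then fst (ls ! x) else 0)" for x
    by (simp add: a_def lookup_sum lookup_single when_def)
  have "label c x = ls ! x" if "x < n" for x using that by (simp add: c_def lookup)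
  hence "content n c = image_mset ((!) ls) (mset_set {..<n})"
    unfolding content_def by (intro image_mset_cong) simp
  also have "\<dots> = mset (map ((!) ls) [0..<n])" by (simp add: atLeast0LessThan)
  also have "\<dots> = M" using len ls map_nth[of ls] by simp
  finally have content: "content n c = M" .
  have "Poly_Mapping.keys a \<subseteq> {..<n}" by (auto simp: in_keys_iff lookup split: if_splits)
  hence "c \<in> tensor_basis n (\<Sum>j<n. Poly_Mapping.lookup a j)
      (card {x. x < n \<and> fst (snd (ls ! x))}) (card {x. x < n \<and> snd (snd (ls ! x))})"
    (is "c \<in> tensor_basis n ?i ?k ?r")
    by (auto simp: c_def in_tensor_basis_iff)
  moreover from mset_wt_content[OF this] have "?i = i" "?k = k" "?r = r" using M content by auto
  ultimately show ?thesis using that content by blast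
qed

text \<open>
  The orbits with trivial stabiliser action are the multisets in the sectors with residues $sd$.
\<close>

lemma dim_tensor_invariants:
  assumes de: "d \<ge> 1" "e \<ge> 1" and n: "n \<ge> 1"
  shows "vector_space.dim cscale (tensor_invariants n i k r (G_group d e n)) =
    card {M \<in> (\<Union>s<e. sector (d * e) (s * d) n r). mset_wt letter_weight M = (i, k)}"
proof -
  let ?B = "tensor_basis n i k r"
  have de0: "d * e \<noteq> 0" using de by simp
  have "vector_space.dim cscale (tensor_invariants n i k r (G_group d e n)) =
      card (content n ` {b \<in> ?B. \<forall>z. moves d e n b b z \<longrightarrow> z = 1})"
    unfolding tensor_invariants_eq[OF de0]
  proof (rule dim_scaled_equivalence)
    show "finite ?B" by (rule finite_tensor_basis)
    show "moves d e n c c 1" if "c \<in> ?B" for c by (rule moves_refl[OF that])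
    show "z \<noteq> 0 \<and> moves d e n c b (inverse z)" if "b \<in> ?B" "c \<in> ?B" "moves d e n b c z" for b c z
      by (rule moves_sym[OF that(1) de0 that(3)])
    show "moves d e n a c (z * y)" if "a \<in> ?B" "b \<in> ?B" "c \<in> ?B" "moves d e n a b y" "moves d e n b c z"
      for a b c y z by (rule moves_trans[OF that(1,4,5)])
    show "(\<exists>z. moves d e n b c z) \<longleftrightarrow> content n b = content n c" if "b \<in> ?B" "c \<in> ?B" for b c
      by (rule moves_iff_content[OF that])
  qed
  also have "content n ` {b \<in> ?B. \<forall>z. moves d e n b b z \<longrightarrow> z = 1} =
      {M \<in> (\<Union>s<e. sector (d * e) (s * d) n r). mset_wt letter_weight M = (i, k)}"
    (is "?L = ?R")
  proof -
    have iff: "(\<forall>z. moves d e n c c z \<longrightarrow> z = 1) \<longleftrightarrow> content n c \<in> (\<Union>s<e. sector (d * e) (s * d) n r)"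
      if c: "c \<in> ?B" for c
    proof -
      have "content n c \<in> sector (d * e) (s * d) n r \<longleftrightarrow>
          (\<forall>x<n. int (d * e) dvd charge (label c x) - int (s * d)) \<and>
          (\<forall>l. fermionic l \<longrightarrow> count (content n c) l \<le> 1)" for s
      proof -
        have "size (content n c) = n" by (simp add: content_def)
        thus ?thesis
          unfolding sector_def mem_Collect_eq set_mset_content
          using mset_wt_content(2)[OF c] by (auto simp only: ball_simps lessThan_iff)
      qed
      hence "content n c \<in> (\<Union>s<e. sector (d * e) (s * d) n r) \<longleftrightarrow>
          (\<exists>s<e. \<forall>x<n. int (d * e) dvd charge (label c x) - int (s * d)) \<and>
          (\<forall>l. fermionic l \<longrightarrow> count (content n c) l \<le> 1)" by blast
      thus ?thesis
        unfolding stabiliser_trivial_iff[OF de n c] count_content_le_1_iff by (rule sym)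
    qed
    show ?thesis
    proof (intro equalityI subsetI)
      fix M assume "M \<in> ?L"
      then obtain c where c: "c \<in> ?B" "\<forall>z. moves d e n c c z \<longrightarrow> z = 1" "M = content n c" by blast
      show "M \<in> ?R"
        unfolding c(3) mem_Collect_eq using iff[OF c(1)] c(2) mset_wt_content(1)[OF c(1)] by blast
    next
      fix M assume M: "M \<in> ?R"
      hence "size M = n" "mset_wt letter_weight M = (i, k)" "size (filter_mset (snd \<circ> snd) M) = r"
        by (auto simp: sector_def)
      then obtain c where c: "c \<in> ?B" "content n c = M" by (rule ex_content)
      have "\<forall>z. moves d e n c c z \<longrightarrow> z = 1" unfolding iff[OF c(1)] c(2) using M by blast
      thus "M \<in> ?L" using c by blast
    qed
  qed
  finally show ?thesis .
qed

lemma hilbert_series_eq_gf: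
  assumes "d \<ge> 1" "e \<ge> 1" "n \<ge> 1"
  shows "hilbert_series n (G_group d e n) r = gf (\<Union>s<e. sector (d * e) (s * d) n r) (mset_wt letter_weight)"
  unfolding hilbert_series_def gf_def dim_tensor_invariants[OF assms] ..

section \<open>The sectors\<close>

lemma finite_fibres_sector: "finite_fibres (sector N m n r) (mset_wt letter_weight)"
proof -
  have fin: "finite {l. fst (letter_weight l) \<le> b}" for b
    by (rule finite_subset[of _ "{..b} \<times> UNIV"]) auto
  have "finite {M \<in> sector N m n r. mset_wt letter_weight M = p}" for p
    by (rule finite_subset[OF _ finite_msets_bounded_sum[OF fin, of n "fst p"]])
       (auto simp: sector_def mset_wt_def)
  thus ?thesis by (simp add: finite_fibres_def)
qed

lemma sector_disjoint:
  assumes "n \<ge> 1" "m < N" "m' < N" "m \<noteq> m'"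
  shows "sector N m n r \<inter> sector N m' n r = {}"
proof (rule ccontr)
  assume "sector N m n r \<inter> sector N m' n r \<noteq> {}"
  then obtain M where M: "M \<in> sector N m n r" "M \<in> sector N m' n r" by blast
  hence "M \<noteq> {#}" using assms(1) by (auto simp: sector_def)
  then obtain l where "l \<in># M" by blast
  hence "int N dvd charge l - int m" "int N dvd charge l - int m'" using M by (auto simp: sector_def)
  hence "int N dvd int m - int m'" using dvd_diff[of "int N" "charge l - int m'" "charge l - int m"] by simp
  hence "int m mod int N = int m' mod int N" by (simp add: mod_eq_dvd_iff)
  thus False using assms by simp
qed

lemma residue_class_iff:
  assumes "m < N"
  shows "int N dvd int a - int m \<longleftrightarrow> (\<exists>j. a = N * j + m)"
proof
  assume "int N dvd int a - int m"
  hence "int a mod int N = int m mod int N" by (simp add: mod_eq_dvd_iff)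
  hence "a mod N = m" using assms by (simp flip: zmod_int)
  thus "\<exists>j. a = N * j + m" using mult_div_mod_eq[of N a] by metis
qed auto

text \<open>
  The letters with second bit $\delta$ and a given charge modulo $N$, as two ladders: $x$ and $y$ are
  the exponents of the lowest bosonic and the lowest fermionic letter.  A bosonic letter has first bit
  $\delta$, a fermionic one its negation.
\<close>

fun interleave :: "nat \<Rightarrow> bool \<Rightarrow> nat \<Rightarrow> nat \<Rightarrow> nat \<times> bool \<Rightarrow> letter" where
  "interleave N \<delta> x y (j, p) = (N * j + (if p then y else x), p \<noteq> \<delta>, \<delta>)"

lemma inj_interleave: "N \<ge> 1 \<Longrightarrow> inj (interleave N \<delta> x y)"
  by (auto simp: inj_def)

lemma count_image_mset_inj_apply: "inj f \<Longrightarrow> count (image_mset f M) (f x) = count M x"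
  by (induction M) (auto simp: inj_eq)

lemma ex_image_mset: "set_mset M \<subseteq> range f \<Longrightarrow> \<exists>M'. M = image_mset f M'"
proof (intro exI)
  assume "set_mset M \<subseteq> range f"
  hence "image_mset (f \<circ> Hilbert_Choice.inv f) M = image_mset id M"
    by (intro image_mset_cong) (auto simp: f_inv_into_f)
  thus "M = image_mset f (image_mset (Hilbert_Choice.inv f) M)"
    by (simp add: multiset.map_comp)
qed

lemma mset_wt_union: "mset_wt w (M + M') = (fst (mset_wt w M) + fst (mset_wt w M'), snd (mset_wt w M) + snd (mset_wt w M'))"
  by (simp add: mset_wt_def)

lemma mset_wt_image: "mset_wt w (image_mset f M) = mset_wt (w \<circ> f) M"
  by (simp add: mset_wt_def multiset.map_comp comp_def)

text \<open>
  Splitting a multiset by the second bit of its letters.  The numbers $m$, $m_1$, $m_2$ are the lowest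
  exponents at which charge $m$ modulo $N$ is attained, by a bosonic letter, by a fermionic letter with
  only the first bit set and by a fermionic letter with only the second bit set.
\<close>

lemma gf_sector:
  assumes N: "N \<ge> 1" and r: "r \<le> n" and m: "m < N" "m\<^sub>1 < N" "m\<^sub>2 < N"
    and m1: "int N dvd int m\<^sub>1 + 1 - int m" and m2: "int N dvd int m\<^sub>2 - 1 - int m"
  shows "gf (sector N m n r) (mset_wt letter_weight) =
    gf (fermi_bose (n - r)) (mset_wt (ladder_weight N (m, 0) (m\<^sub>1, 1)))
    * gf (fermi_bose r) (mset_wt (ladder_weight N (m, 1) (m\<^sub>2, 0)))"
proof -
  define f g where "f = interleave N False m m\<^sub>1" and "g = interleave N True m m\<^sub>2"
  have inj: "inj f" "inj g" using inj_interleave[OF N] by (simp_all add: f_def g_def)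
  have f_simp: "f (j, p) = (N * j + (if p then m\<^sub>1 else m), p, False)"
    and g_simp: "g (j, p) = (N * j + (if p then m\<^sub>2 else m), \<not> p, True)" for j p
    by (simp_all add: f_def g_def)
  define \<Phi> where "\<Phi> = (\<lambda>(A, B). image_mset f A + image_mset g B)"
  let ?P = "snd \<circ> snd :: letter \<Rightarrow> bool"
  have filter_f: "filter_mset ?P (image_mset f A) = {#}" "filter_mset (Not \<circ> ?P) (image_mset f A) = image_mset f A" for A
    by (induction A) (auto simp: f_def)
  have filter_g: "filter_mset ?P (image_mset g A) = image_mset g A" "filter_mset (Not \<circ> ?P) (image_mset g A) = {#}" for A
    by (induction A) (auto simp: g_def)
  have inj_\<Phi>: "inj_on \<Phi> (fermi_bose (n - r) \<times> fermi_bose r)"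
  proof (rule inj_onI, clarify)
    fix A B A' B' assume "\<Phi> (A, B) = \<Phi> (A', B')"
    hence eq: "image_mset f A + image_mset g B = image_mset f A' + image_mset g B'" by (simp add: \<Phi>_def)
    from arg_cong[OF this, of "filter_mset ?P"] have "image_mset g B = image_mset g B'"
      by (simp add: filter_f filter_g)
    moreover from this eq have "image_mset f A = image_mset f A'" by simp
    ultimately show "A = A' \<and> B = B'"
      using injD[OF multiset.inj_map[OF inj(1)]] injD[OF multiset.inj_map[OF inj(2)]] by blast
  qed
  have charge_f: "int N dvd charge (f z) - int m" for z
  proof -
    obtain j p where z: "z = (j, p)" by (cases z)
    have "charge (f z) - int m = int N * int j + (if p then int m\<^sub>1 + 1 - int m else 0)"
      by (simp add: z f_simp)
    thus ?thesis using m1 by simp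
  qed
  have charge_g: "int N dvd charge (g z) - int m" for z
  proof -
    obtain j p where z: "z = (j, p)" by (cases z)
    have "charge (g z) - int m = int N * int j + (if p then int m\<^sub>2 - 1 - int m else 0)"
      by (simp add: z g_simp)
    thus ?thesis using m2 by simp
  qed
  have range_f: "l \<in> range f" if l: "int N dvd charge l - int m" "\<not> ?P l" for l
  proof -
    obtain a \<epsilon> where [simp]: "l = (a, \<epsilon>, False)" using l(2) by (cases l) auto
    have "int N dvd int a - int (if \<epsilon> then m\<^sub>1 else m)"
      using l(1) dvd_diff[OF l(1) m1] by (auto simp: algebra_simps)
    then obtain j where "a = N * j + (if \<epsilon> then m\<^sub>1 else m)"
      using residue_class_iff[of "if \<epsilon> then m\<^sub>1 else m" N a] m by auto
    hence "l = f (j, \<epsilon>)" by (simp add: f_simp)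
    thus ?thesis by blast
  qed
  have range_g: "l \<in> range g" if l: "int N dvd charge l - int m" "?P l" for l
  proof -
    obtain a \<epsilon> where [simp]: "l = (a, \<epsilon>, True)" using l(2) by (cases l) auto
    have "int N dvd int a - int (if \<epsilon> then m else m\<^sub>2)"
      using l(1) dvd_diff[OF l(1) m2] by (auto simp: algebra_simps)
    then obtain j where "a = N * j + (if \<epsilon> then m else m\<^sub>2)"
      using residue_class_iff[of "if \<epsilon> then m else m\<^sub>2" N a] m by (auto split: if_splits)
    hence "l = g (j, \<not> \<epsilon>)" by (simp add: g_simp)
    thus ?thesis by blast
  qed
  have count_\<Phi>_f: "count (\<Phi> (A, B)) (f z) = count A z" for A B z
  proof -
    have "f z \<notin># image_mset g B" by (cases z) (auto simp: f_simp g_def)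
    hence "count (image_mset g B) (f z) = 0" by (simp only: not_in_iff)
    thus ?thesis by (simp add: \<Phi>_def count_image_mset_inj_apply[OF inj(1)])
  qed
  have count_\<Phi>_g: "count (\<Phi> (A, B)) (g z) = count B z" for A B z
  proof -
    have "g z \<notin># image_mset f A" by (cases z) (auto simp: g_simp f_def)
    hence "count (image_mset f A) (g z) = 0" by (simp only: not_in_iff)
    thus ?thesis by (simp add: \<Phi>_def count_image_mset_inj_apply[OF inj(2)])
  qed
  have image_\<Phi>: "\<Phi> ` (fermi_bose (n - r) \<times> fermi_bose r) = sector N m n r"
  proof (intro equalityI subsetI)
    fix M assume "M \<in> \<Phi> ` (fermi_bose (n - r) \<times> fermi_bose r)"
    then obtain A B where AB: "M = \<Phi> (A, B)" "A \<in> fermi_bose (n - r)" "B \<in> fermi_bose r" by auto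
    have "size M = n" using AB r by (simp add: \<Phi>_def fermi_bose_def)
    moreover have "size (filter_mset ?P M) = r"
      using AB by (simp add: \<Phi>_def filter_f filter_g fermi_bose_def)
    moreover have "\<forall>l\<in>#M. int N dvd charge l - int m"
      using charge_f charge_g by (auto simp: AB \<Phi>_def)
    moreover have "count M l \<le> 1" if l: "fermionic l" for l
    proof (cases "l \<in># M")
      case True
      then consider z where "l = f z" | z where "l = g z" by (auto simp: AB \<Phi>_def)
      thus ?thesis
      proof cases
        case (1 z)
        obtain j p where z: "z = (j, p)" by (cases z)
        hence "p" using l 1 by (simp add: f_simp)
        thus ?thesis using AB 1 z by (simp add: count_\<Phi>_f fermi_bose_def)
      next
        case (2 z)
        obtain j p where z: "z = (j, p)" by (cases z)
        hence "p" using l 2 by (simp add: g_simp)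
        thus ?thesis using AB 2 z by (simp add: count_\<Phi>_g fermi_bose_def)
      qed
    qed (simp add: not_in_iff)
    ultimately show "M \<in> sector N m n r" by (simp add: sector_def)
  next
    fix M assume M: "M \<in> sector N m n r"
    have dvd: "int N dvd charge l - int m" if "l \<in># M" for l
      using M that unfolding sector_def by blast
    have "set_mset (filter_mset (Not \<circ> ?P) M) \<subseteq> range f"
    proof
      fix l assume "l \<in># filter_mset (Not \<circ> ?P) M"
      hence "l \<in># M" "\<not> ?P l" by (simp_all add: comp_def)
      thus "l \<in> range f" using range_f dvd by blast
    qed
    moreover have "set_mset (filter_mset ?P M) \<subseteq> range g"
    proof
      fix l assume "l \<in># filter_mset ?P M"
      hence "l \<in># M" "?P l" by simp_all
      thus "l \<in> range g" using range_g dvd by blast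
    qed
    ultimately obtain A B where A: "filter_mset (Not \<circ> ?P) M = image_mset f A" and B: "filter_mset ?P M = image_mset g B"
      using ex_image_mset by metis
    have MAB: "M = \<Phi> (A, B)"
    proof -
      have "M = filter_mset ?P M + filter_mset (\<lambda>l. \<not> ?P l) M" by (rule multiset_partition)
      also have "filter_mset ?P M = image_mset g B" by (rule B)
      also have "filter_mset (\<lambda>l. \<not> ?P l) M = image_mset f A" using A by (simp add: comp_def)
      finally show ?thesis by (simp add: \<Phi>_def add.commute)
    qed
    have "size B = r" using M B by (auto simp: sector_def)
    moreover have "size A + size B = n" using M MAB by (auto simp: sector_def \<Phi>_def)
    moreover have le: "count M l \<le> 1" if "fermionic l" for l
      using M that unfolding sector_def by blast
    have "count A (j, True) \<le> 1" "count B (j, True) \<le> 1" for j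
      using le[of "f (j, True)"] le[of "g (j, True)"]
        count_\<Phi>_f[of A B "(j, True)"] count_\<Phi>_g[of A B "(j, True)"]
      unfolding MAB[symmetric] by (simp_all add: f_simp g_simp)
    ultimately have "A \<in> fermi_bose (n - r)" "B \<in> fermi_bose r" by (auto simp: fermi_bose_def)
    thus "M \<in> \<Phi> ` (fermi_bose (n - r) \<times> fermi_bose r)" using MAB by blast
  qed
  have "gf (sector N m n r) (mset_wt letter_weight) =
      gf (fermi_bose (n - r) \<times> fermi_bose r) (mset_wt letter_weight \<circ> \<Phi>)"
    unfolding image_\<Phi>[symmetric] by (rule gf_image[OF inj_\<Phi>])
  also have "\<dots> = gf (fermi_bose (n - r) \<times> fermi_bose r)
      (\<lambda>(A, B). (fst (mset_wt (ladder_weight N (m, 0) (m\<^sub>1, 1)) A) + fst (mset_wt (ladder_weight N (m, 1) (m\<^sub>2, 0)) B),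
                 snd (mset_wt (ladder_weight N (m, 0) (m\<^sub>1, 1)) A) + snd (mset_wt (ladder_weight N (m, 1) (m\<^sub>2, 0)) B)))"
  proof (rule gf_cong)
    have "letter_weight \<circ> f = ladder_weight N (m, 0) (m\<^sub>1, 1)" "letter_weight \<circ> g = ladder_weight N (m, 1) (m\<^sub>2, 0)"
      by (auto simp: fun_eq_iff f_simp g_simp)
    thus "(mset_wt letter_weight \<circ> \<Phi>) z = (\<lambda>(A, B).
      (fst (mset_wt (ladder_weight N (m, 0) (m\<^sub>1, 1)) A) + fst (mset_wt (ladder_weight N (m, 1) (m\<^sub>2, 0)) B),
       snd (mset_wt (ladder_weight N (m, 0) (m\<^sub>1, 1)) A) + snd (mset_wt (ladder_weight N (m, 1) (m\<^sub>2, 0)) B))) z" for z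
      by (cases z) (simp add: \<Phi>_def mset_wt_union mset_wt_image)
  qed simp
  also have "\<dots> = gf (fermi_bose (n - r)) (mset_wt (ladder_weight N (m, 0) (m\<^sub>1, 1)))
    * gf (fermi_bose r) (mset_wt (ladder_weight N (m, 1) (m\<^sub>2, 0)))"
    by (rule gf_times) (rule finite_fibres_fermi_bose[OF N])+
  finally show ?thesis .
qed


section \<open>Summing over the sectors\<close>

text \<open>
  The homogeneous form of the $q$-Pochhammer symbol, with $x$ and $y$ the weights of the lowest
  letters of the two ladders.
\<close>

definition hpoch :: "'a :: comm_ring_1 \<Rightarrow> 'a \<Rightarrow> 'a \<Rightarrow> nat \<Rightarrow> 'a" where
  "hpoch x y Q k = (\<Prod>j<k. x + y * Q ^ j)"

lemma hpoch_scale: "hpoch (c * x) (c * y) Q k = c ^ k * hpoch x y Q k"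
  by (induction k) (simp_all add: hpoch_def algebra_simps)

lemma hpoch_0 [simp]: "hpoch x y Q 0 = 1"
  by (simp add: hpoch_def)

lemma hpoch_Suc: "hpoch x y Q (Suc k) = hpoch x y Q k * (x + y * Q ^ k)"
  by (simp add: hpoch_def)

lemma hpoch_Suc': "hpoch x y Q (Suc k) = (x + y) * hpoch x (y * Q) Q k"
  unfolding hpoch_def by (subst prod.lessThan_Suc_shift) (simp add: mult.assoc)

lemma q_pochhammer_eq_hpoch: "q_pochhammer (- z) Q k = hpoch 1 z Q k"
  by (simp add: q_pochhammer_def hpoch_def)

lemma gf_fermi_bose_eq_hpoch:
  assumes "N \<ge> 1"
  shows "gf (fermi_bose k) (mset_wt (ladder_weight N x y)) =
    hpoch (qq ^ fst x * tt ^ snd x) (qq ^ fst y * tt ^ snd y) (qq ^ N) k / q_pochhammer (qq ^ N) (qq ^ N) k"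
proof -
  have pow: "qq ^ (N * j) = (qq ^ N) ^ j" "qq ^ (N * Suc j) = qq ^ N * (qq ^ N) ^ j" for j
    by (simp_all add: power_mult power_add)
  show ?thesis
    unfolding gf_fermi_bose[OF assms] hpoch_def q_pochhammer_def pow power_Suc ..
qed

context
  fixes q t :: "rat fls fls" and N n r :: nat
  assumes q: "q = fls_X" and t: "t = fls_const fls_X" and N: "N \<ge> 2" and r: "r \<le> n"
begin

abbreviation (input) "denom \<equiv> q_pochhammer (q ^ N) (q ^ N) (n - r) * q_pochhammer (q ^ N) (q ^ N) r"

text \<open>
  In this sector a lone first bit has charge $0$ modulo $N$ only with an exponent that is at least
  $N - 1$, so the pair of lowest weights is $(1, t q^{N-1})$.
\<close>

lemma gf_sector_0:
  "gf (sector N 0 n r) (mset_wt letter_weight) =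
     hpoch 1 (t * q ^ (N - 1)) (q ^ N) (n - r) * hpoch t q (q ^ N) r / denom"
proof -
  have "gf (sector N 0 n r) (mset_wt letter_weight) =
    gf (fermi_bose (n - r)) (mset_wt (ladder_weight N (0, 0) (N - 1, 1)))
    * gf (fermi_bose r) (mset_wt (ladder_weight N (0, 1) (1, 0)))"
    using N r by (intro gf_sector) (auto simp: of_nat_diff)
  thus ?thesis using N by (simp add: gf_fermi_bose_eq_hpoch q t mult.commute)
qed

text \<open>
  Here the lowest exponents are $m$, $m - 1$ and $m + 1$, so that the dependence on $m$ is a power of
  $q$ that depends on $n$ only.
\<close>

lemma gf_sector_generic:
  assumes "1 \<le> m" "m + 1 < N"
  shows "gf (sector N m n r) (mset_wt letter_weight) =
     q ^ (m * n) * hpoch 1 (t / q) (q ^ N) (n - r) * hpoch t q (q ^ N) r / denom"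
proof -
  have q0: "q \<noteq> 0" by (simp add: q)
  have "gf (sector N m n r) (mset_wt letter_weight) =
    gf (fermi_bose (n - r)) (mset_wt (ladder_weight N (m, 0) (m - 1, 1)))
    * gf (fermi_bose r) (mset_wt (ladder_weight N (m, 1) (m + 1, 0)))"
    using N r assms by (intro gf_sector) (auto simp: of_nat_diff)
  also have "\<dots> = hpoch (q ^ m * 1) (q ^ m * (t / q)) (q ^ N) (n - r)
      * hpoch (q ^ m * t) (q ^ m * q) (q ^ N) r / denom"
  proof -
    have "q ^ (m - 1) * t = q ^ m * (t / q)" using q0 assms by (simp add: power_diff)
    thus ?thesis using N by (simp add: gf_fermi_bose_eq_hpoch flip: q t) (simp add: mult.commute)
  qed
  also have "\<dots> = q ^ (m * (n - r) + m * r) * hpoch 1 (t / q) (q ^ N) (n - r) * hpoch t q (q ^ N) r / denom"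
    unfolding hpoch_scale by (simp add: power_add power_mult)
  also have "m * (n - r) + m * r = m * n" using r by (simp flip: distrib_left)
  finally show ?thesis .
qed

text \<open>
  A lone second bit lowers the charge by one, so it has charge $N - 1$ modulo $N$ already with
  exponent $0$.  This sector occurs only for $d = 1$.
\<close>

lemma gf_sector_top:
  "gf (sector N (N - 1) n r) (mset_wt letter_weight) =
     q ^ ((N - 1) * (n - r)) * hpoch 1 (t / q) (q ^ N) (n - r)
       * hpoch (t * q ^ (N - 1)) 1 (q ^ N) r / denom"
proof -
  have q0: "q \<noteq> 0" by (simp add: q)
  have "gf (sector N (N - 1) n r) (mset_wt letter_weight) =
    gf (fermi_bose (n - r)) (mset_wt (ladder_weight N (N - 1, 0) (N - 2, 1)))
    * gf (fermi_bose r) (mset_wt (ladder_weight N (N - 1, 1) (0, 0)))"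
    using N r by (intro gf_sector) (auto simp: of_nat_diff)
  also have "\<dots> = hpoch (q ^ (N - 1) * 1) (q ^ (N - 1) * (t / q)) (q ^ N) (n - r)
      * hpoch (t * q ^ (N - 1)) 1 (q ^ N) r / denom"
  proof -
    have "Suc (N - 2) = N - 1" using N by simp
    hence "q ^ (N - 1) = q ^ (N - 2) * q" using power_Suc2[of q "N - 2"] by simp
    hence "q ^ (N - 2) * t = q ^ (N - 1) * (t / q)" using q0 by simp
    thus ?thesis using N by (simp add: gf_fermi_bose_eq_hpoch flip: q t) (simp add: mult.commute)
  qed
  also have "\<dots> = q ^ ((N - 1) * (n - r)) * hpoch 1 (t / q) (q ^ N) (n - r)
       * hpoch (t * q ^ (N - 1)) 1 (q ^ N) r / denom"
    unfolding hpoch_scale by (simp add: power_mult)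
  finally show ?thesis .
qed

end

lemma hilbert_series_sum_sectors:
  assumes "d \<ge> 1" "e \<ge> 1" "n \<ge> 1"
  shows "hilbert_series n (G_group d e n) r = (\<Sum>s<e. gf (sector (d * e) (s * d) n r) (mset_wt letter_weight))"
  unfolding hilbert_series_eq_gf[OF assms]
proof (rule gf_UN)
  fix s s' assume "s \<in> {..<e}" "s' \<in> {..<e}" "s \<noteq> s'"
  thus "sector (d * e) (s * d) n r \<inter> sector (d * e) (s' * d) n r = {}"
    using assms by (intro sector_disjoint) (auto simp: mult.commute)
qed (auto intro: finite_fibres_sector)

text \<open>
  For $d \ge 2$ the residue $sd$ with $s < e$ never equals $de - 1$, so all sectors except $s = 0$ are
  generic.
\<close>

lemma hilbert_series_d_ge_2:
  fixes q t :: "rat fls fls"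
  assumes "q = fls_X" "t = fls_const fls_X" and d: "d \<ge> 2" and e: "e \<ge> 1" and n: "n \<ge> 1" and r: "r \<le> n"
  defines "Q \<equiv> q ^ (d * e)"
  shows "hilbert_series n (G_group d e n) r =
    (hpoch 1 (t * q ^ (d * e - 1)) Q (n - r) * hpoch t q Q r
     + (\<Sum>s=1..<e. (q ^ (d * n)) ^ s) * hpoch 1 (t / q) Q (n - r) * hpoch t q Q r)
    / (q_pochhammer Q Q (n - r) * q_pochhammer Q Q r)"
proof -
  have N: "d * e \<ge> 2" using mult_le_mono[OF d e] by simp
  have generic: "gf (sector (d * e) (s * d) n r) (mset_wt letter_weight) =
      (q ^ (d * n)) ^ s * hpoch 1 (t / q) Q (n - r) * hpoch t q Q r / (q_pochhammer Q Q (n - r) * q_pochhammer Q Q r)"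
    if s: "s \<in> {1..<e}" for s
  proof -
    have "s * d + d \<le> d * e" using s mult_le_mono2[of "Suc s" e d] by (simp add: algebra_simps)
    moreover have "1 \<le> s * d" using s d by simp
    ultimately show ?thesis
      using gf_sector_generic[OF assms(1,2) N r, of "s * d"] d
      by (simp add: Q_def power_mult[symmetric] mult_ac)
  qed
  have "hilbert_series n (G_group d e n) r =
      gf (sector (d * e) 0 n r) (mset_wt letter_weight)
      + (\<Sum>s=1..<e. gf (sector (d * e) (s * d) n r) (mset_wt letter_weight))"
    using d e n by (simp add: hilbert_series_sum_sectors sum.atLeast_Suc_lessThan flip: atLeast0LessThan)
  also have "(\<Sum>s=1..<e. gf (sector (d * e) (s * d) n r) (mset_wt letter_weight)) =
      (\<Sum>s=1..<e. (q ^ (d * n)) ^ s) * hpoch 1 (t / q) Q (n - r) * hpoch t q Q r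
        / (q_pochhammer Q Q (n - r) * q_pochhammer Q Q r)"
    unfolding sum_distrib_right sum_divide_distrib by (intro sum.cong generic) auto
  finally show ?thesis
    unfolding gf_sector_0[OF assms(1,2) N r] Q_def by (simp only: add_divide_distrib)
qed

text \<open>
  For $d = 1$ the sectors are all residues modulo $e$, including the last one.
\<close>

lemma hilbert_series_d_eq_1:
  fixes q t :: "rat fls fls"
  assumes "q = fls_X" "t = fls_const fls_X" and e: "e \<ge> 2" and n: "n \<ge> 1" and r: "r \<le> n"
  defines "Q \<equiv> q ^ e"
  shows "hilbert_series n (G_group 1 e n) r =
    (hpoch 1 (t * q ^ (e - 1)) Q (n - r) * hpoch t q Q r
     + (\<Sum>s=1..<e - 1. (q ^ n) ^ s) * hpoch 1 (t / q) Q (n - r) * hpoch t q Q r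
     + q ^ ((e - 1) * (n - r)) * hpoch 1 (t / q) Q (n - r) * hpoch (t * q ^ (e - 1)) 1 Q r)
    / (q_pochhammer Q Q (n - r) * q_pochhammer Q Q r)"
proof -
  have generic: "gf (sector e s n r) (mset_wt letter_weight) =
      (q ^ n) ^ s * hpoch 1 (t / q) Q (n - r) * hpoch t q Q r / (q_pochhammer Q Q (n - r) * q_pochhammer Q Q r)"
    if s: "s \<in> {1..<e - 1}" for s
    using gf_sector_generic[OF assms(1,2) e r, of s] s less_diff_conv[of s e 1]
    by (simp add: Q_def power_mult[symmetric] mult_ac)
  define e' where "e' = e - 2"
  have e': "e = Suc (Suc e')" using e by (simp add: e'_def)
  have "hilbert_series n (G_group 1 e n) r = (\<Sum>s<e. gf (sector e s n r) (mset_wt letter_weight))"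
    using e n by (simp add: hilbert_series_sum_sectors)
  also have "\<dots> = gf (sector e 0 n r) (mset_wt letter_weight)
      + (\<Sum>s=1..<e - 1. gf (sector e s n r) (mset_wt letter_weight))
      + gf (sector e (e - 1) n r) (mset_wt letter_weight)"
    unfolding e' by (simp add: sum.atLeast_Suc_lessThan flip: atLeast0LessThan)
  also have "(\<Sum>s=1..<e - 1. gf (sector e s n r) (mset_wt letter_weight)) =
      (\<Sum>s=1..<e - 1. (q ^ n) ^ s) * hpoch 1 (t / q) Q (n - r) * hpoch t q Q r
        / (q_pochhammer Q Q (n - r) * q_pochhammer Q Q r)"
    unfolding sum_distrib_right sum_divide_distrib by (intro sum.cong generic) auto
  finally show ?thesis
    unfolding gf_sector_0[OF assms(1,2) e r] gf_sector_top[OF assms(1,2) e r] Q_def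
    by (simp only: add_divide_distrib)
qed

section \<open>Closed forms\<close>

lemma geometric_sum_from_1:
  fixes x :: "'a :: comm_ring_1"
  shows "(1 - x) * (\<Sum>s=1..<Suc m. x ^ s) = x - x ^ Suc m"
proof (induction m)
  case (Suc m)
  have "(\<Sum>s=1..<Suc (Suc m). x ^ s) = (\<Sum>s=1..<Suc m. x ^ s) + x ^ Suc m" by simp
  hence "(1 - x) * (\<Sum>s=1..<Suc (Suc m). x ^ s) = (x - x ^ Suc m) + (1 - x) * x ^ Suc m"
    by (simp only: distrib_left Suc.IH)
  also have "\<dots> = x - x ^ Suc (Suc m)" by (simp add: algebra_simps)
  finally show ?case .
qed simp

context
  fixes q t :: "'a :: field" and N :: nat
  assumes q0: "q \<noteq> 0" and N: "N \<ge> 1"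
begin

text \<open>
  Extracting the second summand from each factor leaves a $q$-Pochhammer symbol in $q^{-N}$.
\<close>

lemma hpoch_t_q_eq:
  "hpoch t q (q ^ N) r =
     q ^ (N * (r choose 2) + r) * q_pochhammer (- t * q powi (- 1)) (q powi (- int N)) r"
proof (induction r)
  case (Suc r)
  have choose: "Suc r choose 2 = (r choose 2) + r"
    by (simp add: numeral_2_eq_2)
  have "t + q * (q ^ N) ^ r = q ^ (N * r + 1) * (1 - (- t * q powi (- 1)) * (q powi (- int N)) ^ r)"
    using q0 by (simp add: power_int_minus power_add power_mult field_simps)
  thus ?case
    by (simp add: hpoch_Suc Suc.IH q_pochhammer_def choose power_add algebra_simps)
qed (simp add: q_pochhammer_def numeral_2_eq_2)

text \<open>
  This and the next lemma let the sectors with lowest weights $(1, t/q)$ and $(1, t q^{N-1})$ share all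
  but one factor: the latter product is the former one, started one rung higher.
\<close>

lemma hpoch_t_over_q_Suc:
  "hpoch 1 (t / q) (q ^ N) (Suc k) = (1 + t / q) * hpoch 1 (t * q ^ (N - 1)) (q ^ N) k"
proof -
  have "t / q * q ^ N = t * q ^ (N - 1)" using q0 N by (simp add: power_diff)
  thus ?thesis by (simp add: hpoch_Suc')
qed

lemma hpoch_t_q_pred_Suc:
  "hpoch 1 (t * q ^ (N - 1)) (q ^ N) (Suc k) =
     hpoch 1 (t * q ^ (N - 1)) (q ^ N) k * (1 + t / q * q ^ (N * Suc k))"
proof -
  have "t * q ^ (N - 1) * (q ^ N) ^ k = t / q * q ^ (N * Suc k)"
    using q0 N by (simp add: power_diff power_mult[symmetric] power_add)
  thus ?thesis by (simp add: hpoch_Suc)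
qed

text \<open>
  From the second factor on, $t q^{N-1} + Q^{j+1} = q^{N-1} (t + q Q^j)$ with $Q = q^N$.
\<close>

lemma hpoch_top_Suc:
  "hpoch (t * q ^ (N - 1)) 1 (q ^ N) (Suc k) =
     (1 + t * q ^ (N - 1)) * q ^ ((N - 1) * k) * hpoch t q (q ^ N) k"
proof -
  have qN: "q ^ (N - 1) * q = q ^ N" using power_Suc2[of q "N - 1"] N by simp
  have "hpoch (t * q ^ (N - 1)) (q ^ N) (q ^ N) k = q ^ ((N - 1) * k) * hpoch t q (q ^ N) k"
    using hpoch_scale[of "q ^ (N - 1)" t q "q ^ N" k]
    unfolding qN power_mult by (simp only: mult.commute)
  thus ?thesis by (simp add: hpoch_Suc' add.commute)
qed

end


context
  fixes q t :: "'a :: field" and N :: nat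
  assumes q0: "q \<noteq> 0" and N: "N \<ge> 2" and nonroot: "\<And>m. m \<ge> 1 \<Longrightarrow> 1 - q ^ m \<noteq> 0"
begin

lemma N_ge_1: "N \<ge> 1" using N by simp

lemma denom_Suc:
  "q_pochhammer (q ^ N) (q ^ N) (Suc k) = q_pochhammer (q ^ N) (q ^ N) k * (1 - q ^ (N * Suc k))"
  by (simp add: q_pochhammer_def power_add power_mult)

lemma denom_nonzero: "q_pochhammer (q ^ N) (q ^ N) k \<noteq> 0"
proof (induction k)
  case (Suc k)
  thus ?case using nonroot[of "N * Suc k"] N unfolding denom_Suc by simp
qed (simp add: q_pochhammer_def)

lemma q_pochhammer_t_q_pred: "q_pochhammer (- t * q ^ (N - 1)) (q ^ N) k = hpoch 1 (t * q ^ (N - 1)) (q ^ N) k"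
  using q_pochhammer_eq_hpoch[of "t * q ^ (N - 1)" "q ^ N" k] by simp

text \<open>
  The variable $G$ stands for the geometric sum over the sectors with $s \ge 1$; for $r = 0$ all of them
  are generic.
\<close>

lemma closed_form_r_0:
  assumes n: "n \<ge> 1" and G: "(1 - x) * G = x - q ^ (N * n)" and x: "x = q ^ m" "m \<ge> 1"
  shows "(hpoch 1 (t * q ^ (N - 1)) (q ^ N) n + G * hpoch 1 (t / q) (q ^ N) n) / q_pochhammer (q ^ N) (q ^ N) n =
    q_pochhammer (- t * q ^ (N - 1)) (q ^ N) (n - 1) * (1 + t * q ^ (m - 1))
      / (q_pochhammer (q ^ N) (q ^ N) (n - 1) * (1 - q ^ m))"
proof -
  obtain \<nu> where \<nu>: "n = Suc \<nu>" using n by (cases n) auto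
  define a D y u where "a = hpoch 1 (t * q ^ (N - 1)) (q ^ N) \<nu>" and "D = q_pochhammer (q ^ N) (q ^ N) \<nu>"
    and "y = q ^ (N * n)" and "u = t / q"
  have x1: "1 - x \<noteq> 0" unfolding x(1) by (rule nonroot[OF x(2)])
  have y1: "1 - y \<noteq> 0" unfolding y_def using N n by (intro nonroot) simp
  have D: "D \<noteq> 0" unfolding D_def by (rule denom_nonzero)
  have tq: "t * q ^ (m - 1) = u * x" using q0 x by (simp add: u_def power_diff)
  have key: "(1 - x) * ((1 + u * y) + G * (1 + u)) = (1 - y) * (1 + u * x)"
  proof -
    have "(1 - x) * ((1 + u * y) + G * (1 + u)) = (1 - x) * (1 + u * y) + ((1 - x) * G) * (1 + u)"
      by (simp add: algebra_simps)
    also have "\<dots> = (1 - y) * (1 + u * x)" unfolding G y_def[symmetric] by (simp add: algebra_simps)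
    finally show ?thesis .
  qed
  hence "(1 + u * y) + G * (1 + u) = (1 - y) * (1 + u * x) / (1 - x)"
    using x1 by (simp add: eq_divide_eq mult.commute)
  moreover have "hpoch 1 (t * q ^ (N - 1)) (q ^ N) n + G * hpoch 1 (t / q) (q ^ N) n
      = a * ((1 + u * y) + G * (1 + u))"
    unfolding \<nu> hpoch_t_q_pred_Suc[OF q0 N_ge_1] hpoch_t_over_q_Suc[OF q0 N_ge_1]
    by (simp add: a_def u_def y_def \<nu> algebra_simps)
  moreover have "q_pochhammer (q ^ N) (q ^ N) n = D * (1 - y)"
    unfolding \<nu> denom_Suc by (simp add: D_def y_def \<nu>)
  ultimately have "(hpoch 1 (t * q ^ (N - 1)) (q ^ N) n + G * hpoch 1 (t / q) (q ^ N) n)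
      / q_pochhammer (q ^ N) (q ^ N) n = a * ((1 - y) * (1 + u * x) / (1 - x)) / (D * (1 - y))" by simp
  also have "\<dots> = a * (1 + u * x) / (D * (1 - x))" using x1 y1 D by simp
  finally show ?thesis unfolding q_pochhammer_t_q_pred tq by (simp add: a_def D_def x \<nu>)
qed

lemma closed_form_middle_d_ge_2:
  assumes r: "r < n" and G: "(1 - x) * G = x - y" and x: "x = q ^ m" "m \<ge> 1"
  shows "(hpoch 1 (t * q ^ (N - 1)) (q ^ N) (n - r) * hpoch t q (q ^ N) r
       + G * hpoch 1 (t / q) (q ^ N) (n - r) * hpoch t q (q ^ N) r)
      / (q_pochhammer (q ^ N) (q ^ N) (n - r) * q_pochhammer (q ^ N) (q ^ N) r) =
    q ^ (N * (r choose 2) + r)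
      * (q_pochhammer (- t * q powi (- 1)) (q powi (- int N)) r
         * q_pochhammer (- t * q ^ (N - 1)) (q ^ N) (n - 1 - r)
         / (q_pochhammer (q ^ N) (q ^ N) r * q_pochhammer (q ^ N) (q ^ N) (n - r) * (1 - x)))
      * (1 - y + t * q powi (- 1) * (q ^ (N * (n - r)) * (1 - x) + x - y))"
proof -
  obtain k where k: "n - r = Suc k" "n - 1 - r = k" using r by (cases "n - r") auto
  define a b D w u where "a = hpoch 1 (t * q ^ (N - 1)) (q ^ N) k" and "b = hpoch t q (q ^ N) r"
    and "D = q_pochhammer (q ^ N) (q ^ N) r * q_pochhammer (q ^ N) (q ^ N) (n - r)"
    and "w = q ^ (N * (n - r))" and "u = t / q"
  have x1: "1 - x \<noteq> 0" unfolding x(1) by (rule nonroot[OF x(2)])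
  have u: "t * q powi (- 1) = u" by (simp add: u_def power_int_minus divide_inverse)
  have "(1 - x) * ((1 + u * w) + G * (1 + u)) = (1 - x) * (1 + u * w) + ((1 - x) * G) * (1 + u)"
    by (simp add: algebra_simps)
  also have "\<dots> = 1 - y + u * (w * (1 - x) + x - y)" unfolding G by (simp add: algebra_simps)
  finally have key: "(1 + u * w) + G * (1 + u) = (1 - y + u * (w * (1 - x) + x - y)) / (1 - x)"
    using x1 by (simp add: eq_divide_eq mult.commute)
  have "hpoch 1 (t * q ^ (N - 1)) (q ^ N) (n - r) * b + G * hpoch 1 (t / q) (q ^ N) (n - r) * b =
      a * b * ((1 + u * w) + G * (1 + u))"
    unfolding k hpoch_t_q_pred_Suc[OF q0 N_ge_1] hpoch_t_over_q_Suc[OF q0 N_ge_1]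
    by (simp add: a_def u_def w_def k algebra_simps)
  hence "(hpoch 1 (t * q ^ (N - 1)) (q ^ N) (n - r) * b + G * hpoch 1 (t / q) (q ^ N) (n - r) * b) / D =
      b * (a / (D * (1 - x))) * (1 - y + u * (w * (1 - x) + x - y))"
    unfolding key by (simp add: mult_ac)
  thus ?thesis
    unfolding u q_pochhammer_t_q_pred k(2) b_def D_def w_def a_def hpoch_t_q_eq[OF q0 N_ge_1]
    by (simp add: mult_ac)
qed

text \<open>
  The three summands in the last factor come from the sector $s = 0$, the sector $s = e - 1$ and the
  geometric sum over the sectors in between.
\<close>

lemma closed_form_middle_d_eq_1:
  assumes r: "1 \<le> r" "r < n" and G: "(1 - q ^ n) * G = q ^ n - y"
  shows "(hpoch 1 (t * q ^ (N - 1)) (q ^ N) (n - r) * hpoch t q (q ^ N) r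
       + G * hpoch 1 (t / q) (q ^ N) (n - r) * hpoch t q (q ^ N) r
       + q ^ ((N - 1) * (n - r)) * hpoch 1 (t / q) (q ^ N) (n - r) * hpoch (t * q ^ (N - 1)) 1 (q ^ N) r)
      / (q_pochhammer (q ^ N) (q ^ N) (n - r) * q_pochhammer (q ^ N) (q ^ N) r) =
    q ^ (N * (r choose 2))
      * (q_pochhammer (- t * q powi (- 1)) (q powi (- int N)) (r - 1)
         * q_pochhammer (- t * q ^ (N - 1)) (q ^ N) (n - 1 - r)
         / (q_pochhammer (q ^ N) (q ^ N) r * q_pochhammer (q ^ N) (q ^ N) (n - r) * (1 - q ^ n)))
      * (q ^ r * (1 + t * q ^ ((n - r) * N - 1)) * (1 + t * q powi (- (int r - 1) * int N - 1)) * (1 - q ^ n)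
         + q ^ ((n - r) * (N - 1) - 1) * (1 + t * q ^ (N - 1)) * (1 - q ^ n) * (q + t)
         + q ^ (r - 1) * (1 + t * q powi (- (int r - 1) * int N - 1)) * (q + t) * (q ^ n - y))"
proof -
  obtain k where k: "n - r = Suc k" "n - 1 - r = k" using r by (cases "n - r") auto
  obtain \<rho> where \<rho>: "r = Suc \<rho>" using r by (cases r) auto
  define a where "a = hpoch 1 (t * q ^ (N - 1)) (q ^ N) k"
  define P where "P = q_pochhammer (- t * q powi (- 1)) (q powi (- int N)) \<rho>"
  define D where "D = q_pochhammer (q ^ N) (q ^ N) r * q_pochhammer (q ^ N) (q ^ N) (n - r)"
  define c where "c = q ^ (N * (r choose 2))"
  define w where "w = 1 + t * q powi (- (int r - 1) * int N - 1)"
  define x where "x = q ^ n"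
  have x1: "1 - x \<noteq> 0" unfolding x_def using r by (intro nonroot) simp
  have choose: "r choose 2 = (\<rho> choose 2) + \<rho>" by (simp add: \<rho> numeral_2_eq_2)
  have scale: "q ^ i * (q + t) = q ^ Suc i * (1 + t / q)" for i
    using q0 by (simp add: field_simps)
  have T1: "hpoch 1 (t * q ^ (N - 1)) (q ^ N) (n - r) = a * (1 + t * q ^ ((n - r) * N - 1))"
  proof -
    have "t * q ^ ((n - r) * N - 1) = t / q * q ^ (N * Suc k)"
      using q0 N by (simp add: k power_diff mult.commute)
    thus ?thesis unfolding k hpoch_t_q_pred_Suc[OF q0 N_ge_1] by (simp add: a_def)
  qed
  have T2: "hpoch t q (q ^ N) r = c * (P * (q ^ r * w))"
  proof -
    have "1 - (- t * q powi (- 1)) * (q powi (- int N)) ^ \<rho> = w"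
    proof -
      have "q powi (- (int r - 1) * int N - 1) = q powi (- 1) * (q powi (- int N)) ^ \<rho>"
      proof -
        have pow: "(q powi (- int N)) ^ \<rho> = q powi (- int N * int \<rho>)"
          by (simp only: power_int_mult power_int_of_nat)
        have exponent: "- (int r - 1) * int N - 1 = - 1 + - int N * int \<rho>"
          by (simp add: \<rho> algebra_simps)
        show ?thesis unfolding exponent pow by (rule power_int_add[OF disjI1[OF q0]])
      qed
      thus ?thesis by (simp add: w_def)
    qed
    moreover have "q_pochhammer (- t * q powi (- 1)) (q powi (- int N)) r =
        P * (1 - (- t * q powi (- 1)) * (q powi (- int N)) ^ \<rho>)"
      by (simp add: q_pochhammer_def P_def \<rho>)
    ultimately show ?thesis unfolding hpoch_t_q_eq[OF q0 N_ge_1] c_def power_add by (simp only: mult_ac)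
  qed
  have T3: "hpoch 1 (t / q) (q ^ N) (n - r) = (1 + t / q) * a"
    unfolding k hpoch_t_over_q_Suc[OF q0 N_ge_1] by (simp add: a_def)
  have T4: "hpoch (t * q ^ (N - 1)) 1 (q ^ N) r = (1 + t * q ^ (N - 1)) * (c * P)"
  proof -
    have "(N - 1) * \<rho> + (N * (\<rho> choose 2) + \<rho>) = N * (r choose 2)"
    proof -
      have "(N - 1) * \<rho> + \<rho> = N * \<rho>" using N by (cases N) auto
      thus ?thesis by (simp add: choose algebra_simps)
    qed
    hence c: "c = q ^ ((N - 1) * \<rho>) * q ^ (N * (\<rho> choose 2) + \<rho>)"
      unfolding c_def by (simp only: power_add[symmetric])
    show ?thesis
      unfolding c unfolding \<rho> hpoch_top_Suc[OF q0 N_ge_1] hpoch_t_q_eq[OF q0 N_ge_1] P_def[symmetric] by (simp only: mult_ac)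
  qed
  have S1: "q ^ (r - 1) * (q + t) = q ^ r * (1 + t / q)" using scale[of \<rho>] by (simp add: \<rho>)
  have S2: "q ^ ((n - r) * (N - 1) - 1) * (q + t) = q ^ ((N - 1) * (n - r)) * (1 + t / q)"
  proof -
    have "Suc ((n - r) * (N - 1) - 1) = (N - 1) * (n - r)" using N r by (simp add: mult.commute)
    thus ?thesis using scale[of "(n - r) * (N - 1) - 1"] by simp
  qed
  have G': "G = (x - y) / (1 - x)" using G x1 by (simp add: x_def eq_divide_eq mult.commute)
  let ?v = "1 + t * q ^ (N - 1)" and ?A = "1 + t * q ^ ((n - r) * N - 1)" and ?u = "1 + t / q"
  let ?E = "q ^ ((N - 1) * (n - r))"
  have "(hpoch 1 (t * q ^ (N - 1)) (q ^ N) (n - r) * hpoch t q (q ^ N) r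
       + G * hpoch 1 (t / q) (q ^ N) (n - r) * hpoch t q (q ^ N) r
       + ?E * hpoch 1 (t / q) (q ^ N) (n - r) * hpoch (t * q ^ (N - 1)) 1 (q ^ N) r)
      = c * (P * a) * (q ^ r * ?A * w + G * (q ^ r * ?u) * w + (?E * ?u) * ?v)"
    unfolding T1 T2 T3 T4 by (simp add: algebra_simps)
  also have "q ^ r * ?A * w + G * (q ^ r * ?u) * w + (?E * ?u) * ?v =
      (q ^ r * ?A * w * (1 - x) + (?E * ?u) * ?v * (1 - x) + (q ^ r * ?u) * w * (x - y)) / (1 - x)"
    unfolding G' using x1 by (simp add: add_divide_distrib mult_ac)
  finally have "(hpoch 1 (t * q ^ (N - 1)) (q ^ N) (n - r) * hpoch t q (q ^ N) r
       + G * hpoch 1 (t / q) (q ^ N) (n - r) * hpoch t q (q ^ N) r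
       + ?E * hpoch 1 (t / q) (q ^ N) (n - r) * hpoch (t * q ^ (N - 1)) 1 (q ^ N) r) / D =
      c * (P * a / (D * (1 - x)))
        * (q ^ r * ?A * w * (1 - x) + (?E * ?u) * ?v * (1 - x) + (q ^ r * ?u) * w * (x - y))"
    by (simp add: mult_ac)
  also have "q ^ r * ?A * w * (1 - x) + (?E * ?u) * ?v * (1 - x) + (q ^ r * ?u) * w * (x - y) =
      q ^ r * ?A * w * (1 - x) + q ^ ((n - r) * (N - 1) - 1) * ?v * (1 - x) * (q + t)
       + q ^ (r - 1) * w * (q + t) * (x - y)"
    unfolding S1[symmetric] S2[symmetric] by (simp only: mult_ac)
  finally show ?thesis
    unfolding q_pochhammer_t_q_pred k(2) a_def D_def c_def P_def w_def x_def by (simp add: \<rho> mult_ac)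
qed

lemma hpoch_t_q_split_last:
  assumes "n \<ge> 1"
  shows "hpoch t q (q ^ N) n = q ^ (N * ((n - 1) choose 2) + n - 1)
    * q_pochhammer (- t * q powi (- 1)) (q powi (- int N)) (n - 1) * (q ^ (N * (n - 1) + 1) + t)"
proof -
  obtain \<nu> where \<nu>: "n = Suc \<nu>" using assms by (cases n) auto
  show ?thesis
    unfolding \<nu> hpoch_Suc hpoch_t_q_eq[OF q0 N_ge_1] by (simp add: power_mult add.commute)
qed

lemma closed_form_top_d_ge_2:
  assumes n: "n \<ge> 1" and G: "(1 - x) * G = x - q ^ (N * n)" and x: "x = q ^ m" "m \<ge> 1"
  shows "(hpoch t q (q ^ N) n + G * hpoch t q (q ^ N) n) / q_pochhammer (q ^ N) (q ^ N) n =
    q ^ (N * ((n - 1) choose 2) + n - 1)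
      * (q_pochhammer (- t * q powi (- 1)) (q powi (- int N)) (n - 1)
         / (q_pochhammer (q ^ N) (q ^ N) (n - 1) * (1 - x))) * (q ^ (N * (n - 1) + 1) + t)"
proof -
  define y where "y = q ^ (N * n)"
  have x1: "1 - x \<noteq> 0" unfolding x(1) by (rule nonroot[OF x(2)])
  have y1: "1 - y \<noteq> 0" unfolding y_def using N n by (intro nonroot) simp
  have D: "q_pochhammer (q ^ N) (q ^ N) n = q_pochhammer (q ^ N) (q ^ N) (n - 1) * (1 - y)"
    using denom_Suc[of "n - 1"] n by (simp add: y_def)
  have "(1 - x) * (1 + G) = (1 - x) + (1 - x) * G" by (simp add: algebra_simps)
  also have "\<dots> = 1 - y" unfolding G y_def by simp
  finally have key: "1 + G = (1 - y) / (1 - x)" using x1 by (simp add: eq_divide_eq mult.commute)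
  have "hpoch t q (q ^ N) n + G * hpoch t q (q ^ N) n = hpoch t q (q ^ N) n * (1 + G)"
    by (simp add: algebra_simps)
  thus ?thesis unfolding D key hpoch_t_q_split_last[OF n] using y1 x1 denom_nonzero[of "n - 1"]
    by (simp add: mult_ac)
qed

lemma closed_form_top_d_eq_1:
  assumes n: "n \<ge> 1" and G: "(1 - q ^ n) * G = q ^ n - q ^ (n * (N - 1))"
  shows "(hpoch t q (q ^ N) n + G * hpoch t q (q ^ N) n + hpoch (t * q ^ (N - 1)) 1 (q ^ N) n)
      / q_pochhammer (q ^ N) (q ^ N) n =
    q ^ (N * ((n - 1) choose 2) + n - 1)
      * (q_pochhammer (- t * q powi (- 1)) (q powi (- int N)) (n - 1)
         / (q_pochhammer (q ^ N) (q ^ N) (n - 1) * (1 - q ^ n))) * (q ^ ((n - 1) * (N - 1)) + t)"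
proof -
  obtain \<nu> where \<nu>: "n = Suc \<nu>" using n by (cases n) auto
  define x y B D where "x = q ^ n" and "y = q ^ (N * n)"
    and "B = q ^ (N * ((n - 1) choose 2) + n - 1) * q_pochhammer (- t * q powi (- 1)) (q powi (- int N)) (n - 1)"
    and "D = q_pochhammer (q ^ N) (q ^ N) (n - 1)"
  define v f g where "v = q ^ (N * (n - 1) + 1)" and "f = q ^ ((n - 1) * (N - 1))" and "g = q ^ (N - 1)"
  have x1: "1 - x \<noteq> 0" unfolding x_def by (rule nonroot[OF n])
  have y1: "1 - y \<noteq> 0" unfolding y_def using N n by (intro nonroot) simp
  obtain N' where N': "N = Suc N'" using N by (cases N) auto
  have fx: "f * x = v" unfolding f_def x_def v_def power_add[symmetric] by (simp add: \<nu> N' algebra_simps)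
  have gfx: "g * f * x = y" unfolding f_def x_def g_def y_def power_add[symmetric] by (simp add: \<nu> N' algebra_simps)
  have gf: "q ^ (n * (N - 1)) = g * f" unfolding f_def g_def power_add[symmetric] by (simp add: \<nu> N')
  have T1: "hpoch t q (q ^ N) n = B * (v + t)" unfolding hpoch_t_q_split_last[OF n] by (simp add: B_def v_def)
  have T2: "hpoch (t * q ^ (N - 1)) 1 (q ^ N) n = (1 + t * g) * f * B"
    unfolding \<nu> hpoch_top_Suc[OF q0 N_ge_1] hpoch_t_q_eq[OF q0 N_ge_1] by (simp add: B_def f_def g_def \<nu> mult_ac)
  have D: "q_pochhammer (q ^ N) (q ^ N) n = D * (1 - y)"
    using denom_Suc[of "n - 1"] n by (simp add: y_def D_def)
  have "(1 - x) * ((v + t) * (1 + G) + (1 + t * g) * f) =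
      (v + t) * ((1 - x) + (1 - x) * G) + (1 + t * g) * f * (1 - x)"
    by (simp add: algebra_simps)
  also have "\<dots> = (v + t) * (1 - g * f) + (1 + t * g) * (f - f * x)"
  proof -
    have head: "(1 - x) + (1 - x) * G = 1 - g * f"
      using G by (simp add: x_def gf del: One_nat_def)
    have tail: "(1 + t * g) * f * (1 - x) = (1 + t * g) * (f - f * x)"
      by (simp add: algebra_simps)
    show ?thesis unfolding head tail ..
  qed
  also have "\<dots> = (1 - g * f * x) * (f + t)"
    unfolding fx[symmetric] by (simp add: algebra_simps)
  also have "\<dots> = (1 - y) * (f + t)" unfolding gfx ..
  finally have key: "(v + t) * (1 + G) + (1 + t * g) * f = (1 - y) * (f + t) / (1 - x)"
    using x1 by (simp add: eq_divide_eq mult.commute)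
  have "B * (v + t) + G * (B * (v + t)) + (1 + t * g) * f * B = B * ((v + t) * (1 + G) + (1 + t * g) * f)"
    by (simp add: algebra_simps)
  hence "(hpoch t q (q ^ N) n + G * hpoch t q (q ^ N) n + hpoch (t * q ^ (N - 1)) 1 (q ^ N) n)
      / q_pochhammer (q ^ N) (q ^ N) n = B * ((1 - y) * (f + t) / (1 - x)) / (D * (1 - y))"
    unfolding T1 T2 D key by simp
  also have "\<dots> = B * (f + t) / (D * (1 - x))" using y1 by simp
  finally show ?thesis by (simp add: B_def D_def f_def x_def)
qed

end

theorem corollary3p18:
  fixes d e n :: nat and q t :: "rat fls fls" and H :: "nat \<Rightarrow> rat fls fls"
  assumes "d \<ge> 1" and "e \<ge> 1" and "n \<ge> 2" and "d * e \<ge> 2"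
    and q: "q = fls_X" and t: "t = fls_const fls_X"
    and H: "\<And>r. H r = hilbert_series n (G_group d e n) r"
  shows
    "H 0 = q_pochhammer (- t * q ^ (d * e - 1)) (q ^ (d * e)) (n - 1) * (1 + t * q ^ (d * n - 1))
         / (q_pochhammer (q ^ (d * e)) (q ^ (d * e)) (n - 1) * (1 - q ^ (d * n)))
     \<and> (\<forall>r. 1 \<le> r \<and> r \<le> n - 1 \<and> d \<ge> 2 \<longrightarrow>
        H r = q ^ (d * e * (r choose 2) + r)
          * (q_pochhammer (- t * q powi (- 1)) (q powi (- int (d * e))) r
             * q_pochhammer (- t * q ^ (d * e - 1)) (q ^ (d * e)) (n - 1 - r)
             / (q_pochhammer (q ^ (d * e)) (q ^ (d * e)) r
                * q_pochhammer (q ^ (d * e)) (q ^ (d * e)) (n - r) * (1 - q ^ (d * n))))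
          * (1 - q ^ (d * e * n)
             + t * q powi (- 1)
               * (q ^ (d * e * (n - r)) * (1 - q ^ (d * n)) + q ^ (d * n) - q ^ (d * e * n))))
     \<and> (\<forall>r. 1 \<le> r \<and> r \<le> n - 1 \<and> d = 1 \<longrightarrow>
        H r = q ^ (e * (r choose 2))
          * (q_pochhammer (- t * q powi (- 1)) (q powi (- int e)) (r - 1)
             * q_pochhammer (- t * q ^ (e - 1)) (q ^ e) (n - 1 - r)
             / (q_pochhammer (q ^ e) (q ^ e) r * q_pochhammer (q ^ e) (q ^ e) (n - r) * (1 - q ^ n)))
          * (q ^ r * (1 + t * q ^ ((n - r) * e - 1))
               * (1 + t * q powi (- (int r - 1) * int e - 1)) * (1 - q ^ n)
             + q ^ ((n - r) * (e - 1) - 1) * (1 + t * q ^ (e - 1)) * (1 - q ^ n) * (q + t)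
             + q ^ (r - 1) * (1 + t * q powi (- (int r - 1) * int e - 1)) * (q + t)
               * (q ^ n - q ^ (n * (e - 1)))))
     \<and> H n = q ^ (d * e * ((n - 1) choose 2) + n - 1)
          * (q_pochhammer (- t * q powi (- 1)) (q powi (- int (d * e))) (n - 1)
             / (q_pochhammer (q ^ (d * e)) (q ^ (d * e)) (n - 1) * (1 - q ^ (d * n))))
          * (if d \<ge> 2 then q ^ (d * e * (n - 1) + 1) + t else q ^ ((n - 1) * (e - 1)) + t)"
proof -
  note qt = q t
  define N where "N = d * e"
  have N: "N \<ge> 2" using assms(4) by (simp add: N_def)
  have n1: "n \<ge> 1" using assms(3) by simp
  have q0: "q \<noteq> 0" by (simp add: q)
  have nonroot: "1 - q ^ m \<noteq> 0" if "m \<ge> 1" for m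
    unfolding q by (rule one_minus_fls_X_power_nonzero[OF that])
  have dn: "d * n \<ge> 1" using assms(1) n1 by simp
  define S where "S m = (\<Sum>s=1..<m. (q ^ (d * n)) ^ s)" for m
  have S: "(1 - q ^ (d * n)) * S m = q ^ (d * n) - (q ^ (d * n)) ^ m" if "m \<ge> 1" for m
    using geometric_sum_from_1[of "q ^ (d * n)" "m - 1"] that by (simp add: S_def)
  have S_e: "(1 - q ^ (d * n)) * S e = q ^ (d * n) - q ^ (N * n)"
    unfolding S[OF assms(2)] by (simp add: N_def power_mult[symmetric] mult_ac)
  have H_ge_2: "H r = (hpoch 1 (t * q ^ (N - 1)) (q ^ N) (n - r) * hpoch t q (q ^ N) r
       + S e * hpoch 1 (t / q) (q ^ N) (n - r) * hpoch t q (q ^ N) r)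
      / (q_pochhammer (q ^ N) (q ^ N) (n - r) * q_pochhammer (q ^ N) (q ^ N) r)"
    if "d \<ge> 2" "r \<le> n" for r
    unfolding H hilbert_series_d_ge_2[OF qt that(1) assms(2) n1 that(2)] N_def S_def ..
  have H_eq_1: "H r = (hpoch 1 (t * q ^ (N - 1)) (q ^ N) (n - r) * hpoch t q (q ^ N) r
       + S (e - 1) * hpoch 1 (t / q) (q ^ N) (n - r) * hpoch t q (q ^ N) r
       + q ^ ((N - 1) * (n - r)) * hpoch 1 (t / q) (q ^ N) (n - r) * hpoch (t * q ^ (N - 1)) 1 (q ^ N) r)
      / (q_pochhammer (q ^ N) (q ^ N) (n - r) * q_pochhammer (q ^ N) (q ^ N) r)"
    if "d = 1" "r \<le> n" for r
  proof -
    have "e \<ge> 2" using assms(4) that(1) by simp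
    from hilbert_series_d_eq_1[OF qt this n1 that(2)] show ?thesis
      unfolding H N_def S_def that(1) by simp
  qed
  have S_1: "(1 - q ^ n) * S (e - 1) = q ^ n - q ^ (n * (e - 1))" if "d = 1"
  proof -
    have "e - 1 \<ge> 1" using assms(4) that by simp
    from S[OF this] show ?thesis by (simp add: that power_mult)
  qed
  have "H 0 = q_pochhammer (- t * q ^ (d * e - 1)) (q ^ (d * e)) (n - 1) * (1 + t * q ^ (d * n - 1))
         / (q_pochhammer (q ^ (d * e)) (q ^ (d * e)) (n - 1) * (1 - q ^ (d * n)))"
  proof -
    have "H 0 = (hpoch 1 (t * q ^ (N - 1)) (q ^ N) n + S e * hpoch 1 (t / q) (q ^ N) n)
        / q_pochhammer (q ^ N) (q ^ N) n"
    proof (cases "d = 1")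
      case False
      hence "d \<ge> 2" using assms(1) by simp
      from H_ge_2[OF this, of 0] show ?thesis by (simp add: q_pochhammer_def)
    next
      case True
      \<comment> \<open>without letters whose second bit is set, the sector $s = e - 1$ is generic too\<close>
      have "S e = S (e - 1) + q ^ ((N - 1) * n)"
      proof -
        define e' where "e' = e - 2"
        have e': "e = Suc (Suc e')" using assms(4) True by (simp add: e'_def)
        show ?thesis by (simp add: S_def e' N_def True power_mult[symmetric] mult_ac)
      qed
      thus ?thesis using H_eq_1[OF True, of 0] by (simp add: q_pochhammer_def algebra_simps)
    qed
    thus ?thesis using closed_form_r_0[OF q0 N nonroot n1 S_e refl dn] by (simp add: N_def)
  qed
  moreover have "H r = q ^ (d * e * (r choose 2) + r)
          * (q_pochhammer (- t * q powi (- 1)) (q powi (- int (d * e))) r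
             * q_pochhammer (- t * q ^ (d * e - 1)) (q ^ (d * e)) (n - 1 - r)
             / (q_pochhammer (q ^ (d * e)) (q ^ (d * e)) r
                * q_pochhammer (q ^ (d * e)) (q ^ (d * e)) (n - r) * (1 - q ^ (d * n))))
          * (1 - q ^ (d * e * n)
             + t * q powi (- 1)
               * (q ^ (d * e * (n - r)) * (1 - q ^ (d * n)) + q ^ (d * n) - q ^ (d * e * n)))"
    if r: "1 \<le> r \<and> r \<le> n - 1 \<and> d \<ge> 2" for r
  proof -
    have "r < n" "r \<le> n" "d \<ge> 2" using r n1 by auto
    thus ?thesis
      using closed_form_middle_d_ge_2[OF q0 N nonroot \<open>r < n\<close> S_e refl dn] H_ge_2[of r]
      unfolding N_def by (simp only:)
  qed
  moreover have "H r = q ^ (e * (r choose 2))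
          * (q_pochhammer (- t * q powi (- 1)) (q powi (- int e)) (r - 1)
             * q_pochhammer (- t * q ^ (e - 1)) (q ^ e) (n - 1 - r)
             / (q_pochhammer (q ^ e) (q ^ e) r * q_pochhammer (q ^ e) (q ^ e) (n - r) * (1 - q ^ n)))
          * (q ^ r * (1 + t * q ^ ((n - r) * e - 1))
               * (1 + t * q powi (- (int r - 1) * int e - 1)) * (1 - q ^ n)
             + q ^ ((n - r) * (e - 1) - 1) * (1 + t * q ^ (e - 1)) * (1 - q ^ n) * (q + t)
             + q ^ (r - 1) * (1 + t * q powi (- (int r - 1) * int e - 1)) * (q + t)
               * (q ^ n - q ^ (n * (e - 1))))"
    if r: "1 \<le> r \<and> r \<le> n - 1 \<and> d = 1" for r
  proof -
    have *: "1 \<le> r" "r < n" "r \<le> n" "d = 1" using r n1 by auto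
    have "N = e" using * by (simp add: N_def)
    thus ?thesis
      using closed_form_middle_d_eq_1[OF q0 N nonroot *(1,2) S_1[OF *(4)]] H_eq_1[OF *(4,3)]
      by (simp only:)
  qed
  moreover have "H n = q ^ (d * e * ((n - 1) choose 2) + n - 1)
          * (q_pochhammer (- t * q powi (- 1)) (q powi (- int (d * e))) (n - 1)
             / (q_pochhammer (q ^ (d * e)) (q ^ (d * e)) (n - 1) * (1 - q ^ (d * n))))
          * (if d \<ge> 2 then q ^ (d * e * (n - 1) + 1) + t else q ^ ((n - 1) * (e - 1)) + t)"
  proof (cases "d \<ge> 2")
    case True
    have "H n = (hpoch t q (q ^ N) n + S e * hpoch t q (q ^ N) n) / q_pochhammer (q ^ N) (q ^ N) n"
      using H_ge_2[OF True, of n] by (simp add: q_pochhammer_def)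
    thus ?thesis
      using closed_form_top_d_ge_2[OF q0 N nonroot n1 S_e refl dn] True
      by (simp only: N_def if_True)
  next
    case False
    hence d: "d = 1" using assms(1) by simp
    have Ne: "N = e" by (simp add: N_def d)
    have "H n = (hpoch t q (q ^ N) n + S (e - 1) * hpoch t q (q ^ N) n + hpoch (t * q ^ (N - 1)) 1 (q ^ N) n)
        / q_pochhammer (q ^ N) (q ^ N) n"
      using H_eq_1[OF d, of n] by (simp add: q_pochhammer_def)
    also have "\<dots> = q ^ (N * ((n - 1) choose 2) + n - 1)
      * (q_pochhammer (- t * q powi (- 1)) (q powi (- int N)) (n - 1)
         / (q_pochhammer (q ^ N) (q ^ N) (n - 1) * (1 - q ^ n))) * (q ^ ((n - 1) * (N - 1)) + t)"
      by (rule closed_form_top_d_eq_1[OF q0 N nonroot n1]) (use S_1[OF d] Ne in simp_all)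
    finally show ?thesis using False by (simp only: Ne d mult_1 if_False)
  qed
  ultimately show ?thesis by blast
qed

end
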